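(* Let $N\ge 1$, let $B$ be the open unit ball of $\mathbb{R}^N$ and let $f\in C(\mathbb{R})$. Assume that there is $a\in\mathbb{R}$ with $f(a)>0$ and $f(t)\ge 0$ for all $t>a$, and, with $F(t)=\int_a^t f(s)\,ds$, that $\int^{+\infty}\frac{dt}{\sqrt{F(t)}}<+\infty$. Assume in addition that $f$ is nondecreasing. Then there exists a unique large solution of $\Delta u=f(u)$ in $B$.
   Context: A large solution of $\Delta u=f(u)$ in $B$ is a function $u\in C(B)$ satisfying $\Delta u=f(u)$ in $B$ in the sense of distributions and $\lim_{x\to x_0,\,x\in B}u(x)=+\infty$ for every $x_0\in\partial B$. The notation $\int^{+\infty}\frac{dt}{\sqrt{F(t)}}<+\infty$ means that the integral converges at $+\infty$. *)

theory Defs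
  imports "HOL-Analysis.Analysis"
begin

definition partial_deriv :: "'n \<Rightarrow> (real ^ 'n \<Rightarrow> real) \<Rightarrow> real ^ 'n \<Rightarrow> real" where
  "partial_deriv i \<phi> x = deriv (\<lambda>t. \<phi> (x + t *\<^sub>R axis i 1)) 0"

text \<open>A function is of class \<open>C\<^sup>\<infinity>\<close> iff all its iterated partial derivatives, indexed here by lists of
  coordinate directions, exist and are (Frechet) differentiable everywhere; their continuity is
  then automatic.\<close>

definition smooth_fun :: "(real ^ 'n::finite \<Rightarrow> real) \<Rightarrow> bool" where
  "smooth_fun \<phi> \<longleftrightarrow> (\<forall>is. foldr partial_deriv is \<phi> differentiable_on UNIV)"

text \<open>Test functions on an open set \<open>\<Omega>\<close>, identified with their extensions by zero to the whole space.\<close>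

definition test_function :: "(real ^ 'n::finite) set \<Rightarrow> (real ^ 'n \<Rightarrow> real) \<Rightarrow> bool" where
  "test_function \<Omega> \<phi> \<longleftrightarrow>
     smooth_fun \<phi> \<and> compact (closure {x. \<phi> x \<noteq> 0}) \<and> closure {x. \<phi> x \<noteq> 0} \<subseteq> \<Omega>"

definition laplacian :: "(real ^ 'n::finite \<Rightarrow> real) \<Rightarrow> real ^ 'n \<Rightarrow> real" where
  "laplacian \<phi> x = (\<Sum>i\<in>UNIV. partial_deriv i (partial_deriv i \<phi>) x)"

text \<open>The equation \<open>\<Delta>u = g\<close> in the sense of distributions on \<open>\<Omega>\<close>. It is meant for locally integrable
  \<open>u\<close> and \<open>g\<close> (below both are continuous on \<open>\<Omega>\<close>), for which both integrals converge.\<close>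

definition distributional_laplacian ::
    "(real ^ 'n::finite) set \<Rightarrow> (real ^ 'n \<Rightarrow> real) \<Rightarrow> (real ^ 'n \<Rightarrow> real) \<Rightarrow> bool" where
  "distributional_laplacian \<Omega> u g \<longleftrightarrow>
     (\<forall>\<phi>. test_function \<Omega> \<phi> \<longrightarrow>
        (LINT x:\<Omega>|lborel. u x * laplacian \<phi> x) = (LINT x:\<Omega>|lborel. g x * \<phi> x))"

definition large_solution ::
    "(real \<Rightarrow> real) \<Rightarrow> (real ^ 'n::finite) set \<Rightarrow> (real ^ 'n \<Rightarrow> real) \<Rightarrow> bool" where
  "large_solution f \<Omega> u \<longleftrightarrow>
     continuous_on \<Omega> u \<and>
     distributional_laplacian \<Omega> u (\<lambda>x. f (u x)) \<and>
     (\<forall>x0\<in>frontier \<Omega>. filterlim u at_top (at x0 within \<Omega>))"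

text \<open>Convergence at \<open>+\<infinity>\<close> of the integral of a function that is nonnegative near \<open>+\<infinity>\<close>; nothing is
  required of \<open>g\<close> away from \<open>+\<infinity>\<close>.\<close>

definition integral_converges_at_top :: "(real \<Rightarrow> real) \<Rightarrow> bool" where
  "integral_converges_at_top g \<longleftrightarrow> (\<exists>b. set_integrable lborel {b..} g)"

end

theory Submission
  imports Defs
begin

text \<open>
  In the variable \<open>s = |x|\<^sup>2\<close> a radial solution \<open>V(|x|\<^sup>2)\<close> solves \<open>4 s V'' + 2 N V' = f(V)\<close>, that is,
  \<open>V' = K (f \<circ> V)\<close> with the monotone, dilation-invariant averaging operator
  \<open>(K h)(s) = 1/2 \<integral>\<^sub>0\<^sup>1 \<rho>\<^sup>N\<^sup>-\<^sup>1 h(s \<rho>\<^sup>2) d\<rho>\<close>.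

  Existence. If \<open>f\<close> is replaced by a bounded positive nondecreasing nonlinearity, monotone iteration
  yields minimal solutions \<open>V\<^sub>v\<close> with \<open>V\<^sub>v 0 = v\<close>, and dilating them shows that \<open>v \<mapsto> V\<^sub>v 1\<close> takes every value.
  Positivity is essential here because the initial value problem may be ill-posed where \<open>f\<close> vanishes.
  The solutions with \<open>V\<^sub>n 1 = n\<close> for truncations of \<open>max 0 f + 1/(n+1)\<close> increase with \<open>n\<close> and are locally
  bounded by the Keller--Osserman estimate; their limit is a radial large solution \<open>W\<close>.

  Uniqueness. Let \<open>u\<close> be any large solution. Shifting \<open>W\<close> by a suitable concave change of the variable \<open>s\<close>
  gives strict super- and subsolutions near the boundary that blow up inside the ball or stay bounded
  up to its boundary. Comparison shows that a positive maximum of \<open>\<plusminus>(u - W)\<close> is attained on every sphere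
  near the boundary. At such points \<open>f(W \<plusminus> M) = f(W)\<close>, so \<open>f\<close> is eventually constant, contradicting
  the integral condition. Since \<open>u\<close> is only a continuous distributional solution, these comparisons use that it
  is a viscosity solution.\<close>

section \<open>Radial solutions of the Poisson equation\<close>

text \<open>The operator K comes from writing 4 s V'' + 2 N V' as 4 s^(1 - N/2) (s^(N/2) V')' and
  integrating once: V' is s^(-N/2) / 4 times the integral of t^(N/2 - 1) h(t) over [0, s], and t = s
  \<rho>^2 turns this into K h. The singularity at the origin has disappeared from this form. Since
  x \<bullet> x is a polynomial in x, functions of it can be differentiated at 0 without handling
  the norm. The proof is shaped by f being merely continuous and nondecreasing. Without a Lipschitz
  bound, comparison of minimal solutions with supersolutions replaces uniqueness, and dilation
  replaces continuous dependence on the initial value. As f may be constant on intervals, u > W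
  gives no strict inequality between f(u) and f(W), so strictness must be built into the comparison
  functions; near the boundary it is paid for by f(W) > 0. Without convexity of f, multiples of W
  need not be supersolutions, which is why the variable is changed and not the value.\<close>

definition radial_mean :: "nat \<Rightarrow> (real \<Rightarrow> real) \<Rightarrow> real \<Rightarrow> real" where
  "radial_mean N h s = integral {0..1} (\<lambda>\<rho>. \<rho> ^ (N - 1) * h (s * \<rho>\<^sup>2)) / 2"

lemma scaled_square_mem:
  fixes s S \<rho> :: real
  assumes "s \<in> {0..S}" "\<rho> \<in> {0..1}"
  shows "s * \<rho>\<^sup>2 \<in> {0..S}" "s * \<rho>\<^sup>2 \<le> s"
proof -
  have "\<rho>\<^sup>2 \<le> 1" using assms by (simp add: power_le_one)
  then show "s * \<rho>\<^sup>2 \<le> s" using assms mult_left_mono[of "\<rho>\<^sup>2" 1 s] by simp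
  then show "s * \<rho>\<^sup>2 \<in> {0..S}" using assms by auto
qed

lemma continuous_on_radial_integrand:
  fixes h :: "real \<Rightarrow> real"
  assumes "continuous_on {0..S} h" "s \<in> {0..S}"
  shows "continuous_on {0..1} (\<lambda>\<rho>. \<rho> ^ (N - 1) * h (s * \<rho>\<^sup>2))"
  using scaled_square_mem[OF assms(2)]
  by (intro continuous_intros continuous_on_compose2[OF assms(1)]) auto

lemma radial_integrand_integrable:
  fixes h :: "real \<Rightarrow> real"
  assumes "continuous_on {0..S} h" "s \<in> {0..S}"
  shows "(\<lambda>\<rho>. \<rho> ^ (N - 1) * h (s * \<rho>\<^sup>2)) integrable_on {0..1}"
  using continuous_on_radial_integrand[OF assms] by (rule integrable_continuous_interval)

lemma continuous_on_radial_mean: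
  assumes "continuous_on {0..S} h"
  shows "continuous_on {0..S} (radial_mean N h)"
proof -
  have "continuous_on ({0..S} \<times> cbox 0 1) (\<lambda>(s, \<rho>). \<rho> ^ (N - 1) * h (s * \<rho>\<^sup>2))"
    unfolding split_beta
    using scaled_square_mem
    by (intro continuous_intros continuous_on_compose2[OF assms]) (force simp: mem_Times_iff)+
  from integral_continuous_on_param[OF this] show ?thesis
    unfolding radial_mean_def[abs_def] by (auto intro!: continuous_intros)
qed

lemma radial_mean_mono:
  assumes "continuous_on {0..S} h" "continuous_on {0..S} k" "s \<in> {0..S}"
    and "\<And>t. t \<in> {0..s} \<Longrightarrow> h t \<le> k t"
  shows "radial_mean N h s \<le> radial_mean N k s"
proof -
  have "integral {0..1} (\<lambda>\<rho>. \<rho> ^ (N - 1) * h (s * \<rho>\<^sup>2)) \<le> integral {0..1} (\<lambda>\<rho>. \<rho> ^ (N - 1) * k (s * \<rho>\<^sup>2))"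
    using scaled_square_mem[of s s] assms(3,4)
    by (intro integral_le radial_integrand_integrable[of S] assms mult_left_mono) auto
  then show ?thesis by (simp add: radial_mean_def)
qed

lemma integral_power_unit:
  "integral {0..1} (\<lambda>\<rho>::real. \<rho> ^ (N - 1)) = 1 / real N" if "N > 0"
proof -
  have "((\<lambda>\<rho>::real. \<rho> ^ (N - 1)) has_integral (1 ^ N / real N - 0 ^ N / real N)) {0..1}"
    using that
    by (intro fundamental_theorem_of_calculus)
       (auto intro!: derivative_eq_intros simp flip: has_real_derivative_iff_has_vector_derivative)
  then show ?thesis using that by (auto simp: integral_unique)
qed

lemma radial_mean_const: "radial_mean N (\<lambda>_. c) s = c / (2 * real N)" if "N > 0"
  using integral_power_unit[OF that] by (simp add: radial_mean_def)

lemma radial_mean_zero: "radial_mean N h 0 = h 0 / (2 * real N)" if "N > 0"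
  using integral_power_unit[OF that] by (simp add: radial_mean_def)

lemma radial_mean_scale: "radial_mean N h (c * s) = radial_mean N (\<lambda>t. h (c * t)) s"
  by (simp add: radial_mean_def mult.assoc)

lemma radial_mean_cmult: "radial_mean N (\<lambda>t. c * h t) s = c * radial_mean N h s"
proof -
  have "(\<lambda>\<rho>. \<rho> ^ (N - 1) * (c * h (s * \<rho>\<^sup>2))) = (\<lambda>\<rho>. c * (\<rho> ^ (N - 1) * h (s * \<rho>\<^sup>2)))"
    by (auto simp: mult_ac)
  then show ?thesis by (simp add: radial_mean_def)
qed

lemma radial_mean_bounds:
  assumes "continuous_on {0..S} h" "s \<in> {0..S}" "N > 0"
    and "\<And>t. t \<in> {0..s} \<Longrightarrow> l \<le> h t" "\<And>t. t \<in> {0..s} \<Longrightarrow> h t \<le> u"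
  shows "l / (2 * real N) \<le> radial_mean N h s" "radial_mean N h s \<le> u / (2 * real N)"
  using radial_mean_mono[of S "\<lambda>_. l" h s N] radial_mean_mono[of S h "\<lambda>_. u" s N] assms
  by (auto simp: radial_mean_const)

text \<open>As h is only continuous, one cannot differentiate under the integral. The substitution r
  = sqrt s * \<rho> moves s into an upper limit and a power of sqrt s in front; the quotient rule
  then gives 4 s m' + 2 N m = h for the mean m.\<close>

lemma radial_mean_has_derivative:
  assumes h: "continuous_on {0..S} h" and s: "0 < s" "s < S" and N: "N > 0"
  shows "(radial_mean N h has_real_derivative (h s - 2 * real N * radial_mean N h s) / (4 * s)) (at s)"
proof -
  define G where "G r = integral {0..r} (\<lambda>t. t ^ (N - 1) * h (t\<^sup>2))" for r
  have cG: "continuous_on {0..sqrt S} (\<lambda>t. t ^ (N - 1) * h (t\<^sup>2))"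
  proof (intro continuous_intros continuous_on_compose2[OF h] image_subsetI)
    fix x assume "x \<in> {0..sqrt S}"
    then show "x\<^sup>2 \<in> {0..S}" using s power_mono[of x "sqrt S" 2] by auto
  qed
  have eq: "radial_mean N h t = G (sqrt t) / (2 * sqrt t ^ N)" if t: "t \<in> {0<..<S}" for t
  proof -
    have "((\<lambda>\<rho>. sqrt t *\<^sub>R ((sqrt t * \<rho>) ^ (N - 1) * h ((sqrt t * \<rho>)\<^sup>2))) has_integral
        integral {sqrt t * 0..sqrt t * 1} (\<lambda>t. t ^ (N - 1) * h (t\<^sup>2))) {0..1}"
      using t by (intro has_integral_substitution[where c=0 and d="sqrt S"] cG)
        (auto intro!: derivative_eq_intros mult_left_le order_trans[OF mult_left_le, of _ "sqrt t"])
    then have "((\<lambda>\<rho>. sqrt t ^ N * (\<rho> ^ (N - 1) * h (t * \<rho>\<^sup>2))) has_integral G (sqrt t)) {0..1}"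
      using t N by (simp add: G_def power_mult_distrib mult_ac power_eq_if[of _ N])
    then have "integral {0..1} (\<lambda>\<rho>. sqrt t ^ N * (\<rho> ^ (N - 1) * h (t * \<rho>\<^sup>2))) = G (sqrt t)"
      by (rule integral_unique)
    then show ?thesis using t by (simp add: radial_mean_def field_simps)
  qed
  have r: "0 < sqrt s" "sqrt s < sqrt S" using s by auto
  have "(G has_real_derivative sqrt s ^ (N - 1) * h ((sqrt s)\<^sup>2)) (at (sqrt s) within {0..sqrt S})"
    unfolding G_def using r by (intro integral_has_real_derivative cG) auto
  moreover have "at (sqrt s) within {0..sqrt S} = at (sqrt s)"
    using r by (intro at_within_interior) auto
  ultimately have dG: "(G has_real_derivative sqrt s ^ (N - 1) * h s) (at (sqrt s))"
    using s by simp
  have "((\<lambda>t. G (sqrt t) / (2 * sqrt t ^ N)) has_real_derivative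
      (h s - 2 * real N * radial_mean N h s) / (4 * s)) (at s)"
  proof -
    obtain M where M: "N = Suc M" using N by (cases N) auto
    define q where "q = sqrt s"
    have q: "q > 0" "s = q * q" using s by (auto simp: q_def)
    have dq: "(sqrt has_real_derivative inverse q / 2) (at s)"
      using DERIV_real_sqrt[OF s(1)] by (simp add: q_def)
    have 1: "((\<lambda>t. G (sqrt t)) has_real_derivative (q ^ M * h s) * (inverse q / 2)) (at s)"
      using DERIV_chain2[OF _ dq, of G "q ^ M * h s"] dG by (simp add: q_def M)
    have e: "radial_mean N h s = G q / (2 * q ^ N)" using eq[of s] s by (simp add: q_def)
    have 2: "((\<lambda>t. 2 * sqrt t ^ N) has_real_derivative 2 * (real N * (inverse q / 2) * q ^ M)) (at s)"
      using DERIV_cmult[OF DERIV_power[OF dq, of N], of 2] by (simp add: q_def M mult_ac)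
    have "(h s - 2 * real N * radial_mean N h s) / (4 * s) =
       ((q ^ M * h s) * (inverse q / 2) * (2 * q ^ N) - G q * (2 * (real N * (inverse q / 2) * q ^ M)))
         / ((2 * q ^ N) * (2 * q ^ N))"
      unfolding e using q(1) by (simp add: q(2)[symmetric] M) (simp add: q(2) field_simps)
    moreover have "2 * sqrt s ^ N \<noteq> 0" using r by simp
    ultimately show ?thesis using DERIV_divide[OF 1 2] by (auto simp only: q_def)
  qed
  then show ?thesis
    by (rule has_field_derivative_transform_within_open[where S="{0<..<S}"]) (use s eq in auto)
qed

lemma radial_mean_tendsto:
  assumes "\<And>n. continuous_on {0..S} (h n)" "\<And>n t. t \<in> {0..S} \<Longrightarrow> \<bar>h n t\<bar> \<le> C"
    and "\<And>t. t \<in> {0..S} \<Longrightarrow> (\<lambda>n. h n t) \<longlonglongrightarrow> k t" and s: "s \<in> {0..S}"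
  shows "(\<lambda>n. radial_mean N (h n) s) \<longlonglongrightarrow> radial_mean N k s"
  unfolding radial_mean_def
proof (intro tendsto_divide tendsto_const)
  show "(\<lambda>n. integral {0..1} (\<lambda>\<rho>. \<rho> ^ (N - 1) * h n (s * \<rho>\<^sup>2))) \<longlonglongrightarrow> integral {0..1} (\<lambda>\<rho>. \<rho> ^ (N - 1) * k (s * \<rho>\<^sup>2))"
  proof (rule dominated_convergence(2)[where h="\<lambda>_. C"])
    show "(\<lambda>\<rho>. \<rho> ^ (N - 1) * h n (s * \<rho>\<^sup>2)) integrable_on {0..1}" for n
      by (rule radial_integrand_integrable[OF assms(1) s])
    fix \<rho> :: real assume \<rho>: "\<rho> \<in> {0..1}"
    show "norm (\<rho> ^ (N - 1) * h n (s * \<rho>\<^sup>2)) \<le> C" for n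
    proof -
      have "\<bar>\<rho> ^ (N - 1)\<bar> * \<bar>h n (s * \<rho>\<^sup>2)\<bar> \<le> 1 * C"
        using \<rho> by (intro mult_mono assms(2) scaled_square_mem(1)[OF s]) (auto simp: power_le_one)
      then show ?thesis by (simp add: abs_mult)
    qed
    show "(\<lambda>n. \<rho> ^ (N - 1) * h n (s * \<rho>\<^sup>2)) \<longlonglongrightarrow> \<rho> ^ (N - 1) * k (s * \<rho>\<^sup>2)"
      using \<rho> by (intro tendsto_intros assms(3) scaled_square_mem(1)[OF s])
  qed auto
qed auto

lemma radial_mean_integrable:
  assumes "continuous_on {0..S} h" "s \<le> S"
  shows "radial_mean N h integrable_on {0..s}"
  by (intro integrable_continuous_interval continuous_on_subset[OF continuous_on_radial_mean[OF assms(1)]])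
     (use assms(2) in auto)

lemma radial_integral_tendsto:
  assumes "\<And>n. continuous_on {0..S} (h n)" "\<And>n t. t \<in> {0..S} \<Longrightarrow> \<bar>h n t\<bar> \<le> C"
    and "\<And>t. t \<in> {0..S} \<Longrightarrow> (\<lambda>n. h n t) \<longlonglongrightarrow> k t" and s: "s \<in> {0..S}" and N: "N > 0"
  shows "(\<lambda>n. integral {0..s} (radial_mean N (h n))) \<longlonglongrightarrow> integral {0..s} (radial_mean N k)"
proof (rule dominated_convergence(2)[where h="\<lambda>_. C / (2 * real N)"])
  show "radial_mean N (h n) integrable_on {0..s}" for n
    using s by (intro radial_mean_integrable[OF assms(1)]) auto
  fix t assume t: "t \<in> {0..s}"
  show "norm (radial_mean N (h n) t) \<le> C / (2 * real N)" for n
    using radial_mean_bounds[OF assms(1)[of n] _ N, of t "-C" C] assms(2)[of _ n] t s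
    by (force simp: abs_le_iff)
  show "(\<lambda>n. radial_mean N (h n) t) \<longlonglongrightarrow> radial_mean N k t"
    using t s by (intro radial_mean_tendsto[OF assms(1-3)]) auto
qed auto

definition radial_integral :: "nat \<Rightarrow> (real \<Rightarrow> real) \<Rightarrow> real \<Rightarrow> real" where
  "radial_integral N h s = integral {0..s} (radial_mean N h)"

lemma radial_integral_0 [simp]: "radial_integral N h 0 = 0"
  by (simp add: radial_integral_def)

lemma radial_integral_has_derivative:
  assumes "continuous_on {0..S} h" "s \<in> {0..S}"
  shows "(radial_integral N h has_real_derivative radial_mean N h s) (at s within {0..S})"
  unfolding radial_integral_def[abs_def]
  by (intro integral_has_real_derivative continuous_on_radial_mean assms)

lemma continuous_on_radial_integral:
  assumes "continuous_on {0..S} h"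
  shows "continuous_on {0..S} (radial_integral N h)"
  using radial_integral_has_derivative[OF assms]
  by (meson DERIV_continuous_on)

lemma radial_integral_mono:
  assumes "continuous_on {0..S} h" "continuous_on {0..S} k" "s \<in> {0..S}"
    and "\<And>t. t \<in> {0..s} \<Longrightarrow> h t \<le> k t"
  shows "radial_integral N h s \<le> radial_integral N k s"
  unfolding radial_integral_def
  using assms(3,4) by (intro integral_le radial_mean_integrable[of S] radial_mean_mono[of S] assms(1,2)) auto

text \<open>The mean preserves bounds up to the factor 2 N. With l = 0 this makes solutions
  monotone, with l = -C and u = C it gives them the Lipschitz constant C / (2 N).\<close>

lemma radial_integral_diff_bounds:
  assumes h: "continuous_on {0..S} h" and N: "N > 0" and st: "0 \<le> s" "s \<le> t" "t \<le> S"
    and b: "\<And>r. r \<in> {0..t} \<Longrightarrow> l \<le> h r" "\<And>r. r \<in> {0..t} \<Longrightarrow> h r \<le> u"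
  shows "l * (t - s) / (2 * real N) \<le> radial_integral N h t - radial_integral N h s"
    and "radial_integral N h t - radial_integral N h s \<le> u * (t - s) / (2 * real N)"
proof -
  have int: "radial_mean N h integrable_on {s..t}"
    by (intro integrable_continuous_interval continuous_on_subset[OF continuous_on_radial_mean[OF h]])
       (use st in auto)
  have "radial_integral N h t - radial_integral N h s = integral {s..t} (radial_mean N h)"
    using Henstock_Kurzweil_Integration.integral_combine[of 0 s t "radial_mean N h"] st
      radial_mean_integrable[OF h, of t]
    by (simp add: radial_integral_def)
  moreover have "integral {s..t} (\<lambda>_. l / (2 * real N)) \<le> integral {s..t} (radial_mean N h)"
    using st b by (intro integral_le int radial_mean_bounds(1)[OF h _ N, where u=u]) auto
  moreover have "integral {s..t} (radial_mean N h) \<le> integral {s..t} (\<lambda>_. u / (2 * real N))"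
    using st b by (intro integral_le int radial_mean_bounds(2)[OF h _ N, where l=l]) auto
  ultimately show "l * (t - s) / (2 * real N) \<le> radial_integral N h t - radial_integral N h s"
    "radial_integral N h t - radial_integral N h s \<le> u * (t - s) / (2 * real N)"
    using st by (auto simp: mult.commute)
qed

text \<open>Dilating a solution by c multiplies its right-hand side by c. For c > 1 and a positive
  right-hand side this leaves a surplus, which makes dilated solutions strict
  supersolutions.\<close>

lemma radial_integral_scale:
  assumes h: "continuous_on {0..c * s} h" and c: "c > 0" "0 \<le> s"
  shows "radial_integral N h (c * s) = c * radial_integral N (\<lambda>t. h (c * t)) s"
proof -
  have "((\<lambda>t. c *\<^sub>R radial_mean N h (c * t)) has_integral
      integral {c * 0..c * s} (radial_mean N h)) {0..s}"
    using c by (intro has_integral_substitution[where c=0 and d="c * s"] continuous_on_radial_mean h)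
      (auto intro!: derivative_eq_intros)
  then have "integral {0..c * s} (radial_mean N h) = integral {0..s} (\<lambda>t. c *\<^sub>R radial_mean N h (c * t))"
    by (intro integral_unique[symmetric]) simp
  also have "\<dots> = integral {0..s} (\<lambda>t. c * radial_mean N (\<lambda>t. h (c * t)) t)"
    by (simp add: radial_mean_scale)
  finally show ?thesis by (simp add: radial_integral_def)
qed

lemma radial_integral_cmult: "radial_integral N (\<lambda>t. c * h t) s = c * radial_integral N h s"
  by (simp add: radial_integral_def radial_mean_cmult[abs_def])

text \<open>The common Lipschitz constant C / (2 N) makes a merely pointwise limit continuous, and
  dominated convergence, for the mean and then for its integral, passes to the limit in the
  equation. Serves the Picard iterates, the shooting argument and the truncated problems.\<close>

lemma radial_solution_limit:
  assumes h: "\<And>n. continuous_on {0..S} (h n)" "\<And>n t. t \<in> {0..S} \<Longrightarrow> \<bar>h n t\<bar> \<le> C"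
    and Vn: "\<And>n t. t \<in> {0..S} \<Longrightarrow> V n t = v n + radial_integral N (h n) t"
    and lim: "\<And>t. t \<in> {0..S} \<Longrightarrow> (\<lambda>n. V n t) \<longlonglongrightarrow> W t"
    and hlim: "\<And>t. t \<in> {0..S} \<Longrightarrow> (\<lambda>n. h n t) \<longlonglongrightarrow> k t"
    and N: "N > 0" and S: "0 \<le> S"
  shows "continuous_on {0..S} W" "\<And>t. t \<in> {0..S} \<Longrightarrow> W t = W 0 + radial_integral N k t"
proof -
  have C: "0 \<le> C" using h(2)[of 0 0] S by auto
  have lip: "\<bar>V n t - V n s\<bar> \<le> C / (2 * real N) * \<bar>t - s\<bar>" if "0 \<le> s" "s \<le> t" "t \<le> S" for n s t
    using radial_integral_diff_bounds[OF h(1)[of n] N that, of "-C" C] h(2)[of _ n] that Vn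
    by (force simp: abs_le_iff)
  have lipW: "\<bar>W t - W s\<bar> \<le> C / (2 * real N) * \<bar>t - s\<bar>" if "0 \<le> s" "s \<le> t" "t \<le> S" for s t
    using that
    by (intro tendsto_upperbound[OF tendsto_rabs[OF tendsto_diff[OF lim lim]]] always_eventually allI lip) auto
  have lipW: "dist (W t) (W s) \<le> C / (2 * real N) * dist t s" if "s \<in> {0..S}" "t \<in> {0..S}" for s t
    using lipW[of s t] lipW[of t s] that by (cases "s \<le> t") (auto simp: dist_real_def abs_minus_commute)
  have "(C / (2 * real N))-lipschitz_on {0..S} W"
    using C by (intro lipschitz_onI lipW) auto
  then show "continuous_on {0..S} W" by (rule lipschitz_on_continuous_on)
  show "W t = W 0 + radial_integral N k t" if t: "t \<in> {0..S}" for t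
  proof -
    have "v = (\<lambda>n. V n 0)" using Vn[of 0] S by auto
    then have "v \<longlonglongrightarrow> W 0" using lim[of 0] S by auto
    then have "(\<lambda>n. v n + radial_integral N (h n) t) \<longlonglongrightarrow> W 0 + radial_integral N k t"
      unfolding radial_integral_def by (intro tendsto_add radial_integral_tendsto[OF h hlim t N]) auto
    moreover have "(\<lambda>n. v n + radial_integral N (h n) t) \<longlonglongrightarrow> W t"
      using lim[OF t] Vn[OF t] by simp
    ultimately show ?thesis by (rule LIMSEQ_unique[OF _ _, symmetric])
  qed
qed

lemma incseq_bounded_convergent: "incseq X \<Longrightarrow> (\<And>n. X n \<le> B) \<Longrightarrow> convergent (X :: nat \<Rightarrow> real)"
  by (metis incseq_convergent convergentI)

section \<open>Monotone iteration and shooting for a bounded positive nonlinearity\<close>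

locale bounded_nonlinearity =
  fixes N :: nat and g :: "real \<Rightarrow> real" and C :: real
  assumes N: "N > 0" and cont: "continuous_on UNIV g" and mono: "mono g"
    and pos: "\<And>t. 0 < g t" and le_C: "\<And>t. g t \<le> C"
begin

lemma C_pos: "0 < C" using pos le_C by (rule less_le_trans)

lemma abs_g: "\<bar>g t\<bar> \<le> C" using pos[of t] le_C[of t] by auto

lemma cont_comp: "continuous_on X V \<Longrightarrow> continuous_on X (\<lambda>t. g (V t))"
  by (rule continuous_on_compose2[OF cont]) auto

lemma radial_integral_g_bounds:
  assumes "continuous_on {0..s} V" "s \<ge> 0"
  shows "0 \<le> radial_integral N (\<lambda>t. g (V t)) s" "radial_integral N (\<lambda>t. g (V t)) s \<le> C * s / (2 * real N)"
  using radial_integral_diff_bounds[OF cont_comp[OF assms(1)] N, of 0 s 0 C] assms(2) less_imp_le[OF pos] le_C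
  by auto

primrec picard :: "real \<Rightarrow> nat \<Rightarrow> real \<Rightarrow> real" where
  "picard v 0 = (\<lambda>_. v)"
| "picard v (Suc n) = (\<lambda>s. v + radial_integral N (\<lambda>t. g (picard v n t)) s)"

lemma picard_cont: "continuous_on {0..S} (picard v n)"
  by (induction n) (auto intro!: continuous_intros continuous_on_radial_integral cont_comp)

text \<open>The constant v lies below U because g is positive, and monotonicity of the mean and of g
  preserves this order. It makes the limit of the iterates minimal; allowing v \<le> w also yields
  monotone dependence on the initial value.\<close>

lemma picard_le_super:
  assumes U: "continuous_on {0..S} U"
    and sup: "\<And>s. s \<in> {0..S} \<Longrightarrow> w + radial_integral N (\<lambda>t. g (U t)) s \<le> U s"
    and "v \<le> w" "s \<in> {0..S}"
  shows "picard v n s \<le> U s"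
  using assms(4)
proof (induction n arbitrary: s)
  have le: "w \<le> w + radial_integral N (\<lambda>t. g (U t)) s" if "s \<in> {0..S}" for s
    using radial_integral_g_bounds(1)[OF continuous_on_subset[OF U], of s] that by auto
  case 0
  then show ?case using le[of s] sup[of s] assms(3) by simp
next
  case (Suc n)
  have "radial_integral N (\<lambda>t. g (picard v n t)) s \<le> radial_integral N (\<lambda>t. g (U t)) s"
    using Suc by (intro radial_integral_mono[of S] cont_comp picard_cont U) (auto intro!: monoD[OF mono])
  then show ?case using sup[OF Suc.prems] assms(3) by simp
qed

lemma picard_Suc_le: "s \<ge> 0 \<Longrightarrow> picard v n s \<le> picard v (Suc n) s"
proof (induction n arbitrary: s)
  case 0
  then show ?case
    using radial_integral_g_bounds(1)[of s "\<lambda>_. v"] by simp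
next
  case (Suc n)
  have "radial_integral N (\<lambda>t. g (picard v n t)) s \<le> radial_integral N (\<lambda>t. g (picard v (Suc n) t)) s"
    using Suc by (intro radial_integral_mono[of s] cont_comp picard_cont) (auto intro!: monoD[OF mono])
  then show ?case by simp
qed

lemma picard_bound: "s \<ge> 0 \<Longrightarrow> picard v n s \<le> v + C * s / (2 * real N)"
  using radial_integral_g_bounds(2)[OF picard_cont] C_pos by (cases n) auto

definition sol :: "real \<Rightarrow> real \<Rightarrow> real" where
  "sol v s = lim (\<lambda>n. picard v n s)"

lemma picard_tendsto: "s \<ge> 0 \<Longrightarrow> (\<lambda>n. picard v n s) \<longlonglongrightarrow> sol v s"
  unfolding sol_def convergent_LIMSEQ_iff[symmetric]
  by (rule incseq_bounded_convergent[OF incseq_SucI]) (rule picard_Suc_le picard_bound | assumption)+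

lemma sol_props:
  shows sol_cont: "continuous_on {0..S} (sol v)"
    and sol_eq: "s \<ge> 0 \<Longrightarrow> sol v s = v + radial_integral N (\<lambda>t. g (sol v t)) s"
proof -
  have v0: "sol v 0 = v"
  proof -
    have "picard v n 0 = v" for n by (cases n) auto
    then show ?thesis by (simp add: sol_def)
  qed
  have *: "continuous_on {0..S} (sol v)" "\<And>t. t \<in> {0..S} \<Longrightarrow> sol v t = sol v 0 + radial_integral N (\<lambda>t. g (sol v t)) t"
    if "S \<ge> 0" for S
  proof -
    \<comment> \<open>The limit lemma wants V n expressed through h n, so V is iterate n + 1 while h
      is built from iterate n.\<close>
    have 1: "(\<lambda>n. picard v (Suc n) t) \<longlonglongrightarrow> sol v t" if "t \<in> {0..S}" for t
      using that by (intro LIMSEQ_Suc picard_tendsto) auto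
    have 2: "(\<lambda>n. g (picard v n t)) \<longlonglongrightarrow> g (sol v t)" if "t \<in> {0..S}" for t
      using that by (intro continuous_on_tendsto_compose[OF cont picard_tendsto]) auto
    note L = radial_solution_limit[where V="\<lambda>n. picard v (Suc n)" and W="sol v" and h="\<lambda>n t. g (picard v n t)"
        and k="\<lambda>t. g (sol v t)" and v="\<lambda>_. v" and C=C, OF cont_comp[OF picard_cont] abs_g _ 1 2 N \<open>S \<ge> 0\<close>]
    show "continuous_on {0..S} (sol v)" by (rule L(1)) auto
    show "sol v t = sol v 0 + radial_integral N (\<lambda>t. g (sol v t)) t" if "t \<in> {0..S}" for t
      by (rule L(2)) (use that in auto)
  qed
  show "continuous_on {0..S} (sol v)" using *(1)[of S] by (cases "S \<ge> 0") auto
  show "s \<ge> 0 \<Longrightarrow> sol v s = v + radial_integral N (\<lambda>t. g (sol v t)) s"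
    using *(2)[of s s] v0 by auto
qed

text \<open>Minimality of \<open>sol\<close>, in the form that stands in for a uniqueness theorem
  for the initial value problem.\<close>

lemma sol_le_super:
  assumes "continuous_on {0..S} U"
    and "\<And>s. s \<in> {0..S} \<Longrightarrow> w + radial_integral N (\<lambda>t. g (U t)) s \<le> U s"
    and "v \<le> w" "s \<in> {0..S}"
  shows "sol v s \<le> U s"
  by (rule LIMSEQ_le_const2[OF picard_tendsto]) (use assms picard_le_super[OF assms] in auto)

lemma sol_mono: "v \<le> w \<Longrightarrow> s \<ge> 0 \<Longrightarrow> sol v s \<le> sol w s"
  using sol_eq[of _ w] by (intro sol_le_super[of s _ w] sol_cont) auto

lemma sol_bounds:
  assumes "s \<ge> 0" shows "v \<le> sol v s" "sol v s \<le> v + C * s / (2 * real N)"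
  using radial_integral_g_bounds[OF sol_cont assms] sol_eq[OF assms, of v] by auto

text \<open>The dilated solution raised by c is a supersolution with initial value v + c: dilation
  multiplies the right-hand side by l, and the surplus, at least (l - 1) g v > 0, absorbs the change
  of g under a small shift c. Thus raising the initial value a little costs no more than running the
  old solution a little longer.\<close>

lemma sol_dilation:
  assumes "l > 1"
  shows "\<exists>c0>0. \<forall>c\<in>{0..c0}. sol (v + c) 1 \<le> sol v l + c"
proof -
  \<comment> \<open>Bounds both the dilated solution and its shift on [0, 1]; the extra 1 leaves
    room for c \<le> 1.\<close>
  define B where "B = v + C * l / (2 * real N) + 1"
  have "uniformly_continuous_on {v..B} g"
    by (intro compact_uniformly_continuous continuous_on_subset[OF cont]) auto
  moreover have "(l - 1) * g v > 0" using assms pos by simp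
  ultimately obtain d where d: "d > 0"
    "\<And>x y. x \<in> {v..B} \<Longrightarrow> y \<in> {v..B} \<Longrightarrow> dist y x < d \<Longrightarrow> dist (g y) (g x) < (l - 1) * g v"
    unfolding uniformly_continuous_on_def by metis
  define c0 where "c0 = min 1 (d / 2)"
  have "sol (v + c) 1 \<le> sol v l + c" if c: "c \<in> {0..c0}" for c
  proof -
    define U where "U s = sol v (l * s) + c" for s
    have contU: "continuous_on {0..1} (\<lambda>s. sol v (l * s))"
      using assms by (intro continuous_on_compose2[OF sol_cont[of l v]] continuous_intros) (auto simp: mult_le_cancel_left1)
    have "sol (v + c) 1 \<le> U 1"
    proof (rule sol_le_super[of 1 _ "v + c"])
      show "continuous_on {0..1} U" unfolding U_def by (intro continuous_intros contU)
      fix s :: real assume s: "s \<in> {0..1}"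
      have ineq: "g (U t) \<le> l * g (sol v (l * t))" if t: "t \<in> {0..1}" for t
      proof -
        have "sol v (l * t) \<le> v + C * (l * t) / (2 * real N)" "v \<le> sol v (l * t)"
          using sol_bounds[of "l * t" v] assms t by auto
        moreover have "C * (l * t) / (2 * real N) \<le> C * l / (2 * real N)"
          using t assms C_pos N by (intro divide_right_mono mult_left_mono) (auto simp: mult_le_cancel_left1)
        ultimately have "sol v (l * t) \<in> {v..B}" "U t \<in> {v..B}" "dist (U t) (sol v (l * t)) < d"
          using c d(1) by (auto simp: U_def B_def c0_def dist_real_def)
        from d(2)[OF this] have "g (U t) \<le> g (sol v (l * t)) + (l - 1) * g v"
          by (auto simp: dist_real_def)
        also have "\<dots> \<le> g (sol v (l * t)) + (l - 1) * g (sol v (l * t))"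
          using assms \<open>v \<le> sol v (l * t)\<close> by (intro add_left_mono mult_left_mono monoD[OF mono]) auto
        finally show ?thesis by (simp add: algebra_simps)
      qed
      have "radial_integral N (\<lambda>t. g (U t)) s \<le> radial_integral N (\<lambda>t. l * g (sol v (l * t))) s"
        using s ineq unfolding U_def
        by (intro radial_integral_mono[of 1] cont_comp continuous_intros contU) auto
      also have "\<dots> = radial_integral N (\<lambda>t. g (sol v t)) (l * s)"
        using assms s by (simp add: radial_integral_cmult radial_integral_scale cont_comp[OF sol_cont])
      also have "\<dots> = sol v (l * s) - v" using sol_eq[of "l * s" v] assms s by simp
      finally show "v + c + radial_integral N (\<lambda>t. g (U t)) s \<le> U s" by (simp add: U_def)
    qed auto
    then show ?thesis by (simp add: U_def)
  qed
  moreover have "c0 > 0" using d(1) by (simp add: c0_def)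
  ultimately show ?thesis by blast
qed

text \<open>Let w be the supremum of the initial values with final value at most b. An increasing
  limit of solutions started below w is a solution started at w, so minimality gives
  \<open>sol w 1\<close> \<le> b. If this were strict, \<open>sol w l\<close> < b for some l > 1,
  and \<open>sol_dilation\<close> would admit an initial value above w.\<close>

lemma ex_sol_eq: "\<exists>v. sol v 1 = b"
proof -
  define T where "T = {v. sol v 1 \<le> b}"
  define w where "w = Sup T"
  \<comment> \<open>A solution rises by at most C / (2 N) on [0, 1].\<close>
  have ne: "b - C / (2 * real N) \<in> T" using sol_bounds(2)[of 1 "b - C / (2 * real N)"] by (simp add: T_def)
  have bdd: "bdd_above T" using sol_bounds(1)[of 1] unfolding T_def bdd_above_def by (auto intro: order_trans)
  have below: "sol v 1 \<le> b" if "v < w" for v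
  proof -
    obtain v' where "v' \<in> T" "v < v'" using less_cSup_iff[OF _ bdd, of v] ne \<open>v < w\<close> unfolding w_def by blast
    then show ?thesis using sol_mono[of v v' 1] by (auto simp: T_def)
  qed
  have "sol w 1 \<le> b"
  proof -
    define v where "v n = w - inverse (real (Suc n))" for n
    have inc: "incseq v" unfolding v_def by (intro incseq_SucI) (auto simp: field_simps)
    have v_le: "v n < w" for n by (simp add: v_def)
    have vlim: "v \<longlonglongrightarrow> w"
      unfolding v_def using tendsto_diff[OF tendsto_const LIMSEQ_inverse_real_of_nat, of w] by simp
    define W where "W t = lim (\<lambda>n. sol (v n) t)" for t
    have lim: "(\<lambda>n. sol (v n) t) \<longlonglongrightarrow> W t" if t: "t \<in> {0..1}" for t
      unfolding W_def convergent_LIMSEQ_iff[symmetric]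
    proof (rule incseq_bounded_convergent)
      show "incseq (\<lambda>n. sol (v n) t)" using t inc by (intro incseq_SucI sol_mono) (auto simp: incseq_Suc_iff)
      show "sol (v n) t \<le> sol w t" for n using t less_imp_le[OF v_le] by (intro sol_mono) auto
    qed
    have glim: "(\<lambda>n. g (sol (v n) t)) \<longlonglongrightarrow> g (W t)" if "t \<in> {0..1}" for t
      using that by (intro continuous_on_tendsto_compose[OF cont lim]) auto
    note L = radial_solution_limit[where V="\<lambda>n. sol (v n)" and v=v and S=1, OF cont_comp[OF sol_cont] abs_g sol_eq lim glim N]
    have W0: "W 0 = w"
      using lim[of 0] sol_eq[of 0] vlim by (auto intro: LIMSEQ_unique)
    have "sol w 1 \<le> W 1"
      using L W0 by (intro sol_le_super[of 1 _ w]) auto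
    also have "W 1 \<le> b" by (rule LIMSEQ_le_const2[OF lim]) (use below v_le in auto)
    finally show ?thesis .
  qed
  moreover have "\<not> sol w 1 < b"
  proof
    assume lt: "sol w 1 < b"
    have "(sol w \<longlongrightarrow> sol w 1) (at 1)"
      using sol_cont[of 2 w] by (auto simp: continuous_on at_within_Icc_at dest: bspec[of _ _ 1])
    then have "eventually (\<lambda>s. sol w s < b) (at_right 1)"
      using lt by (intro order_tendstoD(2)[where y="sol w 1"]) (auto intro: tendsto_mono[OF at_le])
    moreover have "eventually (\<lambda>s. s > 1) (at_right (1::real))" by (rule eventually_at_right_less)
    ultimately obtain l where l: "l > 1" "sol w l < b"
      using eventually_happens[OF eventually_conj] by fastforce
    obtain c0 where c0: "c0 > 0" "\<And>c. c \<in> {0..c0} \<Longrightarrow> sol (w + c) 1 \<le> sol w l + c"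
      using sol_dilation[OF l(1), of w] by blast
    define c where "c = min c0 (b - sol w l)"
    have "sol (w + c) 1 \<le> b" "c > 0" using c0(2)[of c] c0(1) l by (auto simp: c_def)
    then have "w + c \<le> w" unfolding w_def[of, symmetric] using cSup_upper[OF _ bdd, of "w + c"] by (simp add: T_def w_def)
    with \<open>c > 0\<close> show False by simp
  qed
  ultimately show ?thesis by (intro exI[of _ w]) auto
qed

end

section \<open>The Keller--Osserman condition\<close>

locale keller_osserman =
  fixes f F :: "real \<Rightarrow> real" and a :: real
  assumes cont_f: "continuous_on UNIV f"
    and f_a: "f a > 0"
    and F_eq: "\<And>t. F t = (LBINT s=ereal a..ereal t. f s)"
    and tail: "\<exists>b. set_integrable lborel {b..} (\<lambda>t. 1 / sqrt (F t))"
    and mono_f: "mono f"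
begin

lemma f_pos: "t \<ge> a \<Longrightarrow> f t > 0"
  using f_a monoD[OF mono_f, of a t] by auto

lemma F_a [simp]: "F a = 0"
  by (simp add: F_eq)

lemma F_eq_integral: "t \<ge> a \<Longrightarrow> F t = integral {a..t} f"
  unfolding F_eq
  by (intro interval_integral_eq_integral borel_integrable_atLeastAtMost')
     (auto intro: continuous_on_subset[OF cont_f])

lemma F_has_derivative:
  assumes "t > a"
  shows "(F has_real_derivative f t) (at t)"
proof -
  have "((\<lambda>t. integral {a..t} f) has_real_derivative f t) (at t within {a..t + 1})"
    using assms by (intro integral_has_real_derivative continuous_on_subset[OF cont_f]) auto
  moreover have "at t within {a..t + 1} = at t"
    using assms by (intro at_within_interior) auto
  ultimately have "((\<lambda>t. integral {a..t} f) has_real_derivative f t) (at t)" by simp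
  then show ?thesis
    by (rule has_field_derivative_transform_within_open[where S="{a<..}"])
       (use assms F_eq_integral in auto)
qed

lemma F_diff_bounds:
  assumes "a \<le> s" "s \<le> t"
  shows "f s * (t - s) \<le> F t - F s" "F t - F s \<le> f t * (t - s)"
proof -
  have "F t - F s = integral {s..t} f"
    using Henstock_Kurzweil_Integration.integral_combine[of a s t f] assms
      integrable_continuous_interval[OF continuous_on_subset[OF cont_f], of a t]
    by (simp add: F_eq_integral)
  moreover have i: "f integrable_on {s..t}"
    by (intro integrable_continuous_interval continuous_on_subset[OF cont_f]) auto
  have "integral {s..t} (\<lambda>_. f s) \<le> integral {s..t} f" "integral {s..t} f \<le> integral {s..t} (\<lambda>_. f t)"
    by (intro integral_le i; auto intro: monoD[OF mono_f])+
  ultimately show "f s * (t - s) \<le> F t - F s" "F t - F s \<le> f t * (t - s)"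
    using assms by (auto simp: mult.commute)
qed

lemma F_pos: "t > a \<Longrightarrow> F t > 0"
  using F_diff_bounds(1)[of a t] mult_pos_pos[OF f_a, of "t - a"] by simp

lemma F_mono: "a \<le> s \<Longrightarrow> s \<le> t \<Longrightarrow> F s \<le> F t"
  using F_diff_bounds(1)[of s t] mult_nonneg_nonneg[OF less_imp_le[OF f_pos], of s "t - s"] by simp

text \<open>\<Theta> acts as a clock: where V'^2 \<ge> c F(V) with V' > 0, \<Theta>(V) advances at
  rate at least sqrt c, so small increments of \<Theta> at great heights bound the time that V can
  still last.\<close>

lemma ex_primitive:
  "\<exists>\<Theta> b. b > a \<and> (\<forall>t>b. (\<Theta> has_real_derivative 1 / sqrt (F t)) (at t)) \<and> 
     (\<forall>\<epsilon>>0. \<exists>K>b. \<forall>s\<ge>K. \<forall>t\<ge>s. \<Theta> t - \<Theta> s \<le> \<epsilon>)"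
proof -
  obtain b0 where b0: "set_integrable lborel {b0..} (\<lambda>t. 1 / sqrt (F t))" using tail by blast
  \<comment> \<open>Beyond a + 1 the function F is positive and differentiable; at a it
    vanishes.\<close>
  define b where "b = max b0 (a + 1)"
  have "set_integrable lborel {b..} (\<lambda>t. 1 / sqrt (F t))"
    by (rule set_integrable_subset[OF b0]) (auto simp: b_def)
  then have int: "(\<lambda>t. 1 / sqrt (F t)) integrable_on {b..}"
    by (rule set_borel_integral_eq_integral(1))
  have ba: "b > a" by (simp add: b_def)
  have contF: "continuous_on {b..t} (\<lambda>t. 1 / sqrt (F t))" for t
    using ba by (intro continuous_intros continuous_at_imp_continuous_on ballI
        DERIV_isCont[OF F_has_derivative] isCont_divide isCont_real_sqrt)
      (auto dest!: F_pos[OF less_le_trans, of b])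
  define \<Theta> where "\<Theta> t = integral {b..t} (\<lambda>t. 1 / sqrt (F t))" for t
  have d: "(\<Theta> has_real_derivative 1 / sqrt (F t)) (at t)" if "t > b" for t
  proof -
    have "(\<Theta> has_real_derivative 1 / sqrt (F t)) (at t within {b..t + 1})"
      unfolding \<Theta>_def using that by (intro integral_has_real_derivative contF) auto
    moreover have "at t within {b..t + 1} = at t"
      using that by (intro at_within_interior) auto
    ultimately show ?thesis by simp
  qed
  have nonneg: "1 / sqrt (F t) \<ge> 0" if "t \<ge> b" for t
    using F_pos[of t] that ba by simp
  have mono: "\<Theta> s \<le> \<Theta> t" if "s \<le> t" for s t
    unfolding \<Theta>_def using that nonneg
    by (intro integral_subset_le integrable_continuous_interval contF) auto
  have bnd: "\<Theta> t \<le> integral {b..} (\<lambda>t. 1 / sqrt (F t))" for t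
    unfolding \<Theta>_def using nonneg
    by (intro integral_subset_le integrable_continuous_interval contF int) auto
  then have bdd: "bdd_above (range \<Theta>)" by (auto simp: bdd_above_def)
  have "\<exists>K>b. \<forall>s\<ge>K. \<forall>t\<ge>s. \<Theta> t - \<Theta> s \<le> \<epsilon>" if "\<epsilon> > 0" for \<epsilon>
  proof -
    obtain K where K: "\<Theta> K > Sup (range \<Theta>) - \<epsilon>"
      using less_cSup_iff[OF _ bdd, of "Sup (range \<Theta>) - \<epsilon>"] \<open>\<epsilon> > 0\<close> by auto
    have "\<Theta> t - \<Theta> s \<le> \<epsilon>" if "s \<ge> max K (b + 1)" for s t
      using mono[of K s] cSup_upper[OF _ bdd, of "\<Theta> t"] K that by auto
    then show ?thesis by (intro exI[of _ "max K (b + 1)"]) auto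
  qed
  with d ba show ?thesis by (intro exI[of _ \<Theta>] exI[of _ b]) auto
qed

text \<open>The mean value theorem for \<Theta> between the midpoint of a and k and k itself bounds
  (k - a) / (2 sqrt(F k)) by a small increment of \<Theta>. Hence (k - a)^2 \<le> \<epsilon> F k
  \<le> \<epsilon> f(k) (k - a), the last step because f is nondecreasing.\<close>

lemma eventually_superlinear:
  assumes "\<epsilon> > 0"
  shows "\<exists>K>a. \<forall>k\<ge>K. k - a \<le> \<epsilon> * f k"
proof -
  obtain \<Theta> b where \<Theta>: "b > a" "\<And>t. t > b \<Longrightarrow> (\<Theta> has_real_derivative 1 / sqrt (F t)) (at t)"
    "\<And>\<epsilon>. \<epsilon> > 0 \<Longrightarrow> \<exists>K>b. \<forall>s\<ge>K. \<forall>t\<ge>s. \<Theta> t - \<Theta> s \<le> \<epsilon>"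
    using ex_primitive by metis
  obtain K where K: "K > b" "\<And>s t. s \<ge> K \<Longrightarrow> t \<ge> s \<Longrightarrow> \<Theta> t - \<Theta> s \<le> sqrt \<epsilon> / 2"
    using \<Theta>(3)[of "sqrt \<epsilon> / 2"] assms by auto
  \<comment> \<open>This threshold for k places the midpoint s of a and k beyond K.\<close>
  have "k - a \<le> \<epsilon> * f k" if k: "k \<ge> 2 * K - a" for k
  proof -
    define s where "s = (k + a) / 2"
    have s: "s \<ge> K" "s < k" "s > b" "s > a" "k - s = (k - a) / 2" using k K \<Theta>(1) by (auto simp: s_def field_simps)
    obtain z where z: "s < z" "z < k" "\<Theta> k - \<Theta> s = (k - s) * (1 / sqrt (F z))"
      using MVT2[OF s(2), of \<Theta> "\<lambda>t. 1 / sqrt (F t)"] \<Theta>(2) s by auto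
    have F: "0 < F z" "F z \<le> F k" "0 < F k" using z s F_pos[of z] F_pos[of k] F_mono[of z k] by auto
    have "(k - s) * (1 / sqrt (F k)) \<le> (k - s) * (1 / sqrt (F z))"
      using F s by (intro mult_left_mono divide_left_mono) auto
    also have "\<dots> \<le> sqrt \<epsilon> / 2" using z(3) K(2)[OF s(1), of k] s(2) by linarith
    finally have "k - a \<le> sqrt \<epsilon> * sqrt (F k)" unfolding s(5) using F by (simp add: field_simps)
    then have "(k - a)\<^sup>2 \<le> (sqrt \<epsilon> * sqrt (F k))\<^sup>2" using s by (intro power_mono) auto
    then have "(k - a) * (k - a) \<le> \<epsilon> * F k" using F assms by (simp add: power_mult_distrib flip: power2_eq_square)
    also have "\<dots> \<le> \<epsilon> * (f k * (k - a))"
      using F_diff_bounds(2)[of a k] s assms by (intro mult_left_mono) auto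
    finally have "(k - a) * (k - a) \<le> (\<epsilon> * f k) * (k - a)" by simp
    then show ?thesis using s by (auto dest: mult_right_le_imp_le)
  qed
  moreover have "2 * K - a > a" using K \<Theta> by auto
  ultimately show ?thesis by blast
qed

lemma f_unbounded: "\<exists>t>a. f t > C"
proof -
  obtain K where K: "K > a" "\<And>k. k \<ge> K \<Longrightarrow> k - a \<le> 1 * f k"
    using eventually_superlinear[of 1] by auto
  show ?thesis using K(2)[of "max K (C + a + 1)"] K(1) by (intro exI[of _ "max K (C + a + 1)"]) auto
qed

text \<open>The Keller--Osserman time estimate. Starting from the height \<open>k = V s\<^sub>0\<close>, the energy inequality
  takes \<open>V\<close> to \<open>2k - a\<close> in a short time because \<open>F - F k\<close> grows at rate at least \<open>f k\<close>; afterwards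
  \<open>F k \<le> F (V s) / 2\<close> and the tail of the integral of \<open>1 / sqrt F\<close> bounds the remaining time.\<close>

lemma blowup_time:
  assumes \<kappa>: "\<kappa> > 0" and \<eta>: "\<eta> > 0"
  shows "\<exists>K>a. \<forall>V m s0 s1. V s0 \<ge> K \<longrightarrow> s0 \<le> s1 \<longrightarrow>
     (\<forall>s\<in>{s0..s1}. (V has_real_derivative m s) (at s) \<and> m s > 0 \<and> \<kappa> * (F (V s) - F (V s0)) \<le> (m s)\<^sup>2) \<longrightarrow>
     s1 - s0 \<le> \<eta>"
proof -
  obtain \<Theta> b where \<Theta>: "b > a" "\<And>t. t > b \<Longrightarrow> (\<Theta> has_real_derivative 1 / sqrt (F t)) (at t)"
    "\<And>\<epsilon>. \<epsilon> > 0 \<Longrightarrow> \<exists>K>b. \<forall>s\<ge>K. \<forall>t\<ge>s. \<Theta> t - \<Theta> s \<le> \<epsilon>"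
    using ex_primitive by metis
  obtain K1 where K1: "K1 > b" "\<And>s t. s \<ge> K1 \<Longrightarrow> t \<ge> s \<Longrightarrow> \<Theta> t - \<Theta> s \<le> sqrt (\<kappa> / 2) * (\<eta> / 2)"
    using \<Theta>(3)[of "sqrt (\<kappa> / 2) * (\<eta> / 2)"] \<kappa> \<eta> by auto
  \<comment> \<open>Each of the two stages gets time \<eta> / 2. The factor 1/16 is the square of
    \<eta> / 2 times the 1/2 from differentiating a square root below.\<close>
  obtain K2 where K2: "K2 > a" "\<And>k. k \<ge> K2 \<Longrightarrow> k - a \<le> \<kappa> * \<eta>\<^sup>2 / 16 * f k"
    using eventually_superlinear[of "\<kappa> * \<eta>\<^sup>2 / 16"] \<kappa> \<eta> by auto
  define K where "K = max K1 K2"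
  have "s1 - s0 \<le> \<eta>"
    if k: "V s0 \<ge> K" and s01: "s0 \<le> s1"
      and V: "\<And>s. s \<in> {s0..s1} \<Longrightarrow> (V has_real_derivative m s) (at s)"
      and m: "\<And>s. s \<in> {s0..s1} \<Longrightarrow> m s > 0"
      and en: "\<And>s. s \<in> {s0..s1} \<Longrightarrow> \<kappa> * (F (V s) - F (V s0)) \<le> (m s)\<^sup>2" for V m s0 s1
  proof (rule ccontr)
    assume "\<not> s1 - s0 \<le> \<eta>"
    then have long: "s1 > s0 + \<eta>" by simp
    define k where "k = V s0"
    have k: "k \<ge> K1" "k \<ge> K2" "k > a" "k > b" using k K1 K2 by (auto simp: K_def k_def)
    have fk: "f k > 0" using f_pos k by simp
    have Vmono: "V s < V t" if "s0 \<le> s" "s < t" "t \<le> s1" for s t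
    proof (rule DERIV_pos_imp_increasing[OF that(2)])
      fix x assume "s \<le> x" "x \<le> t"
      then have "x \<in> {s0..s1}" using that by auto
      with V m show "\<exists>y. (V has_real_derivative y) (at x) \<and> 0 < y" by blast
    qed
    define sm where "sm = s0 + \<eta> / 2"
    have sm: "s0 < sm" "sm < s1" using long \<eta> by (auto simp: sm_def)
    \<comment> \<open>By convexity of F the energy inequality gives V' \<ge> sqrt(\<kappa> f(k) (V -
      k)), so sqrt(V - k) grows at rate at least sqrt(\<kappa> f(k)) / 2. At s0 its argument
      vanishes, whence derivatives only in the open interval.\<close>
    have c: "continuous_on {s0..sm} (\<lambda>s. sqrt (V s - k))"
      using V sm by (intro continuous_intros continuous_at_imp_continuous_on ballI DERIV_isCont[OF V]) auto
    have d: "((\<lambda>s. sqrt (V s - k)) has_derivative (*) (m z * (inverse (sqrt (V z - k)) / 2))) (at z)"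
      if z: "s0 < z" "z < sm" for z
    proof -
      have "V z - k > 0" using Vmono[of s0 z] z sm by (simp add: k_def)
      moreover have "(V has_real_derivative m z) (at z)" using V z sm by auto
      ultimately show ?thesis
        unfolding has_field_derivative_def[symmetric] by (auto intro!: derivative_eq_intros)
    qed
    obtain z where z: "s0 < z" "z < sm"
      "sqrt (V sm - k) = \<eta> / 2 * (m z * (inverse (sqrt (V z - k)) / 2))"
      using mvt[OF sm(1) c d] by (auto simp: k_def sm_def mult_ac)
    have Vz: "V z > k" using Vmono[of s0 z] z sm by (simp add: k_def)
    have "\<kappa> * (f k * (V z - k)) \<le> \<kappa> * (F (V z) - F k)"
      using \<kappa> Vz k F_diff_bounds(1)[of k "V z"] by (intro mult_left_mono) auto
    also have "\<dots> \<le> (m z)\<^sup>2" using en[of z] z sm by (auto simp: k_def)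
    finally have "\<kappa> * f k \<le> (m z)\<^sup>2 * (inverse (sqrt (V z - k)))\<^sup>2"
      using Vz by (simp add: field_simps)
    then have "\<kappa> * f k * (\<eta>\<^sup>2 / 16) \<le> ((m z)\<^sup>2 * (inverse (sqrt (V z - k)))\<^sup>2) * (\<eta>\<^sup>2 / 16)"
      by (intro mult_right_mono) auto
    also have "\<dots> = (sqrt (V sm - k))\<^sup>2" unfolding z(3) by (simp add: power_mult_distrib power_divide)
    also have "\<dots> = V sm - k" using Vmono[of s0 sm] sm by (simp add: k_def)
    finally have Vsm: "V sm \<ge> 2 * k - a" using K2(2)[OF k(2)] by (simp add: algebra_simps)
    have "\<exists>z. sm < z \<and> z < s1 \<and> \<Theta> (V s1) - \<Theta> (V sm) = (s1 - sm) * (1 / sqrt (F (V z)) * m z)"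
    proof (rule MVT2[OF sm(2)])
      fix x assume x: "sm \<le> x" "x \<le> s1"
      have "V x > b" using Vmono[of s0 x] x sm k by (simp add: k_def)
      from DERIV_chain2[OF \<Theta>(2)[OF this] V] x sm
      show "((\<lambda>s. \<Theta> (V s)) has_real_derivative 1 / sqrt (F (V x)) * m x) (at x)" by auto
    qed
    then obtain y where y: "sm < y" "y < s1" "\<Theta> (V s1) - \<Theta> (V sm) = (s1 - sm) * (1 / sqrt (F (V y)) * m y)"
      by blast
    have Vy: "V y > k" "V y \<ge> 2 * k - a" using Vmono[of sm y] Vmono[of s0 y] y sm Vsm by (auto simp: k_def)
    have "F k \<le> f k * (k - a)" using F_diff_bounds(2)[of a k] k by simp
    also have "\<dots> \<le> f k * (V y - k)" using fk Vy by (intro mult_left_mono) auto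
    also have "\<dots> \<le> F (V y) - F k" using F_diff_bounds(1)[of k "V y"] Vy k by simp
    finally have "\<kappa> / 2 * F (V y) \<le> \<kappa> * (F (V y) - F k)" using \<kappa> by (simp add: field_simps)
    also have "\<dots> \<le> (m y)\<^sup>2" using en[of y] y sm by (auto simp: k_def)
    finally have "sqrt (\<kappa> / 2 * F (V y)) \<le> m y" using m[of y] y sm by (intro real_le_lsqrt) auto
    then have my: "sqrt (\<kappa> / 2) \<le> 1 / sqrt (F (V y)) * m y"
      using F_pos[of "V y"] Vy k unfolding real_sqrt_mult by (simp add: pos_le_divide_eq)
    have "sqrt (\<kappa> / 2) * (\<eta> / 2) < sqrt (\<kappa> / 2) * (s1 - sm)"
      using \<kappa> long by (intro mult_strict_left_mono) (auto simp: sm_def)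
    also have "\<dots> \<le> (1 / sqrt (F (V y)) * m y) * (s1 - sm)"
      using my sm by (intro mult_right_mono) auto
    also have "\<dots> = \<Theta> (V s1) - \<Theta> (V sm)" using y by simp
    also have "\<dots> \<le> sqrt (\<kappa> / 2) * (\<eta> / 2)"
      using Vmono[of s0 sm] Vmono[of sm s1] sm k by (intro K1(2)) (auto simp: k_def)
    finally show False by simp
  qed
  moreover have "K > a" using K2 by (simp add: K_def)
  ultimately show ?thesis by (intro exI[of _ K]) blast
qed

end

section \<open>Existence of a radial large solution\<close>

lemma radial_solution_has_derivative:
  assumes h: "continuous_on {0..S} h"
    and V: "\<And>t. t \<in> {0..S} \<Longrightarrow> V t = c + radial_integral N h t" and s: "0 < s" "s < S"
  shows "(V has_real_derivative radial_mean N h s) (at s)"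
proof -
  have "(radial_integral N h has_real_derivative radial_mean N h s) (at s within {0..S})"
    using s by (intro radial_integral_has_derivative h) auto
  moreover have "at s within {0..S} = at s"
    using s by (intro at_within_interior) auto
  ultimately have "((\<lambda>t. c + radial_integral N h t) has_real_derivative radial_mean N h s) (at s)"
    by (auto intro!: derivative_eq_intros)
  then show ?thesis
    by (rule has_field_derivative_transform_within_open[where S="{0<..<S}"]) (use s V in auto)
qed

lemma radial_solution_mono:
  assumes h: "continuous_on {0..S} h" and N: "N > 0"
    and V: "\<And>t. t \<in> {0..S} \<Longrightarrow> V t = c + radial_integral N h t"
    and nonneg: "\<And>t. t \<in> {0..S} \<Longrightarrow> 0 \<le> h t" and st: "0 \<le> s" "s \<le> t" "t \<le> S"
  shows "V s \<le> V t"
proof -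
  obtain u where u: "\<And>r. r \<in> {0..S} \<Longrightarrow> h r \<le> u"
    using compact_attains_sup[OF compact_continuous_image[OF h]] st by fastforce
  have "0 * (t - s) / (2 * real N) \<le> radial_integral N h t - radial_integral N h s"
    using st by (intro radial_integral_diff_bounds(1)[OF h N, where u=u] nonneg u) auto
  then show ?thesis using V[of s] V[of t] st by simp
qed

text \<open>At a positive maximum of \<open>V - W\<close> the difference \<open>V' - W'\<close> vanishes (or is positive, at the origin)
  and starts to increase, so that the maximum can only be attained at the end point.\<close>

lemma radial_comparison:
  assumes h: "continuous_on {0..S} h" and k: "continuous_on {0..S} k" and N: "N > 0"
    and V: "\<And>t. t \<in> {0..S} \<Longrightarrow> V t = c + radial_integral N h t"
    and W: "\<And>t. t \<in> {0..S} \<Longrightarrow> W t = d + radial_integral N k t"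
    and b: "0 < b" "b < S" "V b \<le> W b"
    and less: "\<And>t. t \<in> {0..b} \<Longrightarrow> W t < V t \<Longrightarrow> k t < h t"
    and s: "s \<in> {0..b}"
  shows "V s \<le> W s"
proof (rule ccontr)
  assume neg: "\<not> V s \<le> W s"
  have contV: "continuous_on {0..S} V"
    by (rule continuous_on_eq[where f="\<lambda>t. c + radial_integral N h t"])
       (use V in \<open>auto intro!: continuous_intros continuous_on_radial_integral h\<close>)
  have contW: "continuous_on {0..S} W"
    by (rule continuous_on_eq[where f="\<lambda>t. d + radial_integral N k t"])
       (use W in \<open>auto intro!: continuous_intros continuous_on_radial_integral k\<close>)
  define D where "D t = V t - W t" for t
  define m where "m t = radial_mean N h t - radial_mean N k t" for t
  have contD: "continuous_on {0..S} D" unfolding D_def by (intro continuous_intros contV contW)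
  have contm: "continuous_on {0..S} m"
    unfolding m_def by (intro continuous_intros continuous_on_radial_mean h k)
  have dD: "(D has_real_derivative m t) (at t)" if "0 < t" "t < S" for t
    unfolding D_def m_def
    by (intro derivative_intros radial_solution_has_derivative[OF h V] radial_solution_has_derivative[OF k W] that)
  obtain x where x: "x \<in> {0..b}" "\<And>y. y \<in> {0..b} \<Longrightarrow> D y \<le> D x"
    using continuous_attains_sup[of "{0..b}" D] continuous_on_subset[OF contD] b by force
  have Dx: "D x > 0" using x(2)[OF s] neg by (simp add: D_def)
  then have xb: "x < b" using x b by (cases "x = b") (auto simp: D_def)
  have hk: "k x < h x" using less[OF x(1)] Dx by (simp add: D_def)
  have "\<exists>r>0. \<forall>y. x < y \<and> y < x + r \<longrightarrow> m y > 0"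
  proof (cases "x = 0")
    case True
    have "m 0 > 0" using hk N True by (simp add: m_def radial_mean_zero divide_strict_right_mono)
    moreover have "(m \<longlongrightarrow> m 0) (at 0 within {0..S})" using contm b by (auto simp: continuous_on)
    ultimately have "eventually (\<lambda>y. m y > 0) (at 0 within {0..S})" by (auto dest: order_tendstoD(1))
    then obtain r where "r > 0" "\<And>y. y \<in> {0..S} \<Longrightarrow> y \<noteq> 0 \<Longrightarrow> dist y 0 < r \<Longrightarrow> m y > 0"
      unfolding eventually_at by auto
    then show ?thesis using True b by (intro exI[of _ "min r S"]) auto
  next
    case False
    then have x0: "0 < x" "x < S" using x b xb by auto
    have "m x = 0"
      by (rule DERIV_local_max[OF dD[OF x0], of "min x (b - x)"]) (use x x0 xb in \<open>auto simp: abs_less_iff\<close>)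
    have "(m has_real_derivative
        ((h x - 2 * real N * radial_mean N h x) / (4 * x) - (k x - 2 * real N * radial_mean N k x) / (4 * x))) (at x)"
      unfolding m_def by (intro derivative_intros radial_mean_has_derivative[OF h x0 N] radial_mean_has_derivative[OF k x0 N])
    also have "(h x - 2 * real N * radial_mean N h x) / (4 * x) - (k x - 2 * real N * radial_mean N k x) / (4 * x)
        = (h x - k x - 2 * real N * m x) / (4 * x)"
      unfolding m_def diff_divide_distrib[symmetric] by (simp add: algebra_simps)
    also have "\<dots> = (h x - k x) / (4 * x)" by (simp add: \<open>m x = 0\<close>)
    finally have "\<exists>r>0. \<forall>e>0. e < r \<longrightarrow> m x < m (x + e)"
      by (rule DERIV_pos_inc_right) (use hk x0 in auto)
    then obtain r where r: "r > 0" "\<And>e. e > 0 \<Longrightarrow> e < r \<Longrightarrow> m x < m (x + e)" by blast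
    have "m y > 0" if "x < y" "y < x + r" for y
      using r(2)[of "y - x"] that \<open>m x = 0\<close> by simp
    then show ?thesis using r(1) by blast
  qed
  then obtain r where r: "r > 0" "\<And>y. x < y \<Longrightarrow> y < x + r \<Longrightarrow> m y > 0" by blast
  define y where "y = min b (x + r)"
  have y: "x < y" "y \<le> b" using r xb by (auto simp: y_def)
  have cD: "continuous_on {x..y} D" by (rule continuous_on_subset[OF contD]) (use x y b in auto)
  have dD': "(D has_derivative (*) (m t)) (at t)" if "x < t" "t < y" for t
    using dD[of t] that x y b by (auto simp: has_field_derivative_def)
  obtain z where z: "x < z" "z < y" "D y - D x = m z * (y - x)"
    by (rule mvt[OF y(1) cD dD'])
  have "z < x + r" using z by (simp add: y_def)
  then have "m z * (y - x) > 0" using r(2)[of z] z y by (intro mult_pos_pos) auto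
  then have "D y > D x" using z by simp
  moreover have "D y \<le> D x" by (rule x(2)) (use x(1) y in auto)
  ultimately show False by simp
qed

section \<open>Truncated problems and their limit\<close>

context keller_osserman
begin

text \<open>The truncation at height n gives boundedness and is not felt by a solution on [0, 1]
  whose value at 1 is n. The last term gives positivity, and its strict decrease in n supplies the
  strict inequality that \<open>radial_comparison\<close> asks for.\<close>

definition approx :: "nat \<Rightarrow> real \<Rightarrow> real" where
  "approx n t = max 0 (f (min t (real n))) + 1 / (real n + 1)"

lemma approx_bounded_nonlinearity:
  assumes N: "N > 0"
  shows "bounded_nonlinearity N (approx n) (max 0 (f n) + 1)"
proof (unfold_locales, rule N)
  show "continuous_on UNIV (approx n)"
    unfolding approx_def[abs_def] by (intro continuous_intros continuous_on_compose2[OF cont_f]) auto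
  show "mono (approx n)"
    unfolding approx_def[abs_def]
    by (intro monoI add_right_mono max.mono monoD[OF mono_f] min.mono) auto
  show "0 < approx n t" for t by (simp add: approx_def add_nonneg_pos)
  show "approx n t \<le> max 0 (f n) + 1" for t
    unfolding approx_def by (intro add_mono max.mono monoD[OF mono_f]) (auto simp: field_simps)
qed

lemma approx_eq: "t \<le> real n \<Longrightarrow> approx n t = max 0 (f t) + 1 / (real n + 1)"
  by (simp add: approx_def)

lemma approx_Suc_less:
  assumes "s < t" "t \<le> real n"
  shows "approx (Suc n) s < approx n t"
proof -
  have "max 0 (f s) \<le> max 0 (f t)" using assms by (intro max.mono monoD[OF mono_f]) auto
  moreover have "1 / (real (Suc n) + 1) < 1 / (real n + 1)" by (simp add: field_simps)
  ultimately show ?thesis using assms by (simp add: approx_eq)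
qed

text \<open>Were V s0 too large, the monotone energy t^N V'^2 - \<kappa> F(V) would provide the
  hypothesis of \<open>blowup_time\<close>, which lets the solution last only half of the way from
  s0 to 1; yet it exists past 1. Its threshold K does not involve n.\<close>

lemma radial_bound:
  assumes N: "N > 0" and S: "S < 1"
  shows "\<exists>K. \<forall>n V. continuous_on {0..2} V \<longrightarrow>
      (\<forall>t\<in>{0..2}. V t = V 0 + radial_integral N (\<lambda>t. approx n (V t)) t) \<longrightarrow> V 1 = real n \<longrightarrow>
      (\<forall>s\<in>{0..S}. V s \<le> K)"
proof -
  define s0 where "s0 = max S (1/2)"
  have s0: "S \<le> s0" "1/2 \<le> s0" "s0 < 1" using S by (auto simp: s0_def)
  \<comment> \<open>The minimum over [1/2, 1] of t^(N-1) / 2, the weight in the derivative of t^N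
    V'^2; this is why s0 is kept above 1/2.\<close>
  define \<kappa> where "\<kappa> = (1/2) ^ (N - 1) / (2::real)"
  have \<kappa>: "\<kappa> > 0" by (simp add: \<kappa>_def)
  obtain K where K: "K > a" "\<And>V m s1. V s0 \<ge> K \<Longrightarrow> s0 \<le> s1 \<Longrightarrow>
     (\<And>s. s\<in>{s0..s1} \<Longrightarrow> (V has_real_derivative m s) (at s) \<and> m s > 0 \<and> \<kappa> * (F (V s) - F (V s0)) \<le> (m s)\<^sup>2) \<Longrightarrow>
     s1 - s0 \<le> (1 - s0) / 2"
    using blowup_time[OF \<kappa>, of "(1 - s0) / 2"] s0 by (metis half_gt_zero diff_gt_0_iff_gt)
  have "V s \<le> K" if contV: "continuous_on {0..2} V"
    and V: "\<And>t. t \<in> {0..2} \<Longrightarrow> V t = V 0 + radial_integral N (\<lambda>t. approx n (V t)) t"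
    and V1: "V 1 = real n" and s: "s \<in> {0..S}" for n V s
  proof -
    interpret g: bounded_nonlinearity N "approx n" "max 0 (f n) + 1" by (rule approx_bounded_nonlinearity[OF N])
    define h where "h t = approx n (V t)" for t
    define m where "m = radial_mean N h"
    have h: "continuous_on {0..2} h" unfolding h_def by (rule g.cont_comp[OF contV])
    note V = V[folded h_def[abs_def]]
    have mono: "V s \<le> V t" if "0 \<le> s" "s \<le> t" "t \<le> 2" for s t
      using that g.pos by (intro radial_solution_mono[OF h N V]) (auto simp: h_def less_imp_le)
    have mpos: "m t > 0" if "t \<in> {0..2}" for t
    proof -
      have "1 / (real n + 1) / (2 * real N) \<le> m t"
        unfolding m_def using that g.le_C
        by (intro radial_mean_bounds(1)[OF h that N, where u="max 0 (f n) + 1"]) (auto simp: h_def approx_def)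
      moreover have "1 / (real n + 1) / (2 * real N) > 0" using N by simp
      ultimately show ?thesis by linarith
    qed
    have "V s0 < K"
    proof (rule ccontr)
      assume "\<not> V s0 < K"
      then have Vs0: "V s0 \<ge> K" by simp
      have dV: "(V has_real_derivative m t) (at t)" if "t \<in> {s0..1}" for t
        unfolding m_def using that s0 by (intro radial_solution_has_derivative[OF h V]) auto
      have dm: "(m has_real_derivative (h t - 2 * real N * m t) / (4 * t)) (at t)" if "t \<in> {s0..1}" for t
        unfolding m_def using that s0 by (intro radial_mean_has_derivative[OF h _ _ N]) auto
      have en: "\<kappa> * (F (V t) - F (V s0)) \<le> (m t)\<^sup>2" if t: "t \<in> {s0..1}" for t
      proof -
        \<comment> \<open>The weight t^N cancels the friction term 2 N V' of the equation: the
          derivative of t^N V'^2 is t^(N-1) V' h / 2.\<close>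
        define E where "E t = t ^ N * (m t)\<^sup>2 - \<kappa> * F (V t)" for t
        have "E s0 \<le> E t"
        proof (rule DERIV_nonneg_imp_nondecreasing[of s0 t E])
          show "s0 \<le> t" using t by simp
          fix x assume "s0 \<le> x" "x \<le> t"
          then have x: "x \<in> {s0..1}" "x > 0" "V x > a" using t s0 mono[of s0 x] Vs0 K by auto
          \<comment> \<open>V is nondecreasing with V 1 = n, so the truncation is inactive and h
            dominates f(V).\<close>
          have Vn: "V x \<le> real n" using mono[of x 1] V1 x by auto
          have hf: "f (V x) \<le> h x" "0 \<le> f (V x)"
            using f_pos[of "V x"] x Vn by (auto simp: h_def approx_eq)
          obtain M where M: "N = Suc M" using N by (cases N) auto
          define D where "D = (1/2) * x ^ (N - 1) * m x * h x - \<kappa> * (f (V x) * m x)"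
          have "((\<lambda>t. t ^ N * (m t)\<^sup>2) has_real_derivative
             real N * x ^ (N - 1) * (m x)\<^sup>2 + 2 * m x * ((h x - 2 * real N * m x) / (4 * x)) * x ^ N) (at x)"
            using dm[OF x(1)] by (auto intro!: derivative_eq_intros)
          also have "real N * x ^ (N - 1) * (m x)\<^sup>2 + 2 * m x * ((h x - 2 * real N * m x) / (4 * x)) * x ^ N
             = (1/2) * x ^ (N - 1) * m x * h x"
            using x by (simp add: M field_simps power2_eq_square)
          finally have "(E has_real_derivative D) (at x)"
            unfolding E_def D_def
            by (intro derivative_intros DERIV_cmult DERIV_chain2[OF F_has_derivative dV] x)
          moreover have "D \<ge> 0"
          proof -
            have "(1/2) ^ (N - 1) \<le> x ^ (N - 1)" using x s0 by (intro power_mono) auto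
            then have "(1/2) ^ (N - 1) * f (V x) \<le> x ^ (N - 1) * h x" using hf x by (intro mult_mono) auto
            then have "((1/2) ^ (N - 1) * f (V x)) * (m x / 2) \<le> (x ^ (N - 1) * h x) * (m x / 2)"
              using mpos[of x] x s0 by (intro mult_right_mono) auto
            then show ?thesis by (simp add: D_def \<kappa>_def mult_ac)
          qed
          ultimately show "\<exists>y. (E has_real_derivative y) (at x) \<and> 0 \<le> y" by blast
        qed
        moreover have "t ^ N * (m t)\<^sup>2 \<le> 1 * (m t)\<^sup>2"
          using t s0 by (intro mult_right_mono power_le_one) auto
        moreover have "0 \<le> s0 ^ N * (m s0)\<^sup>2" using s0 by simp
        ultimately show ?thesis by (simp add: E_def algebra_simps)
      qed
      have "1 - s0 \<le> (1 - s0) / 2"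
        using dV en mpos s0 by (intro K(2)[where V=V and m=m, OF Vs0]) auto
      then show False using s0 by simp
    qed
    then show ?thesis using mono[of s s0] s s0 by auto
  qed
  then show ?thesis by blast
qed

text \<open>The limit W inherits the blow-up from W \<ge> V n. Passing to the limit only yields the
  equation with max 0 f, so it remains to show that W stays where f is nonnegative.\<close>

lemma ex_radial_large_solution:
  assumes N: "N > 0"
  shows "\<exists>W. (\<forall>S<1. continuous_on {0..S} W) \<and>
    (\<forall>t\<in>{0..<1}. W t = W 0 + radial_integral N (\<lambda>t. f (W t)) t) \<and>
    (\<forall>t\<in>{0..<1}. f (W t) \<ge> 0) \<and> filterlim W at_top (at_left 1)"
proof -
  \<comment> \<open>The interval reaches beyond 1 so that V has a two-sided derivative at 1.\<close>
  have "\<exists>V. continuous_on {0..2} V \<and>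
      (\<forall>t\<in>{0..2}. V t = V 0 + radial_integral N (\<lambda>t. approx n (V t)) t) \<and> V 1 = real n" for n
  proof -
    interpret g: bounded_nonlinearity N "approx n" "max 0 (f n) + 1" by (rule approx_bounded_nonlinearity[OF N])
    obtain v where "g.sol v 1 = real n" using g.ex_sol_eq by blast
    moreover have "g.sol v 0 = v" using g.sol_eq[of 0 v] by simp
    moreover have "\<forall>t\<in>{0..2}. g.sol v t = g.sol v 0 + radial_integral N (\<lambda>t. approx n (g.sol v t)) t"
      unfolding calculation(2) by (intro ballI g.sol_eq) simp
    ultimately show ?thesis using g.sol_cont[of 2 v] by blast
  qed
  then obtain V where contV: "\<And>n. continuous_on {0..2} (V n)"
    and V: "\<And>n t. t \<in> {0..2} \<Longrightarrow> V n t = V n 0 + radial_integral N (\<lambda>t. approx n (V n t)) t"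
    and V1: "\<And>n. V n 1 = real n" by metis
  note bn = approx_bounded_nonlinearity[OF N]
  have hc: "continuous_on {0..2} (\<lambda>t. approx n (V n t))" for n
    by (rule bounded_nonlinearity.cont_comp[OF bn contV])
  have mono: "V n s \<le> V n t" if "0 \<le> s" "s \<le> t" "t \<le> 2" for n s t
    using that bounded_nonlinearity.pos[OF bn]
    by (intro radial_solution_mono[OF hc N V]) (auto simp: less_imp_le)
  \<comment> \<open>The values n and n + 1 at the end point 1 are ordered, and the comparison
    carries this order inwards.\<close>
  have inc: "V n s \<le> V (Suc n) s" if s: "s \<in> {0..1}" for n s
  proof (rule radial_comparison[OF hc hc N V V, of 1 n "Suc n"])
    fix t assume t: "t \<in> {0..1}" "V (Suc n) t < V n t"
    then show "approx (Suc n) (V (Suc n) t) < approx n (V n t)"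
      using mono[of t 1 n] V1[of n] by (intro approx_Suc_less) auto
  qed (use V1 s in auto)
  have incs: "incseq (\<lambda>n. V n s)" if "s \<in> {0..1}" for s
    using inc that by (intro incseq_SucI) auto
  define W where "W t = lim (\<lambda>n. V n t)" for t
  have bound: "\<exists>K. \<forall>n. \<forall>s\<in>{0..S}. V n s \<le> K" if S1: "S < 1" for S
  proof -
    obtain K where K: "\<forall>n V. continuous_on {0..2} V \<longrightarrow>
        (\<forall>t\<in>{0..2}. V t = V 0 + radial_integral N (\<lambda>t. approx n (V t)) t) \<longrightarrow> V 1 = real n \<longrightarrow>
        (\<forall>s\<in>{0..S}. V s \<le> K)"
      using radial_bound[OF N S1] by (rule exE)
    have "\<forall>s\<in>{0..S}. V n s \<le> K" for n
      using K[THEN spec, THEN spec, THEN mp, OF contV, of n] V[of _ n] V1[of n] by blast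
    then show ?thesis by blast
  qed
  have lim: "(\<lambda>n. V n t) \<longlonglongrightarrow> W t" if t: "t \<in> {0..<1}" for t
  proof -
    obtain K where "\<And>n. V n t \<le> K" using bound[of t] t by (metis atLeastAtMost_iff atLeastLessThan_iff order_refl)
    then show ?thesis
      unfolding W_def convergent_LIMSEQ_iff[symmetric]
      by (intro incseq_bounded_convergent incs) (use t in auto)
  qed
  define fp where "fp t = max 0 (f t)" for t
  have cfp: "continuous_on UNIV fp" unfolding fp_def by (intro continuous_intros cont_f)
  have *: "continuous_on {0..S} W" "\<And>t. t \<in> {0..S} \<Longrightarrow> W t = W 0 + radial_integral N (\<lambda>t. fp (W t)) t"
    if S: "0 \<le> S" "S < 1" for S
  proof -
    obtain K where K: "\<And>n s. s \<in> {0..S} \<Longrightarrow> V n s \<le> K" using bound[OF S(2)] by blast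
    have h1: "continuous_on {0..S} (\<lambda>t. approx n (V n t))" for n
      by (rule continuous_on_subset[OF hc]) (use S in auto)
    have h2: "\<bar>approx n (V n t)\<bar> \<le> max 0 (f K) + 1" if "t \<in> {0..S}" for n t
    proof -
      have "approx n (V n t) \<le> max 0 (f K) + 1"
        unfolding approx_def using K[OF that, of n]
        by (intro add_mono max.mono monoD[OF mono_f]) (auto simp: field_simps)
      then show ?thesis using bounded_nonlinearity.pos[OF bn, of n "V n t"] by simp
    qed
    have h3: "(\<lambda>n. approx n (V n t)) \<longlonglongrightarrow> fp (W t)" if t: "t \<in> {0..S}" for t
    proof -
      have inv: "(\<lambda>n. 1 / (real n + 1)) \<longlonglongrightarrow> 0"
        using LIMSEQ_inverse_real_of_nat by (simp add: inverse_eq_divide add.commute)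
      have "(\<lambda>n. fp (V n t) + 1 / (real n + 1)) \<longlonglongrightarrow> fp (W t) + 0"
        using t S by (intro tendsto_add continuous_on_tendsto_compose[OF cfp lim] inv) auto
      moreover have "eventually (\<lambda>n. fp (V n t) + 1 / (real n + 1) = approx n (V n t)) sequentially"
        using eventually_ge_at_top[of "nat \<lceil>K\<rceil>"]
      proof eventually_elim
        case (elim n)
        then have "K \<le> real n" by linarith
        then show ?case using K[OF t, of n] by (simp add: approx_eq fp_def)
      qed
      ultimately have "(\<lambda>n. approx n (V n t)) \<longlonglongrightarrow> fp (W t) + 0" by (rule Lim_transform_eventually)
      then show ?thesis by simp
    qed
    have h4: "V n t = V n 0 + radial_integral N (\<lambda>t. approx n (V n t)) t" if "t \<in> {0..S}" for n t
      using that S by (intro V) auto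
    have h5: "(\<lambda>n. V n t) \<longlonglongrightarrow> W t" if "t \<in> {0..S}" for t
      using that S by (intro lim) auto
    note L = radial_solution_limit[OF h1 h2 h4 h5 h3 N S(1)]
    show "continuous_on {0..S} W" by (rule L(1))
    show "W t = W 0 + radial_integral N (\<lambda>t. fp (W t)) t" if "t \<in> {0..S}" for t
      by (rule L(2)[OF _ _ _ _ that])
  qed
  have blow: "filterlim W at_top (at_left 1)"
    unfolding filterlim_at_top
  proof
    fix Z :: real
    obtain n :: nat where n: "Z < real n" using reals_Archimedean2 by blast
    have "(V n \<longlongrightarrow> V n 1) (at 1)"
      using contV[of n] by (auto simp: continuous_on at_within_Icc_at dest: bspec[of _ _ 1])
    then have "eventually (\<lambda>t. Z < V n t) (at_left 1)"
      using n V1[of n] by (intro order_tendstoD(1)[where y="V n 1"]) (auto intro: tendsto_mono[OF at_le])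
    moreover have "eventually (\<lambda>t. t \<in> {0<..<1}) (at_left (1::real))"
      using eventually_at_left_real[of 0 "1::real"] by simp
    ultimately show "eventually (\<lambda>t. Z \<le> W t) (at_left 1)"
    proof eventually_elim
      case (elim t)
      then have "V n t \<le> W t" by (intro incseq_le[OF incs lim]) auto
      then show ?case using elim by simp
    qed
  qed
  have monoW: "W s \<le> W t" if "0 \<le> s" "s \<le> t" "t < 1" for s t
    using that mono by (intro LIMSEQ_le[OF lim lim]) auto
  \<comment> \<open>If f(W 0) < 0, then f is still negative at some d > W 0. Until W reaches d the
    right-hand side max 0 f vanishes, so W is constant and never reaches d, against the
    blow-up.\<close>
  have f0: "f (W 0) \<ge> 0"
  proof (rule ccontr)
    assume "\<not> f (W 0) \<ge> 0"
    then have "f (W 0) < 0" by simp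
    moreover have "(f \<longlongrightarrow> f (W 0)) (at_right (W 0))"
      using cont_f by (auto simp: continuous_on_eq_continuous_at isCont_def intro: tendsto_mono[OF at_le])
    ultimately have "eventually (\<lambda>t. f t < 0) (at_right (W 0))" by (auto dest: order_tendstoD(2))
    then obtain d where d: "d > W 0" "f d < 0"
      using eventually_happens[OF eventually_conj[OF _ eventually_at_right_less[of "W 0"]]] by fastforce
    have e1: "eventually (\<lambda>t. d \<le> W t) (at_left 1)" using blow by (simp add: filterlim_at_top)
    have e2: "eventually (\<lambda>t. t \<in> {0<..<1}) (at_left (1::real))"
      using eventually_at_left_real[of 0 "1::real"] by simp
    obtain t where t: "0 < t" "t < 1" "d \<le> W t"
      using eventually_happens[OF eventually_conj[OF e1 e2]] by auto
    have "\<exists>x\<ge>0. x \<le> t \<and> W x = d"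
      by (rule IVT') (use t d *(1)[of t] in simp_all)
    then obtain x where x: "0 \<le> x" "x \<le> t" "W x = d" by blast
    have "fp (W y) = 0" if "y \<in> {0..x}" for y
    proof -
      have "f (W y) \<le> f d" using monoW[of y x] that x t by (intro monoD[OF mono_f]) auto
      then show ?thesis using d by (simp add: fp_def)
    qed
    then have "radial_integral N (\<lambda>t. fp (W t)) x \<le> radial_integral N (\<lambda>t. 0) x"
      using x t *(1)[of x] by (intro radial_integral_mono[of x] continuous_on_compose2[OF cfp]) auto
    moreover have "radial_integral N (\<lambda>t. 0) x = 0" using radial_integral_cmult[of N 0 "\<lambda>_. 0" x] by simp
    ultimately have "W x \<le> W 0" using *(2)[of x x] x t by simp
    then show False using x d by simp
  qed
  have f_nonneg: "f (W t) \<ge> 0" if "t \<in> {0..<1}" for t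
    using f0 monoD[OF mono_f monoW[of 0 t]] that by auto
  have eq: "W t = W 0 + radial_integral N (\<lambda>t. f (W t)) t" if t: "t \<in> {0..<1}" for t
  proof -
    have "radial_integral N (\<lambda>t. fp (W t)) t = radial_integral N (\<lambda>t. f (W t)) t"
      using t f_nonneg *(1)[of t] by (intro antisym radial_integral_mono[of t] continuous_on_compose2[OF cfp] continuous_on_compose2[OF cont_f])
        (auto simp: fp_def)
    then show ?thesis using *(2)[of t t] t by auto
  qed
  have cont: "continuous_on {0..S} W" if "S < 1" for S
    using *(1)[of S] that by (cases "S \<ge> 0") auto
  show ?thesis
    by (rule exI[of _ W]) (intro conjI ballI allI impI cont f_nonneg blow eq)
qed

end

section \<open>Second differences and Green's formula\<close>

abbreviation has_axis_derivative :: "'n::finite \<Rightarrow> (real ^ 'n \<Rightarrow> real) \<Rightarrow> real ^ 'n \<Rightarrow> real \<Rightarrow> bool" where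
  "has_axis_derivative i z x D \<equiv> ((\<lambda>t. z (x + t *\<^sub>R axis i 1)) has_real_derivative D) (at 0)"

text \<open>A C^2 notion adapted to second differences: these see only pure second derivatives along
  the axes, so only those are required to be continuous.\<close>

definition has_laplacian :: "(real ^ 'n::finite) set \<Rightarrow> (real ^ 'n \<Rightarrow> real) \<Rightarrow> (real ^ 'n \<Rightarrow> real) \<Rightarrow> bool" where
  "has_laplacian \<Omega> z L \<longleftrightarrow> continuous_on \<Omega> z \<and>
     (\<exists>d1 d2. (\<forall>i. \<forall>x\<in>\<Omega>. has_axis_derivative i z x (d1 i x) \<and>
                      has_axis_derivative i (d1 i) x (d2 i x)) \<and>
              (\<forall>i. continuous_on \<Omega> (d2 i)) \<and> (\<forall>x\<in>\<Omega>. L x = (\<Sum>i\<in>UNIV. d2 i x)))"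

lemma has_laplacianI:
  assumes "continuous_on \<Omega> z"
    and "\<And>i x. x \<in> \<Omega> \<Longrightarrow> has_axis_derivative i z x (d1 i x)"
    and "\<And>i x. x \<in> \<Omega> \<Longrightarrow> has_axis_derivative i (d1 i) x (d2 i x)"
    and "\<And>i. continuous_on \<Omega> (d2 i)" and "\<And>x. x \<in> \<Omega> \<Longrightarrow> L x = (\<Sum>i\<in>UNIV. d2 i x)"
  shows "has_laplacian \<Omega> z L"
  using assms unfolding has_laplacian_def by blast

definition second_difference :: "real \<Rightarrow> (real ^ 'n::finite \<Rightarrow> real) \<Rightarrow> real ^ 'n \<Rightarrow> real" where
  "second_difference h z x = (\<Sum>i\<in>UNIV. z (x + h *\<^sub>R axis i 1) + z (x - h *\<^sub>R axis i 1) - 2 * z x)"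

text \<open>Two applications of the mean value theorem to \<phi>(t) + \<phi>(-t) - c t^2. The
  intermediate point y enters together with -y, hence the factor 2.\<close>

lemma second_difference_bound_1d:
  fixes \<phi> \<phi>1 \<phi>2 :: "real \<Rightarrow> real"
  assumes h: "0 < h"
    and d: "\<And>t. \<bar>t\<bar> \<le> h \<Longrightarrow> (\<phi> has_real_derivative \<phi>1 t) (at t)"
      "\<And>t. \<bar>t\<bar> \<le> h \<Longrightarrow> (\<phi>1 has_real_derivative \<phi>2 t) (at t)"
    and c: "\<And>t. \<bar>t\<bar> \<le> h \<Longrightarrow> \<bar>\<phi>2 t - c\<bar> \<le> e"
  shows "\<bar>\<phi> h + \<phi> (- h) - 2 * \<phi> 0 - c * h\<^sup>2\<bar> \<le> 2 * e * h\<^sup>2"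
proof -
  have neg: "((\<lambda>t. f (- t)) has_real_derivative - f' (- t)) (at t)"
    if "(f has_real_derivative f' (- t)) (at (- t))" for f f' :: "real \<Rightarrow> real" and t
  proof -
    have "(uminus has_real_derivative -1) (at t)" by (auto intro!: derivative_eq_intros)
    from DERIV_chain2[OF that this] show ?thesis by simp
  qed
  define k where "k t = \<phi> t + \<phi> (- t) - c * t\<^sup>2" for t
  define l where "l t = \<phi>1 t - \<phi>1 (- t) - 2 * c * t" for t
  have "(k has_real_derivative l t) (at t)" if "0 \<le> t" "t \<le> h" for t
    unfolding k_def l_def using that by (auto intro!: derivative_eq_intros d(1) neg[of \<phi> \<phi>1])
  then obtain x where x: "0 < x" "x < h" "k h - k 0 = (h - 0) * l x"
    using MVT2[OF h, of k l] by auto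
  have "(l has_real_derivative (\<phi>2 t + \<phi>2 (- t) - 2 * c)) (at t)" if "0 \<le> t" "t \<le> x" for t
    unfolding l_def using that x by (auto intro!: derivative_eq_intros d(2) neg[of \<phi>1 \<phi>2])
  then obtain y where y: "0 < y" "y < x" "l x - l 0 = (x - 0) * (\<phi>2 y + \<phi>2 (- y) - 2 * c)"
    using MVT2[OF x(1), of l "\<lambda>t. \<phi>2 t + \<phi>2 (- t) - 2 * c"] by auto
  have e: "\<bar>\<phi>2 y + \<phi>2 (- y) - 2 * c\<bar> \<le> 2 * e"
    using c[of y] c[of "-y"] x y by auto
  have "\<bar>k h - k 0\<bar> = h * x * \<bar>\<phi>2 y + \<phi>2 (- y) - 2 * c\<bar>"
    using x y h by (simp add: abs_mult l_def)
  also have "\<dots> \<le> h * h * (2 * e)" using x h e by (intro mult_mono) auto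
  also have "k h - k 0 = \<phi> h + \<phi> (- h) - 2 * \<phi> 0 - c * h\<^sup>2" by (simp add: k_def)
  finally show ?thesis by (simp add: power2_eq_square mult.commute mult.left_commute)
qed

lemma norm_scaleR_axis [simp]: "norm (t *\<^sub>R axis i (1::real) :: real ^ 'n::finite) = \<bar>t\<bar>"
  by (simp add: norm_axis_1)

lemma second_difference_estimate:
  fixes z :: "real ^ 'n::finite \<Rightarrow> real"
  assumes h: "0 < h" and sub: "cball x h \<subseteq> \<Omega>"
    and d: "\<And>i x. x \<in> \<Omega> \<Longrightarrow> has_axis_derivative i z x (d1 i x)"
      "\<And>i x. x \<in> \<Omega> \<Longrightarrow> has_axis_derivative i (d1 i) x (d2 i x)"
    and c: "\<And>i y. y \<in> cball x h \<Longrightarrow> \<bar>d2 i y - c i\<bar> \<le> e"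
  shows "\<bar>second_difference h z x - (\<Sum>i\<in>UNIV. c i) * h\<^sup>2\<bar> \<le> real CARD('n) * (2 * e * h\<^sup>2)"
proof -
  have mem: "x + t *\<^sub>R axis i 1 \<in> cball x h" if "\<bar>t\<bar> \<le> h" for t and i :: 'n
    using that by (simp add: dist_norm)
  have shift: "((\<lambda>t. f (x + t *\<^sub>R axis i 1)) has_real_derivative f') (at t)"
    if "((\<lambda>s. f ((x + t *\<^sub>R axis i 1) + s *\<^sub>R axis i 1)) has_real_derivative f') (at 0)"
    for f :: "real ^ 'n \<Rightarrow> real" and i t f'
    using DERIV_shift[of "\<lambda>t. f (x + t *\<^sub>R axis i 1)" f' 0 t] that by (simp add: algebra_simps)
  have "\<bar>z (x + h *\<^sub>R axis i 1) + z (x - h *\<^sub>R axis i 1) - 2 * z x - c i * h\<^sup>2\<bar> \<le> 2 * e * h\<^sup>2" for i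
    using second_difference_bound_1d[OF h, of "\<lambda>t. z (x + t *\<^sub>R axis i 1)" "\<lambda>t. d1 i (x + t *\<^sub>R axis i 1)"
       "\<lambda>t. d2 i (x + t *\<^sub>R axis i 1)" "c i" e] shift d mem sub c
    by (auto simp: subset_iff)
  then have "\<bar>\<Sum>i\<in>UNIV. z (x + h *\<^sub>R axis i 1) + z (x - h *\<^sub>R axis i 1) - 2 * z x - c i * h\<^sup>2\<bar>
      \<le> (\<Sum>i\<in>(UNIV :: 'n set). 2 * e * h\<^sup>2)"
    by (intro order_trans[OF sum_abs] sum_mono)
  then show ?thesis by (simp add: second_difference_def sum_subtractf sum_distrib_right)
qed

lemma second_difference_tendsto:
  fixes z :: "real ^ 'n::finite \<Rightarrow> real"
  assumes z: "has_laplacian \<Omega> z L" and x: "x \<in> \<Omega>" and "open \<Omega>"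
  shows "((\<lambda>h. second_difference h z x / h\<^sup>2) \<longlongrightarrow> L x) (at_right 0)"
proof -
  obtain d1 d2 where d: "\<And>i x. x \<in> \<Omega> \<Longrightarrow> has_axis_derivative i z x (d1 i x)"
      "\<And>i x. x \<in> \<Omega> \<Longrightarrow> has_axis_derivative i (d1 i) x (d2 i x)"
      "\<And>i. continuous_on \<Omega> (d2 i)" "\<And>x. x \<in> \<Omega> \<Longrightarrow> L x = (\<Sum>i\<in>UNIV. d2 i x)"
    using z unfolding has_laplacian_def by blast
  show ?thesis
  proof (rule tendstoI)
    fix e :: real assume e: "e > 0"
    define e' where "e' = e / (4 * real CARD('n))"
    have e': "e' > 0" using e by (simp add: e'_def)
    have "\<exists>r>0. \<forall>y\<in>cball x r. y \<in> \<Omega> \<and> \<bar>d2 i y - d2 i x\<bar> \<le> e'" for i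
    proof -
      have "isCont (d2 i) x" using d(3) x \<open>open \<Omega>\<close> by (simp add: continuous_on_eq_continuous_at)
      then have "eventually (\<lambda>y. dist (d2 i y) (d2 i x) < e') (nhds x)"
        using e' by (auto simp: isCont_def tendsto_at_iff_tendsto_nhds dest: tendstoD)
      moreover have "eventually (\<lambda>y. y \<in> \<Omega>) (nhds x)" using x \<open>open \<Omega>\<close> by (auto simp: eventually_nhds)
      ultimately have "eventually (\<lambda>y. y \<in> \<Omega> \<and> \<bar>d2 i y - d2 i x\<bar> \<le> e') (nhds x)"
        by eventually_elim (auto simp: dist_real_def)
      then obtain r where "r > 0" "\<And>y. dist y x < r \<Longrightarrow> y \<in> \<Omega> \<and> \<bar>d2 i y - d2 i x\<bar> \<le> e'"
        unfolding eventually_nhds_metric by blast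
      then show ?thesis by (intro exI[of _ "r / 2"]) (auto simp: dist_commute)
    qed
    then obtain r where r: "\<And>i. r i > 0" "\<And>i y. y \<in> cball x (r i) \<Longrightarrow> y \<in> \<Omega> \<and> \<bar>d2 i y - d2 i x\<bar> \<le> e'"
      by metis
    define R where "R = Min (range r)"
    have R: "R > 0" "\<And>i. R \<le> r i" using r(1) by (auto simp: R_def)
    have "dist (second_difference h z x / h\<^sup>2) (L x) < e" if h: "0 < h" "h < R" for h
    proof -
      have cb: "cball x h \<subseteq> cball x (r i)" for i using h R(2)[of i] by auto
      have "\<bar>second_difference h z x - (\<Sum>i\<in>UNIV. d2 i x) * h\<^sup>2\<bar> \<le> real CARD('n) * (2 * e' * h\<^sup>2)"
        using r(2) cb by (intro second_difference_estimate[OF h(1) _ d(1,2)]) blast+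
      also have "\<dots> = e / 2 * h\<^sup>2" by (simp add: e'_def)
      finally have "\<bar>second_difference h z x / h\<^sup>2 - L x\<bar> \<le> e / 2"
        using h d(4)[OF x] by (simp add: field_simps abs_le_iff)
      then show ?thesis using e by (simp add: dist_real_def)
    qed
    then show "eventually (\<lambda>h. dist (second_difference h z x / h\<^sup>2) (L x) < e) (at_right 0)"
      using R(1) unfolding eventually_at_right_field by (intro exI[of _ R]) auto
  qed
qed

text \<open>The estimate centred at 0 instead of at the second derivatives; it provides the
  dominating functions for the passage to the limit.\<close>

lemma second_difference_bounded:
  fixes z :: "real ^ 'n::finite \<Rightarrow> real"
  assumes z: "has_laplacian \<Omega> z L" and K: "compact K" "K \<subseteq> \<Omega>"
  shows "\<exists>C\<ge>0. \<forall>x h. 0 < h \<longrightarrow> cball x h \<subseteq> K \<longrightarrow> \<bar>second_difference h z x\<bar> \<le> C * h\<^sup>2"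
proof -
  obtain d1 d2 where d: "\<And>i x. x \<in> \<Omega> \<Longrightarrow> has_axis_derivative i z x (d1 i x)"
      "\<And>i x. x \<in> \<Omega> \<Longrightarrow> has_axis_derivative i (d1 i) x (d2 i x)"
      "\<And>i. continuous_on \<Omega> (d2 i)"
    using z unfolding has_laplacian_def by blast
  have "\<exists>B. \<forall>y\<in>K. \<bar>d2 i y\<bar> \<le> B" for i
    using compact_imp_bounded[OF compact_continuous_image[OF continuous_on_subset[OF d(3) K(2)] K(1)], of i]
    by (auto simp: bounded_iff)
  then obtain B where B: "\<And>i y. y \<in> K \<Longrightarrow> \<bar>d2 i y\<bar> \<le> B i" by metis
  define M where "M = Max (insert 0 (range B))"
  have M: "M \<ge> 0" "\<And>i. B i \<le> M" unfolding M_def by (intro Max_ge; simp)+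
  have "\<bar>second_difference h z x\<bar> \<le> (real CARD('n) * (2 * M)) * h\<^sup>2" if "0 < h" "cball x h \<subseteq> K" for x h
  proof -
    have b: "\<bar>d2 i y - 0\<bar> \<le> M" if "y \<in> cball x h" for i y
      using B[of y i] M(2)[of i] that \<open>cball x h \<subseteq> K\<close> by auto
    have "cball x h \<subseteq> \<Omega>" by (rule order_trans[OF that(2) K(2)])
    from second_difference_estimate[OF that(1) this d(1,2) b] show ?thesis by (simp add: mult_ac)
  qed
  then show ?thesis using M(1) by (intro exI[of _ "real CARD('n) * (2 * M)"]) auto
qed

section \<open>Test functions under second differences\<close>

lemma smooth_fun_partial_derivs:
  fixes \<phi> :: "real ^ 'n::finite \<Rightarrow> real"
  assumes "smooth_fun \<phi>"
  shows "foldr partial_deriv js \<phi> differentiable (at x)"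
    and "continuous_on X (foldr partial_deriv js \<phi>)"
    and "((\<lambda>t. foldr partial_deriv js \<phi> (x + t *\<^sub>R axis i 1)) has_real_derivative
        partial_deriv i (foldr partial_deriv js \<phi>) x) (at 0)"
proof -
  have d: "foldr partial_deriv js \<phi> differentiable (at x)" for js x
    using assms unfolding smooth_fun_def differentiable_on_def by blast
  show "foldr partial_deriv js \<phi> differentiable (at x)" by (rule d)
  show "continuous_on X (foldr partial_deriv js \<phi>)"
    by (intro continuous_at_imp_continuous_on ballI differentiable_imp_continuous_within d)
  have "(\<lambda>t. foldr partial_deriv js \<phi> (x + t *\<^sub>R axis i 1)) differentiable (at 0)"
  proof (rule differentiable_compose[of "foldr partial_deriv js \<phi>"])
    show "foldr partial_deriv js \<phi> differentiable (at (x + 0 *\<^sub>R axis i 1))" by (rule d)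
    have "((\<lambda>t. x + t *\<^sub>R axis i 1) has_derivative (\<lambda>t. t *\<^sub>R axis i 1)) (at (0::real))"
      by (auto intro!: derivative_eq_intros)
    then show "(\<lambda>t. x + t *\<^sub>R axis i 1) differentiable (at (0::real))" by (rule differentiableI)
  qed
  then show "((\<lambda>t. foldr partial_deriv js \<phi> (x + t *\<^sub>R axis i 1)) has_real_derivative
      partial_deriv i (foldr partial_deriv js \<phi>) x) (at 0)"
    unfolding partial_deriv_def by (rule DERIV_deriv_iff_real_differentiable[THEN iffD2])
qed

lemma smooth_fun_has_laplacian:
  assumes "smooth_fun \<phi>"
  shows "has_laplacian UNIV \<phi> (laplacian \<phi>)"
proof (rule has_laplacianI[where ?d1.0="\<lambda>i. partial_deriv i \<phi>" and ?d2.0="\<lambda>i. partial_deriv i (partial_deriv i \<phi>)"])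
  show "continuous_on UNIV \<phi>" using smooth_fun_partial_derivs(2)[OF assms, of UNIV "[]"] by simp
  show "has_axis_derivative i \<phi> x (partial_deriv i \<phi> x)" for i x
    using smooth_fun_partial_derivs(3)[OF assms, of "[]" x i] by simp
  show "has_axis_derivative i (partial_deriv i \<phi>) x (partial_deriv i (partial_deriv i \<phi>) x)" for i x
    using smooth_fun_partial_derivs(3)[OF assms, of "[i]" x i] by simp
  show "continuous_on UNIV (partial_deriv i (partial_deriv i \<phi>))" for i
    using smooth_fun_partial_derivs(2)[OF assms, of UNIV "[i,i]"] by simp
qed (simp add: laplacian_def)

lemma partial_deriv_zero_outside:
  assumes "open X" "x \<in> X" "\<And>y. y \<in> X \<Longrightarrow> \<phi> y = 0"
  shows "partial_deriv i \<phi> x = 0"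
proof -
  have "((\<lambda>t. x + t *\<^sub>R axis i 1) \<longlongrightarrow> x + 0 *\<^sub>R axis i 1) (nhds (0::real))"
    by (intro tendsto_intros filterlim_ident)
  then have "eventually (\<lambda>t. x + t *\<^sub>R axis i 1 \<in> X) (nhds (0::real))"
    using assms(1,2) by (auto intro: topological_tendstoD)
  then have "eventually (\<lambda>t. \<phi> (x + t *\<^sub>R axis i 1) = 0) (nhds (0::real))"
    by eventually_elim (rule assms(3))
  then have "deriv (\<lambda>t. \<phi> (x + t *\<^sub>R axis i 1)) 0 = deriv (\<lambda>t. 0) (0::real)"
    by (intro deriv_cong_ev) auto
  then show ?thesis by (simp add: partial_deriv_def)
qed

lemma laplacian_zero_outside:
  assumes "x \<notin> closure {y. \<phi> y \<noteq> 0}"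
  shows "laplacian \<phi> x = 0"
proof -
  have o: "open (- closure {y. \<phi> y \<noteq> 0})" by auto
  have 0: "\<phi> y = 0" if "y \<in> - closure {y. \<phi> y \<noteq> 0}" for y
    using that closure_subset[of "{y. \<phi> y \<noteq> 0}"] by auto
  have 1: "partial_deriv i \<phi> y = 0" if "y \<in> - closure {y. \<phi> y \<noteq> 0}" for i y
    by (rule partial_deriv_zero_outside[OF o that 0])
  have "partial_deriv i (partial_deriv i \<phi>) x = 0" for i
    by (rule partial_deriv_zero_outside[OF o _ 1]) (use assms in auto)
  then show ?thesis by (simp add: laplacian_def)
qed

lemma integral_lborel_translate:
  fixes g :: "'a::euclidean_space \<Rightarrow> real"
  assumes "g \<in> borel_measurable borel"
  shows "(\<integral>x. g (v + x) \<partial>lborel) = (\<integral>x. g x \<partial>lborel)"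
  using integral_distr[of "(+) v" lborel borel g] assms by (simp add: lborel_distr_plus)

text \<open>If the support lies in the ball of radius R, then for norm x > R + 1 and steps h \<le> 1
  all points involved miss it, and otherwise they lie in the compact ball of radius R + 2.\<close>

lemma test_function_second_difference_bound:
  fixes \<phi> :: "real ^ 'n::finite \<Rightarrow> real"
  assumes "smooth_fun \<phi>" "compact (closure {x. \<phi> x \<noteq> 0})"
  shows "\<exists>C\<ge>0. \<forall>h x. 0 < h \<longrightarrow> h \<le> 1 \<longrightarrow> \<bar>second_difference h \<phi> x\<bar> \<le> C * h\<^sup>2"
proof -
  obtain R where R': "\<And>x. x \<in> closure {x. \<phi> x \<noteq> 0} \<Longrightarrow> norm x \<le> R"
    using compact_imp_bounded[OF assms(2)] unfolding bounded_iff by blast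
  have R: "norm x \<le> R" if "\<phi> x \<noteq> 0" for x
    using that by (intro R' subsetD[OF closure_subset]) simp
  obtain C where C: "C \<ge> 0" "\<And>x h. 0 < h \<Longrightarrow> cball x h \<subseteq> cball 0 (R + 2) \<Longrightarrow> \<bar>second_difference h \<phi> x\<bar> \<le> C * h\<^sup>2"
    using second_difference_bounded[OF smooth_fun_has_laplacian[OF assms(1)] compact_cball[of 0 "R + 2"]] by auto
  have "\<bar>second_difference h \<phi> x\<bar> \<le> C * h\<^sup>2" if h: "0 < h" "h \<le> 1" for h x
  proof (cases "norm x \<le> R + 1")
    case True
    have "cball x h \<subseteq> cball 0 (R + 2)"
    proof
      fix y assume "y \<in> cball x h"
      then have "norm (x - y) \<le> h" by (simp add: dist_norm)
      with norm_triangle_ineq4[of x "x - y"] True h show "y \<in> cball 0 (R + 2)" by simp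
    qed
    with h(1) show ?thesis by (rule C(2))
  next
    case False
    have *: "\<phi> (x + v) = 0" if "norm v \<le> 1" for v
    proof (rule ccontr)
      assume "\<phi> (x + v) \<noteq> 0"
      then have "norm (x + v) \<le> R" by (rule R)
      with norm_triangle_ineq4[of "x + v" v] that False show False by simp
    qed
    have "\<phi> (x + h *\<^sub>R axis i 1) = 0" "\<phi> (x - h *\<^sub>R axis i 1) = 0" "\<phi> x = 0" for i
      using *[of "h *\<^sub>R axis i 1"] *[of "- (h *\<^sub>R axis i 1)"] *[of 0] h by auto
    then have "second_difference h \<phi> x = 0" by (simp add: second_difference_def)
    then show ?thesis using C(1) by simp
  qed
  then show ?thesis using C(1) by blast
qed

text \<open>All differences fall on \<phi>, where they are bounded uniformly in x, so a multiple of
  |w| dominates. It is used both for the truncated z of Green's formula and for the mollified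
  difference in the touching principle.\<close>

lemma integral_second_difference_tendsto:
  fixes \<phi> w :: "real ^ 'n::finite \<Rightarrow> real"
  assumes \<phi>: "smooth_fun \<phi>" "compact (closure {x. \<phi> x \<noteq> 0})" and w: "integrable lborel w"
    and h: "\<And>n. 0 < h n" "\<And>n. h n \<le> 1" "h \<longlonglongrightarrow> 0"
  shows "(\<lambda>n. (\<integral>x. w x * (second_difference (h n) \<phi> x / (h n)\<^sup>2) \<partial>lborel)) \<longlonglongrightarrow> (\<integral>x. w x * laplacian \<phi> x \<partial>lborel)"
proof -
  obtain C where C: "C \<ge> 0" "\<And>h x. 0 < h \<Longrightarrow> h \<le> 1 \<Longrightarrow> \<bar>second_difference h \<phi> x\<bar> \<le> C * h\<^sup>2"
    using test_function_second_difference_bound[OF \<phi>] by auto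
  have c\<phi>: "continuous_on UNIV \<phi>" using smooth_fun_partial_derivs(2)[OF \<phi>(1), of UNIV "[]"] by simp
  have [measurable]: "w \<in> borel_measurable borel" using borel_measurable_integrable[OF w] by simp
  have [measurable]: "second_difference h \<phi> \<in> borel_measurable borel" for h
    unfolding second_difference_def[abs_def]
    by (intro borel_measurable_continuous_onI continuous_intros continuous_on_compose2[OF c\<phi>]) auto
  have lim: "(\<lambda>n. second_difference (h n) \<phi> x / (h n)\<^sup>2) \<longlonglongrightarrow> laplacian \<phi> x" for x
    using h(1) by (intro filterlim_compose[OF second_difference_tendsto[OF smooth_fun_has_laplacian[OF \<phi>(1)]]])
      (auto simp: filterlim_at h(3) less_imp_neq[OF h(1), THEN not_sym])
  have [measurable]: "laplacian \<phi> \<in> borel_measurable borel"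
    by (rule borel_measurable_LIMSEQ_real[OF lim]) measurable
  show ?thesis
  proof (rule integral_dominated_convergence[where w="\<lambda>x. C * \<bar>w x\<bar>"])
    show "integrable lborel (\<lambda>x. C * \<bar>w x\<bar>)" using w by auto
    show "AE x in lborel. (\<lambda>n. w x * (second_difference (h n) \<phi> x / (h n)\<^sup>2)) \<longlonglongrightarrow> w x * laplacian \<phi> x"
      by (intro AE_I2 tendsto_intros lim)
    show "AE x in lborel. norm (w x * (second_difference (h n) \<phi> x / (h n)\<^sup>2)) \<le> C * \<bar>w x\<bar>" for n
    proof (intro AE_I2)
      fix x
      have "\<bar>second_difference (h n) \<phi> x / (h n)\<^sup>2\<bar> \<le> C"
        using C(2)[OF h(1,2), of n x] h(1)[of n] by (simp add: abs_divide divide_le_eq)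
      then have "\<bar>w x\<bar> * \<bar>second_difference (h n) \<phi> x / (h n)\<^sup>2\<bar> \<le> \<bar>w x\<bar> * C"
        by (intro mult_left_mono) auto
      then show "norm (w x * (second_difference (h n) \<phi> x / (h n)\<^sup>2)) \<le> C * \<bar>w x\<bar>"
        by (simp only: norm_mult real_norm_def abs_mult mult.commute[of C])
    qed
  qed measurable
qed

text \<open>Green's formula without integration by parts: second differences can be moved from one factor to the
  other by translation invariance of the Lebesgue measure.\<close>

lemma distributional_laplacian_classical:
  fixes z :: "real ^ 'n::finite \<Rightarrow> real"
  assumes z: "has_laplacian \<Omega> z L" and "open \<Omega>"
  shows "distributional_laplacian \<Omega> z L"
  unfolding distributional_laplacian_def
proof (intro allI impI)
  fix \<phi> :: "real ^ 'n \<Rightarrow> real" assume "test_function \<Omega> \<phi>"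
  define K where "K = closure {x. \<phi> x \<noteq> 0}"
  have \<phi>: "smooth_fun \<phi>" and K: "compact K" "K \<subseteq> \<Omega>"
    using \<open>test_function \<Omega> \<phi>\<close> by (auto simp: test_function_def K_def)
  have \<phi>0: "\<phi> x = 0" if "x \<notin> K" for x using that closure_subset[of "{x. \<phi> x \<noteq> 0}"] by (auto simp: K_def)
  have c\<phi>: "continuous_on UNIV \<phi>" using smooth_fun_partial_derivs(2)[OF \<phi>, of UNIV "[]"] by simp
  obtain e where e: "e > 0" "(\<Union>x\<in>K. cball x e) \<subseteq> \<Omega>"
    using compact_subset_open_imp_cball_epsilon_subset[OF K(1) \<open>open \<Omega>\<close> K(2)] by blast
  \<comment> \<open>A closed e-neighbourhood of the support. Cutting z off outside it makes z
    integrable on the whole space, so that translations act freely, and is not felt by second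
    differences at points of K with steps up to e.\<close>
  define K' where "K' = {x + y | x y. x \<in> K \<and> y \<in> cball 0 e}"
  have K': "compact K'" unfolding K'_def by (intro compact_sums K(1) compact_cball)
  have inK': "y \<in> K'" if "x \<in> K" "dist x y \<le> e" for x y
    unfolding K'_def using that
    by (intro CollectI exI[of _ x] exI[of _ "y - x"]) (simp add: dist_norm norm_minus_commute)
  have K'\<Omega>: "K' \<subseteq> \<Omega>"
    unfolding K'_def using e(2) by (force simp: dist_norm)
  have KK': "K \<subseteq> K'" using inK' e(1) by auto
  define w where "w x = indicator K' x * z x" for x
  have contz: "continuous_on K' z"
    using z K'\<Omega> by (auto simp: has_laplacian_def intro: continuous_on_subset)
  have intw: "integrable lborel (\<lambda>x. w x * p x)" if "continuous_on UNIV p" for p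
  proof -
    have "integrable lborel (\<lambda>x. indicator K' x *\<^sub>R (z x * p x))"
      by (intro borel_integrable_compact K' continuous_intros contz continuous_on_subset[OF that]) auto
    then show ?thesis by (simp add: w_def mult.assoc)
  qed
  have w: "integrable lborel w" using intw[of "\<lambda>_. 1"] by simp
  have [measurable]: "w \<in> borel_measurable borel" using borel_measurable_integrable[OF w] by simp
  have [measurable]: "\<phi> \<in> borel_measurable borel" by (intro borel_measurable_continuous_onI c\<phi>)
  have int\<phi>: "integrable lborel (\<lambda>x. w (x + v) * \<phi> x)" "(\<integral>x. w (x + v) * \<phi> x \<partial>lborel) = (\<integral>x. w x * \<phi> (x - v) \<partial>lborel)" for v
  proof -
    define g where "g x = w x * \<phi> (x - v)" for x
    have g: "integrable lborel g"
      unfolding g_def by (intro intw continuous_on_compose2[OF c\<phi>] continuous_intros) auto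
    have gm: "g \<in> borel_measurable borel" using borel_measurable_integrable[OF g] by simp
    have "integrable (distr lborel borel ((+) v)) g" using g by (simp add: lborel_distr_plus)
    then have "integrable lborel (\<lambda>x. g (v + x))" using integrable_distr_eq[of "(+) v" lborel borel g] gm by simp
    then show "integrable lborel (\<lambda>x. w (x + v) * \<phi> x)" by (simp add: g_def add.commute)
    show "(\<integral>x. w (x + v) * \<phi> x \<partial>lborel) = (\<integral>x. w x * \<phi> (x - v) \<partial>lborel)"
      using integral_lborel_translate[OF gm, of v] by (simp add: g_def add.commute)
  qed
  \<comment> \<open>Discrete integration by parts: a translation moves each shift from \<phi> to w
    with the opposite sign, and the two signs occur symmetrically.\<close>
  have swap: "(\<integral>x. w x * second_difference h \<phi> x \<partial>lborel) = (\<integral>x. second_difference h w x * \<phi> x \<partial>lborel)" for h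
  proof -
    have i: "integrable lborel (\<lambda>x. w x * \<phi> (x + v))" for v
      by (intro intw continuous_on_compose2[OF c\<phi>] continuous_intros) auto
    have i': "integrable lborel (\<lambda>x. w x * \<phi> (x - v))" for v
      by (intro intw continuous_on_compose2[OF c\<phi>] continuous_intros) auto
    have j: "integrable lborel (\<lambda>x. w (x - v) * \<phi> x)" "(\<integral>x. w (x - v) * \<phi> x \<partial>lborel) = (\<integral>x. w x * \<phi> (x + v) \<partial>lborel)" for v
      using int\<phi>[of "- v"] by auto
    have i0: "integrable lborel (\<lambda>x. w x * \<phi> x)" using i[of 0] by simp
    have "(\<integral>x. w x * second_difference h \<phi> x \<partial>lborel) =
       (\<integral>x. (\<Sum>i\<in>UNIV. w x * \<phi> (x + h *\<^sub>R axis i 1) + w x * \<phi> (x - h *\<^sub>R axis i 1) - 2 * (w x * \<phi> x)) \<partial>lborel)"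
      by (simp add: second_difference_def sum_distrib_left algebra_simps)
    also have "\<dots> = (\<Sum>i\<in>UNIV. (\<integral>x. w x * \<phi> (x + h *\<^sub>R axis i 1) \<partial>lborel) + (\<integral>x. w x * \<phi> (x - h *\<^sub>R axis i 1) \<partial>lborel) - 2 * (\<integral>x. w x * \<phi> x \<partial>lborel))"
      using i i' i0 by simp
    also have "\<dots> = (\<Sum>i\<in>UNIV. (\<integral>x. w (x - h *\<^sub>R axis i 1) * \<phi> x \<partial>lborel) + (\<integral>x. w (x + h *\<^sub>R axis i 1) * \<phi> x \<partial>lborel) - 2 * (\<integral>x. w x * \<phi> x \<partial>lborel))"
      by (simp add: int\<phi>(2) j(2))
    also have "\<dots> = (\<integral>x. (\<Sum>i\<in>UNIV. w (x - h *\<^sub>R axis i 1) * \<phi> x + w (x + h *\<^sub>R axis i 1) * \<phi> x - 2 * (w x * \<phi> x)) \<partial>lborel)"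
      using int\<phi>(1) j(1) i0 by simp
    also have "\<dots> = (\<integral>x. second_difference h w x * \<phi> x \<partial>lborel)"
      unfolding second_difference_def sum_distrib_right
      by (intro arg_cong[where f="integral\<^sup>L lborel"] ext sum.cong refl) (simp add: algebra_simps)
    finally show ?thesis .
  qed
  define h where "h n = min 1 e / real (Suc n)" for n
  have h: "0 < h n" "h n \<le> 1" "h n \<le> e" for n
  proof -
    show "0 < h n" using e by (simp add: h_def)
    have "h n \<le> min 1 e" unfolding h_def using e by (intro divide_le_eq[THEN iffD2]) auto
    then show "h n \<le> 1" "h n \<le> e" by auto
  qed
  have hlim: "h \<longlonglongrightarrow> 0"
    unfolding h_def using tendsto_mult_right_zero[OF LIMSEQ_inverse_real_of_nat, of "min 1 e"] by (simp add: divide_inverse)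
  obtain C where C: "C \<ge> 0" "\<And>x h. 0 < h \<Longrightarrow> cball x h \<subseteq> K' \<Longrightarrow> \<bar>second_difference h z x\<bar> \<le> C * h\<^sup>2"
    using second_difference_bounded[OF z K' K'\<Omega>] by auto
  have sdw: "second_difference h w x = second_difference h z x" if "x \<in> K" "0 < h" "h \<le> e" for x h
  proof -
    have "x + h *\<^sub>R axis i 1 \<in> K'" "x - h *\<^sub>R axis i 1 \<in> K'" "x \<in> K'" for i
      using that e(1) by (auto intro!: inK'[OF that(1)] simp: dist_norm)
    then show ?thesis by (simp add: second_difference_def w_def)
  qed
  have lim1: "(\<lambda>n. (\<integral>x. w x * (second_difference (h n) \<phi> x / (h n)\<^sup>2) \<partial>lborel)) \<longlonglongrightarrow> (\<integral>x. w x * laplacian \<phi> x \<partial>lborel)"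
    using K(1) by (intro integral_second_difference_tendsto \<phi> w h hlim) (simp add: K_def)
  have pt: "(\<lambda>n. second_difference (h n) w x / (h n)\<^sup>2 * \<phi> x) \<longlonglongrightarrow> L x * \<phi> x" for x
  proof (cases "x \<in> K")
    case True
    have "(\<lambda>n. second_difference (h n) z x / (h n)\<^sup>2) \<longlonglongrightarrow> L x"
      using h(1) K(2) True
      by (intro filterlim_compose[OF second_difference_tendsto[OF z _ \<open>open \<Omega>\<close>]]) (auto simp: filterlim_at hlim less_imp_neq[OF h(1), THEN not_sym])
    then show ?thesis using sdw[OF True h(1,3)] by (intro tendsto_intros) simp
  qed (simp add: \<phi>0)
  have [measurable]: "second_difference h w \<in> borel_measurable borel" for h
    unfolding second_difference_def[abs_def] by measurable
  have lim2: "(\<lambda>n. (\<integral>x. second_difference (h n) w x / (h n)\<^sup>2 * \<phi> x \<partial>lborel)) \<longlonglongrightarrow> (\<integral>x. L x * \<phi> x \<partial>lborel)"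
  proof (rule integral_dominated_convergence[where w="\<lambda>x. C * \<bar>indicator K x * \<phi> x\<bar>"])
    have "integrable lborel (\<lambda>x. indicator K x *\<^sub>R \<phi> x)"
      by (intro borel_integrable_compact K continuous_on_subset[OF c\<phi>]) auto
    then show "integrable lborel (\<lambda>x. C * \<bar>indicator K x * \<phi> x\<bar>)" by simp
    have "(\<lambda>x. L x * \<phi> x) \<in> borel_measurable borel"
      by (rule borel_measurable_LIMSEQ_real[OF pt]) measurable
    then show "(\<lambda>x. L x * \<phi> x) \<in> borel_measurable lborel" by simp
    show "(\<lambda>x. second_difference (h n) w x / (h n)\<^sup>2 * \<phi> x) \<in> borel_measurable lborel" for n by measurable
    show "AE x in lborel. (\<lambda>n. second_difference (h n) w x / (h n)\<^sup>2 * \<phi> x) \<longlonglongrightarrow> L x * \<phi> x"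
      by (intro AE_I2 pt)
    show "AE x in lborel. norm (second_difference (h n) w x / (h n)\<^sup>2 * \<phi> x) \<le> C * \<bar>indicator K x * \<phi> x\<bar>" for n
    proof (intro AE_I2)
      fix x
      show "norm (second_difference (h n) w x / (h n)\<^sup>2 * \<phi> x) \<le> C * \<bar>indicator K x * \<phi> x\<bar>"
      proof (cases "x \<in> K")
        case True
        have "cball x (h n) \<subseteq> K'" using inK'[OF True] h(3)[of n] by auto
        then have "\<bar>second_difference (h n) w x / (h n)\<^sup>2\<bar> \<le> C"
          using C(2)[OF h(1)[of n]] sdw[OF True h(1,3), of n] h(1)[of n] by (simp add: abs_divide divide_le_eq)
        then have "\<bar>second_difference (h n) w x / (h n)\<^sup>2\<bar> * \<bar>\<phi> x\<bar> \<le> C * \<bar>\<phi> x\<bar>"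
          by (intro mult_right_mono) auto
        then show ?thesis using True by (simp add: abs_mult)
      qed (simp add: \<phi>0)
    qed
  qed
  have eqn: "(\<integral>x. w x * (second_difference (h n) \<phi> x / (h n)\<^sup>2) \<partial>lborel) = (\<integral>x. second_difference (h n) w x / (h n)\<^sup>2 * \<phi> x \<partial>lborel)" for n
  proof -
    have "(\<integral>x. w x * (second_difference (h n) \<phi> x / (h n)\<^sup>2) \<partial>lborel) = (\<integral>x. w x * second_difference (h n) \<phi> x \<partial>lborel) / (h n)\<^sup>2"
      by simp
    also have "\<dots> = (\<integral>x. second_difference (h n) w x * \<phi> x \<partial>lborel) / (h n)\<^sup>2" by (simp only: swap)
    also have "\<dots> = (\<integral>x. second_difference (h n) w x / (h n)\<^sup>2 * \<phi> x \<partial>lborel)" by simp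
    finally show ?thesis .
  qed
  have eq: "(\<integral>x. w x * laplacian \<phi> x \<partial>lborel) = (\<integral>x. L x * \<phi> x \<partial>lborel)"
    by (rule LIMSEQ_unique[OF lim1[unfolded eqn] lim2])
  have "(\<lambda>x. indicator \<Omega> x *\<^sub>R (z x * laplacian \<phi> x)) = (\<lambda>x. w x * laplacian \<phi> x)"
  proof
    show "indicator \<Omega> x *\<^sub>R (z x * laplacian \<phi> x) = w x * laplacian \<phi> x" for x
    proof (cases "x \<in> K")
      case True
      then have "x \<in> K'" "x \<in> \<Omega>" using KK' K'\<Omega> by auto
      then show ?thesis by (simp add: w_def)
    next
      case False
      then show ?thesis using laplacian_zero_outside[of x \<phi>] by (simp add: K_def)
    qed
  qed
  moreover have "(\<lambda>x. indicator \<Omega> x *\<^sub>R (L x * \<phi> x)) = (\<lambda>x. L x * \<phi> x)"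
  proof
    show "indicator \<Omega> x *\<^sub>R (L x * \<phi> x) = L x * \<phi> x" for x
      using \<phi>0[of x] K(2) by (cases "x \<in> K") auto
  qed
  ultimately show "(LINT x:\<Omega>|lborel. z x * laplacian \<phi> x) = (LINT x:\<Omega>|lborel. L x * \<phi> x)"
    unfolding set_lebesgue_integral_def using eq by simp
qed

section \<open>Bump functions and the touching principle\<close>

text \<open>Differentiating exp(-1/t) only produces further powers of 1/t, so the index m makes the
  family closed under derivatives up to linear combinations.\<close>

definition flat :: "nat \<Rightarrow> real \<Rightarrow> real" where
  "flat m t = (if t > 0 then exp (- 1 / t) / t ^ m else 0)"

lemma flat_tendsto_0: "(flat m \<longlongrightarrow> 0) (at_right 0)"
proof -
  have "((\<lambda>x::real. x ^ m / exp x) \<longlongrightarrow> 0) at_top" by (rule tendsto_power_div_exp_0)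
  then have "((\<lambda>t::real. inverse t ^ m / exp (inverse t)) \<longlongrightarrow> 0) (at_right 0)"
    by (rule filterlim_compose) (rule filterlim_inverse_at_top_right)
  moreover have "eventually (\<lambda>t::real. inverse t ^ m / exp (inverse t) = flat m t) (at_right 0)"
    using eventually_at_right_less[of "0::real"]
    by eventually_elim (auto simp: flat_def exp_minus field_simps)
  ultimately show ?thesis by (rule Lim_transform_eventually)
qed

lemma flat_has_derivative:
  "(flat m has_real_derivative flat (m + 2) t - real m * flat (m + 1) t) (at t)"
proof -
  consider "t > 0" | "t < 0" | "t = 0" by linarith
  then show ?thesis
  proof cases
    case 1
    have "((\<lambda>t. exp (- 1 / t) / t ^ m) has_real_derivative
        (exp (- 1 / t) * (1 / t\<^sup>2) * t ^ m - exp (- 1 / t) * (real m * t ^ (m - 1))) / (t ^ m * t ^ m)) (at t)"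
      using 1 by (auto intro!: derivative_eq_intros simp: power2_eq_square)
    also have "(exp (- 1 / t) * (1 / t\<^sup>2) * t ^ m - exp (- 1 / t) * (real m * t ^ (m - 1))) / (t ^ m * t ^ m)
        = flat (m + 2) t - real m * flat (m + 1) t"
      using 1 by (cases m) (simp_all add: flat_def field_simps power2_eq_square)
    finally show ?thesis
      by (rule has_field_derivative_transform_within_open[where S="{0<..}"]) (use 1 in \<open>auto simp: flat_def\<close>)
  next
    case 2
    have "((\<lambda>t. 0) has_real_derivative flat (m + 2) t - real m * flat (m + 1) t) (at t)"
      using 2 by (simp add: flat_def)
    then show ?thesis
      by (rule has_field_derivative_transform_within_open[where S="{..<0}"]) (use 2 in \<open>auto simp: flat_def\<close>)
  next
    case 3
    \<comment> \<open>To the right of 0 the difference quotient of \<open>flat m\<close> is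
      \<open>flat (Suc m)\<close>, which tends to 0.\<close>
    have r: "((\<lambda>h. (flat m h - flat m 0) / h) \<longlongrightarrow> 0) (at_right 0)"
    proof (rule Lim_transform_eventually[OF flat_tendsto_0[of "Suc m"]])
      show "eventually (\<lambda>h. flat (Suc m) h = (flat m h - flat m 0) / h) (at_right 0)"
        using eventually_at_right_less[of "0::real"] by eventually_elim (auto simp: flat_def)
    qed
    have l: "((\<lambda>h. (flat m h - flat m 0) / h) \<longlongrightarrow> 0) (at_left 0)"
    proof (rule Lim_transform_eventually[OF tendsto_const])
      have "eventually (\<lambda>h. h < 0) (at_left (0::real))" by (auto simp: eventually_at_filter)
      then show "eventually (\<lambda>h. 0 = (flat m h - flat m 0) / h) (at_left 0)"
        by eventually_elim (auto simp: flat_def)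
    qed
    from filterlim_split_at[OF l r] show ?thesis using 3 by (simp add: DERIV_def flat_def)
  qed
qed

text \<open>\<open>smooth_fun\<close> quantifies over all iterated partial derivatives, so induction
  needs a class that contains the bump and is closed under partial differentiation; the chain rule
  brings in coordinate factors, the product rule sums.\<close>

inductive flat_polynomial :: "real ^ 'n::finite \<Rightarrow> real \<Rightarrow> (real ^ 'n \<Rightarrow> real) \<Rightarrow> bool" for c d where
  flat: "flat_polynomial c d (\<lambda>x. flat m (d - (x - c) \<bullet> (x - c)))"
| coord: "flat_polynomial c d \<phi> \<Longrightarrow> flat_polynomial c d (\<lambda>x. (x - c) $ i * \<phi> x)"
| scale: "flat_polynomial c d \<phi> \<Longrightarrow> flat_polynomial c d (\<lambda>x. k * \<phi> x)"
| add: "flat_polynomial c d \<phi> \<Longrightarrow> flat_polynomial c d \<psi> \<Longrightarrow> flat_polynomial c d (\<lambda>x. \<phi> x + \<psi> x)"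

lemma flat_polynomial_differentiable: "flat_polynomial c d \<phi> \<Longrightarrow> \<phi> differentiable (at x)"
proof (induction rule: flat_polynomial.induct)
  case (flat m)
  have "(\<lambda>x. d - (x - c) \<bullet> (x - c)) differentiable (at x)"
    by (rule differentiableI) (auto intro!: derivative_eq_intros)
  moreover have "flat m differentiable (at (d - (x - c) \<bullet> (x - c)))"
    unfolding real_differentiable_def by (rule exI, rule flat_has_derivative)
  ultimately show ?case by (rule differentiable_compose[of "flat m", rotated])
next
  case (coord \<phi> i)
  have "(\<lambda>x. (x - c) $ i) differentiable (at x)"
    by (rule differentiableI[OF bounded_linear.has_derivative[OF bounded_linear_vec_nth has_derivative_diff[OF has_derivative_ident has_derivative_const]]])
  then show ?case using coord.IH by (rule differentiable_mult)
next
  case (scale \<phi> k)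
  show ?case by (rule differentiable_mult[OF differentiable_const scale.IH])
next
  case (add \<phi> \<psi>)
  show ?case by (rule differentiable_add[OF add.IH])
qed

lemma inner_shift_axis:
  fixes x c :: "real ^ 'n::finite"
  shows "(x + t *\<^sub>R axis i 1 - c) \<bullet> (x + t *\<^sub>R axis i 1 - c) = (x - c) \<bullet> (x - c) + 2 * t * (x - c) $ i + t\<^sup>2"
proof -
  define v where "v = x - c"
  define w where "w = t *\<^sub>R (axis i 1 :: real ^ 'n)"
  have 1: "x + w - c = v + w" by (simp add: v_def)
  have 2: "(v + w) \<bullet> (v + w) = v \<bullet> v + 2 * (v \<bullet> w) + w \<bullet> w"
    by (simp add: inner_add_left inner_add_right inner_commute[of w v])
  have 3: "v \<bullet> w = t * v $ i" by (simp add: w_def inner_axis)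
  have 4: "w \<bullet> w = t\<^sup>2" by (simp add: w_def inner_axis_axis power2_eq_square)
  show ?thesis unfolding v_def[symmetric] w_def[symmetric] 1 2 3 4 by simp
qed

lemma flat_polynomial_partial_deriv_aux:
  "flat_polynomial c d \<phi> \<Longrightarrow>
     \<exists>\<psi>. flat_polynomial c d \<psi> \<and> (\<forall>x. has_axis_derivative j \<phi> x (\<psi> x))"
proof (induction rule: flat_polynomial.induct)
  case (flat m)
  let ?E = "\<lambda>m x. flat m (d - (x - c) \<bullet> (x - c))"
  let ?\<psi> = "\<lambda>x. (-2) * ((x - c) $ j * ?E (m + 2) x) + (2 * real m) * ((x - c) $ j * ?E (m + 1) x)"
  have "flat_polynomial c d ?\<psi>"
    by (intro flat_polynomial.intros)
  moreover have "((\<lambda>t. ?E m (x + t *\<^sub>R axis j 1)) has_real_derivative ?\<psi> x) (at 0)" for x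
  proof -
    have 1: "((\<lambda>t. d - ((x - c) \<bullet> (x - c) + 2 * t * (x - c) $ j + t\<^sup>2)) has_real_derivative - 2 * (x - c) $ j) (at 0)"
      by (auto intro!: derivative_eq_intros)
    have 2: "(flat m has_real_derivative flat (m + 2) (d - (x - c) \<bullet> (x - c)) - real m * flat (m + 1) (d - (x - c) \<bullet> (x - c)))
        (at (d - ((x - c) \<bullet> (x - c) + 2 * 0 * (x - c) $ j + 0\<^sup>2)))"
      using flat_has_derivative by simp
    from DERIV_chain2[OF 2 1] show ?thesis unfolding inner_shift_axis
      by (rule DERIV_cong) (simp add: algebra_simps)
  qed
  ultimately show ?case by blast
next
  case (coord \<phi> i)
  then obtain \<psi> where \<psi>: "flat_polynomial c d \<psi>" "\<And>x. has_axis_derivative j \<phi> x (\<psi> x)"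
    by blast
  let ?\<eta> = "\<lambda>x. axis j 1 $ i * \<phi> x + (x - c) $ i * \<psi> x"
  have "flat_polynomial c d ?\<eta>" by (intro flat_polynomial.intros coord \<psi>)
  moreover have "((\<lambda>t. (x + t *\<^sub>R axis j 1 - c) $ i * \<phi> (x + t *\<^sub>R axis j 1)) has_real_derivative ?\<eta> x) (at 0)" for x
  proof -
    have "((\<lambda>t. (x + t *\<^sub>R axis j 1 - c) $ i) has_real_derivative axis j 1 $ i) (at 0)"
      by (auto intro!: derivative_eq_intros)
    from DERIV_mult[OF this \<psi>(2)[of x]] show ?thesis by (simp add: mult.commute add.commute)
  qed
  ultimately show ?case by blast
next
  case (scale \<phi> k)
  then obtain \<psi> where \<psi>: "flat_polynomial c d \<psi>" "\<And>x. has_axis_derivative j \<phi> x (\<psi> x)"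
    by blast
  show ?case
    by (intro exI[of _ "\<lambda>x. k * \<psi> x"] conjI allI flat_polynomial.scale \<psi> DERIV_cmult)
next
  case (add \<phi> \<eta>)
  then obtain \<psi> \<psi>' where \<psi>: "flat_polynomial c d \<psi>" "\<And>x. has_axis_derivative j \<phi> x (\<psi> x)"
    "flat_polynomial c d \<psi>'" "\<And>x. has_axis_derivative j \<eta> x (\<psi>' x)"
    by blast
  show ?case
    by (intro exI[of _ "\<lambda>x. \<psi> x + \<psi>' x"] conjI allI flat_polynomial.add \<psi> DERIV_add)
qed

lemma flat_polynomial_smooth:
  assumes "flat_polynomial c d \<phi>"
  shows "smooth_fun \<phi>"
proof -
  have step: "flat_polynomial c d (partial_deriv j \<phi>)" if pm: "flat_polynomial c d \<phi>" for j \<phi>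
  proof -
    obtain \<psi> where \<psi>: "flat_polynomial c d \<psi>" "\<And>x. has_axis_derivative j \<phi> x (\<psi> x)"
      using flat_polynomial_partial_deriv_aux[OF pm] by blast
    have "partial_deriv j \<phi> = \<psi>"
      unfolding partial_deriv_def using DERIV_imp_deriv[OF \<psi>(2)] by (intro ext)
    then show ?thesis using \<psi>(1) by simp
  qed
  have "flat_polynomial c d (foldr partial_deriv js \<phi>)" for js
    by (induction js) (auto intro: assms step)
  from differentiable_at_withinI[OF flat_polynomial_differentiable[OF this]] show ?thesis
    unfolding smooth_fun_def differentiable_on_def by blast
qed

definition bump :: "real \<Rightarrow> real ^ 'n::finite \<Rightarrow> real ^ 'n \<Rightarrow> real" where
  "bump \<delta> c x = flat 0 (\<delta>\<^sup>2 - (x - c) \<bullet> (x - c))"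

lemma bump_smooth: "smooth_fun (bump \<delta> c)"
  unfolding bump_def[abs_def] by (rule flat_polynomial_smooth[OF flat_polynomial.flat])

lemma bump_nonneg: "0 \<le> bump \<delta> c x" and bump_le_1: "bump \<delta> c x \<le> 1"
  by (auto simp: bump_def flat_def)

lemma bump_pos_iff: "\<delta> > 0 \<Longrightarrow> bump \<delta> c x \<noteq> 0 \<longleftrightarrow> dist c x < \<delta>"
proof -
  assume "\<delta> > 0"
  then have "dist c x < \<delta> \<longleftrightarrow> (norm (x - c))\<^sup>2 < \<delta>\<^sup>2"
    using power_strict_mono[of "norm (x - c)" \<delta> 2] power2_less_imp_less[of "norm (x - c)" \<delta>]
    by (auto simp: dist_norm norm_minus_commute)
  then show ?thesis by (auto simp: bump_def flat_def power2_norm_eq_inner)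
qed

lemma bump_support: "\<delta> > 0 \<Longrightarrow> closure {x. bump \<delta> c x \<noteq> 0} \<subseteq> cball c \<delta>"
  by (intro closure_minimal) (auto simp: bump_pos_iff)

lemma bump_compact_support: "\<delta> > 0 \<Longrightarrow> compact (closure {x. bump \<delta> c x \<noteq> 0})"
  using bump_support[of \<delta> c] by (auto simp: compact_eq_bounded_closed intro: bounded_subset[OF bounded_cball])

lemma bump_test_function: "\<delta> > 0 \<Longrightarrow> cball c \<delta> \<subseteq> \<Omega> \<Longrightarrow> test_function \<Omega> (bump \<delta> c)"
  unfolding test_function_def
  by (intro conjI bump_smooth bump_compact_support order_trans[OF bump_support])

lemma bump_translate: "bump \<delta> (c + v) x = bump \<delta> c (x - v)"
  by (simp add: bump_def algebra_simps)

lemma continuous_on_bump: "continuous_on X (bump \<delta> c)"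
  using smooth_fun_partial_derivs(2)[OF bump_smooth, of X "[]"] by simp

lemma bump_measurable [measurable]: "bump \<delta> c \<in> borel_measurable borel"
  by (intro borel_measurable_continuous_onI continuous_on_bump)

lemma bump_integral:
  fixes c :: "real ^ 'n::finite"
  assumes "\<delta> > 0"
  shows "integrable lborel (bump \<delta> c)" "(\<integral>x. bump \<delta> c x \<partial>lborel) = (\<integral>x. bump \<delta> (0 :: real ^ 'n) x \<partial>lborel)"
    "(\<integral>x. bump \<delta> c x \<partial>lborel) > 0"
proof -
  have eq: "(\<lambda>x. indicator (cball c \<delta>) x *\<^sub>R bump \<delta> c x) = bump \<delta> c" for c :: "real ^ 'n"
  proof
    show "indicator (cball c \<delta>) x *\<^sub>R bump \<delta> c x = bump \<delta> c x" for x
      using bump_pos_iff[OF assms, of c x] by (cases "x \<in> cball c \<delta>") auto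
  qed
  have int: "integrable lborel (bump \<delta> c)" for c :: "real ^ 'n"
    using borel_integrable_compact[OF compact_cball continuous_on_bump, of c \<delta> \<delta> c] eq by simp
  show "integrable lborel (bump \<delta> c)" by (rule int)
  show "(\<integral>x. bump \<delta> c x \<partial>lborel) = (\<integral>x. bump \<delta> (0 :: real ^ 'n) x \<partial>lborel)"
    using integral_lborel_translate[of "bump \<delta> c" c] by (simp add: bump_def)
  \<comment> \<open>The value at distance \<delta> / 2 from the centre, hence a positive lower bound
    on the smaller ball.\<close>
  define b where "b = flat 0 (\<delta>\<^sup>2 - (\<delta> / 2)\<^sup>2)"
  have b: "b > 0" using assms by (simp add: b_def flat_def power_divide)
  have le: "b * indicator (ball c (\<delta> / 2)) x \<le> bump \<delta> c x" for x
  proof (cases "x \<in> ball c (\<delta> / 2)")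
    case True
    then have "(norm (x - c))\<^sup>2 \<le> (\<delta> / 2)\<^sup>2"
      by (intro power_mono) (auto simp: dist_norm norm_minus_commute)
    then have 1: "0 < \<delta>\<^sup>2 - (\<delta> / 2)\<^sup>2" "\<delta>\<^sup>2 - (\<delta> / 2)\<^sup>2 \<le> \<delta>\<^sup>2 - (x - c) \<bullet> (x - c)"
      using assms by (auto simp: power2_norm_eq_inner power_divide)
    have "exp (- 1 / s) \<le> exp (- 1 / t)" if "0 < s" "s \<le> t" for s t :: real
      using that by (simp add: frac_le)
    from this[OF 1] have "b \<le> bump \<delta> c x" using 1 by (simp add: b_def bump_def flat_def)
    then show ?thesis using True by simp
  qed (simp add: bump_nonneg)
  have "integrable lborel (\<lambda>x. b * indicator (ball c (\<delta> / 2)) x)"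
    using emeasure_bounded_finite[of "ball c (\<delta> / 2)"]
    by (intro integrable_mult_right integrable_real_indicator) auto
  then have "(\<integral>x. b * indicator (ball c (\<delta> / 2)) x \<partial>lborel) \<le> (\<integral>x. bump \<delta> c x \<partial>lborel)"
    by (intro integral_mono int le)
  moreover have "(\<integral>x. b * indicator (ball c (\<delta> / 2)) x \<partial>lborel) = b * measure lborel (ball c (\<delta> / 2))"
    by simp
  moreover have "b * measure lborel (ball c (\<delta> / 2)) > 0"
    using assms by (intro mult_pos_pos b content_ball_pos) auto
  ultimately show "(\<integral>x. bump \<delta> c x \<partial>lborel) > 0" by linarith
qed

section \<open>Calculus of functions with a Laplacian, and the touching principle\<close>

lemma has_laplacianE:
  assumes "has_laplacian \<Omega> z L"
  obtains d1 d2 where "continuous_on \<Omega> z"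
    "\<And>i x. x \<in> \<Omega> \<Longrightarrow> has_axis_derivative i z x (d1 i x)"
    "\<And>i x. x \<in> \<Omega> \<Longrightarrow> has_axis_derivative i (d1 i) x (d2 i x)"
    "\<And>i. continuous_on \<Omega> (d2 i)" "\<And>x. x \<in> \<Omega> \<Longrightarrow> L x = (\<Sum>i\<in>UNIV. d2 i x)"
  using assms unfolding has_laplacian_def by blast

lemma has_laplacian_add:
  assumes "has_laplacian \<Omega> z L" "has_laplacian \<Omega> w M"
  shows "has_laplacian \<Omega> (\<lambda>x. z x + w x) (\<lambda>x. L x + M x)"
proof -
  obtain d1 d2 where d: "continuous_on \<Omega> z"
    "\<And>i x. x \<in> \<Omega> \<Longrightarrow> has_axis_derivative i z x (d1 i x)"
    "\<And>i x. x \<in> \<Omega> \<Longrightarrow> has_axis_derivative i (d1 i) x (d2 i x)"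
    "\<And>i. continuous_on \<Omega> (d2 i)" "\<And>x. x \<in> \<Omega> \<Longrightarrow> L x = (\<Sum>i\<in>UNIV. d2 i x)"
    by (rule has_laplacianE[OF assms(1)]) (rule that)
  obtain e1 e2 where e: "continuous_on \<Omega> w"
    "\<And>i x. x \<in> \<Omega> \<Longrightarrow> has_axis_derivative i w x (e1 i x)"
    "\<And>i x. x \<in> \<Omega> \<Longrightarrow> has_axis_derivative i (e1 i) x (e2 i x)"
    "\<And>i. continuous_on \<Omega> (e2 i)" "\<And>x. x \<in> \<Omega> \<Longrightarrow> M x = (\<Sum>i\<in>UNIV. e2 i x)"
    by (rule has_laplacianE[OF assms(2)]) (rule that)
  show ?thesis
  proof (rule has_laplacianI)
    show "continuous_on \<Omega> (\<lambda>x. z x + w x)" by (rule continuous_on_add[OF d(1) e(1)])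
    show "((\<lambda>t. z (x + t *\<^sub>R axis i 1) + w (x + t *\<^sub>R axis i 1)) has_real_derivative d1 i x + e1 i x) (at 0)"
      if "x \<in> \<Omega>" for i x by (rule DERIV_add[OF d(2)[OF that] e(2)[OF that]])
    show "((\<lambda>t. d1 i (x + t *\<^sub>R axis i 1) + e1 i (x + t *\<^sub>R axis i 1)) has_real_derivative d2 i x + e2 i x) (at 0)"
      if "x \<in> \<Omega>" for i x by (rule DERIV_add[OF d(3)[OF that] e(3)[OF that]])
    show "continuous_on \<Omega> (\<lambda>x. d2 i x + e2 i x)" for i by (rule continuous_on_add[OF d(4) e(4)])
    show "L x + M x = (\<Sum>i\<in>UNIV. d2 i x + e2 i x)" if "x \<in> \<Omega>" for x
      by (simp add: d(5)[OF that] e(5)[OF that] sum.distrib)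
  qed
qed

lemma has_laplacian_cmult:
  assumes "has_laplacian \<Omega> z L"
  shows "has_laplacian \<Omega> (\<lambda>x. c * z x) (\<lambda>x. c * L x)"
proof -
  obtain d1 d2 where d: "continuous_on \<Omega> z"
    "\<And>i x. x \<in> \<Omega> \<Longrightarrow> has_axis_derivative i z x (d1 i x)"
    "\<And>i x. x \<in> \<Omega> \<Longrightarrow> has_axis_derivative i (d1 i) x (d2 i x)"
    "\<And>i. continuous_on \<Omega> (d2 i)" "\<And>x. x \<in> \<Omega> \<Longrightarrow> L x = (\<Sum>i\<in>UNIV. d2 i x)"
    by (rule has_laplacianE[OF assms]) (rule that)
  show ?thesis
  proof (rule has_laplacianI)
    show "continuous_on \<Omega> (\<lambda>x. c * z x)" by (rule continuous_on_mult_left[OF d(1)])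
    show "((\<lambda>t. c * z (x + t *\<^sub>R axis i 1)) has_real_derivative c * d1 i x) (at 0)"
      if "x \<in> \<Omega>" for i x by (rule DERIV_cmult[OF d(2)[OF that]])
    show "((\<lambda>t. c * d1 i (x + t *\<^sub>R axis i 1)) has_real_derivative c * d2 i x) (at 0)"
      if "x \<in> \<Omega>" for i x by (rule DERIV_cmult[OF d(3)[OF that]])
    show "continuous_on \<Omega> (\<lambda>x. c * d2 i x)" for i by (rule continuous_on_mult_left[OF d(4)])
    show "c * L x = (\<Sum>i\<in>UNIV. c * d2 i x)" if "x \<in> \<Omega>" for x
      by (simp add: d(5)[OF that] sum_distrib_left)
  qed
qed

lemma has_laplacian_subset:
  assumes "has_laplacian \<Omega> z L" "X \<subseteq> \<Omega>"
  shows "has_laplacian X z L"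
proof -
  obtain d1 d2 where d: "continuous_on \<Omega> z"
    "\<And>i x. x \<in> \<Omega> \<Longrightarrow> has_axis_derivative i z x (d1 i x)"
    "\<And>i x. x \<in> \<Omega> \<Longrightarrow> has_axis_derivative i (d1 i) x (d2 i x)"
    "\<And>i. continuous_on \<Omega> (d2 i)" "\<And>x. x \<in> \<Omega> \<Longrightarrow> L x = (\<Sum>i\<in>UNIV. d2 i x)"
    by (rule has_laplacianE[OF assms(1)]) (rule that)
  show ?thesis
    by (rule has_laplacianI[OF continuous_on_subset[OF d(1) assms(2)] d(2) d(3) continuous_on_subset[OF d(4) assms(2)] d(5)])
       (use assms(2) in auto)
qed

lemma has_laplacian_continuous:
  assumes "has_laplacian \<Omega> z L"
  shows "continuous_on \<Omega> L"
proof -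
  obtain d1 d2 where "continuous_on \<Omega> z"
    "\<And>i x. x \<in> \<Omega> \<Longrightarrow> has_axis_derivative i z x (d1 i x)"
    "\<And>i x. x \<in> \<Omega> \<Longrightarrow> has_axis_derivative i (d1 i) x (d2 i x)"
    and d: "\<And>i. continuous_on \<Omega> (d2 i)" "\<And>x. x \<in> \<Omega> \<Longrightarrow> L x = (\<Sum>i\<in>UNIV. d2 i x)"
    by (rule has_laplacianE[OF assms]) (rule that)
  have "continuous_on \<Omega> (\<lambda>x. \<Sum>i\<in>UNIV. d2 i x)" by (intro continuous_on_sum d(1))
  then show ?thesis by (rule continuous_on_eq) (simp add: d(2))
qed

lemma has_laplacian_square:
  "has_laplacian \<Omega> (\<lambda>x. (x - c) \<bullet> (x - c)) (\<lambda>_ :: real ^ 'n::finite. 2 * real CARD('n))"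
proof (rule has_laplacianI[where ?d1.0="\<lambda>i x. 2 * (x - c) $ i" and ?d2.0="\<lambda>i x. 2"])
  show "continuous_on \<Omega> (\<lambda>x. (x - c) \<bullet> (x - c))" by (intro continuous_intros)
  show "((\<lambda>t. (x + t *\<^sub>R axis i 1 - c) \<bullet> (x + t *\<^sub>R axis i 1 - c)) has_real_derivative 2 * (x - c) $ i) (at 0)" for i x
    unfolding inner_shift_axis by (auto intro!: derivative_eq_intros)
  show "((\<lambda>t. 2 * (x + t *\<^sub>R axis i 1 - c) $ i) has_real_derivative 2) (at 0)" for i and x :: "real ^ 'n"
    by (auto intro!: derivative_eq_intros)
qed auto

text \<open>A distributional solution is a viscosity solution. If \<open>g x0 > L x0\<close>, subtract a small multiple of
  \<open>|x - x0|\<^sup>2\<close> to make the maximum strict; the mollification \<open>J\<close> of the difference then has an interior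
  maximum \<open>x1\<close>, where its second differences are nonpositive, although its Laplacian is positive.\<close>

lemma distributional_laplacian_touching:
  fixes u z :: "real ^ 'n::finite \<Rightarrow> real"
  assumes u: "continuous_on \<Omega> u" and g: "continuous_on \<Omega> g"
    and dl: "distributional_laplacian \<Omega> u g"
    and X: "open X" "X \<subseteq> \<Omega>" and z: "has_laplacian X z L"
    and x0: "x0 \<in> X" and mx: "\<And>x. x \<in> X \<Longrightarrow> u x - z x \<le> u x0 - z x0"
  shows "g x0 \<le> L x0"
proof (rule ccontr)
  assume "\<not> g x0 \<le> L x0"
  define \<kappa> where "\<kappa> = g x0 - L x0"
  have \<kappa>: "\<kappa> > 0" using \<open>\<not> g x0 \<le> L x0\<close> by (simp add: \<kappa>_def)
  \<comment> \<open>The paraboloid has Laplacian 2 n \<epsilon> = \<kappa> / 2 in dimension n, which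
    leaves half of the gap \<kappa>.\<close>
  define \<epsilon> where "\<epsilon> = \<kappa> / (4 * real CARD('n))"
  have \<epsilon>: "\<epsilon> > 0" using \<kappa> by (simp add: \<epsilon>_def)
  define z' where "z' x = z x + \<epsilon> * ((x - x0) \<bullet> (x - x0))" for x
  define L' where "L' x = L x + \<epsilon> * (2 * real CARD('n))" for x
  have L'_eq: "L' x = L x + \<kappa> / 2" for x by (simp add: L'_def \<epsilon>_def)
  have z': "has_laplacian X z' L'"
    unfolding z'_def[abs_def] L'_def[abs_def]
    by (intro has_laplacian_add z has_laplacian_cmult has_laplacian_square)
  define w where "w x = u x - z' x" for x
  have w_le: "w x \<le> w x0 - \<epsilon> * (dist x x0)\<^sup>2" if "x \<in> X" for x
    using mx[OF that] by (simp add: w_def z'_def dist_norm power2_norm_eq_inner)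
  have cont_z': "continuous_on X z'" using z' unfolding has_laplacian_def by (rule conjunct1)
  have cont_w: "continuous_on X w"
    unfolding w_def by (rule continuous_on_diff[OF continuous_on_subset[OF u X(2)] cont_z'])
  have cont_gL: "continuous_on X (\<lambda>x. g x - L' x)"
    by (rule continuous_on_diff[OF continuous_on_subset[OF g X(2)] has_laplacian_continuous[OF z']])
  have "isCont (\<lambda>x. g x - L' x) x0" using cont_gL X x0 by (simp add: continuous_on_eq_continuous_at)
  then have "((\<lambda>x. g x - L' x) \<longlongrightarrow> g x0 - L' x0) (nhds x0)"
    unfolding isCont_def by (rule tendsto_at_iff_tendsto_nhds[THEN iffD1])
  moreover have "\<kappa> / 4 < g x0 - L' x0" using \<kappa> by (simp add: L'_eq) (simp add: \<kappa>_def)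
  ultimately have "eventually (\<lambda>x. \<kappa> / 4 < g x - L' x) (nhds x0)"
    by (rule order_tendstoD(1))
  moreover have "eventually (\<lambda>x. x \<in> X) (nhds x0)" using x0 X by (auto simp: eventually_nhds)
  ultimately have "eventually (\<lambda>x. x \<in> X \<and> \<kappa> / 4 < g x - L' x) (nhds x0)" by eventually_elim auto
  then obtain r where r: "r > 0" "\<And>x. dist x x0 < r \<Longrightarrow> x \<in> X \<and> \<kappa> / 4 < g x - L' x"
    unfolding eventually_nhds_metric by blast
  define \<rho> where "\<rho> = r / 2"
  have \<rho>: "\<rho> > 0" using r by (simp add: \<rho>_def)
  define B where "B = cball x0 \<rho>"
  have B: "x \<in> X" "\<kappa> / 4 < g x - L' x" if "x \<in> B" for x
    using r(2)[of x] that r(1) by (auto simp: B_def \<rho>_def dist_commute)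
  have BX: "B \<subseteq> X" using B by auto
  \<comment> \<open>A level between two bounds: w > A near x0, while within \<delta> \<le> \<rho> /
    4 of the sphere of radius \<rho> / 2 the distance to x0 is at least \<rho> / 4, so that w \<le>
    w x0 - \<epsilon> \<rho>^2 / 16 < A.\<close>
  define A where "A = w x0 - \<epsilon> * \<rho>\<^sup>2 / 32"
  have "isCont w x0" using cont_w X x0 by (simp add: continuous_on_eq_continuous_at)
  then have "(w \<longlongrightarrow> w x0) (nhds x0)"
    unfolding isCont_def by (rule tendsto_at_iff_tendsto_nhds[THEN iffD1])
  moreover have "A < w x0" using \<epsilon> \<rho> by (simp add: A_def)
  ultimately have "eventually (\<lambda>x. A < w x) (nhds x0)"
    by (rule order_tendstoD(1))
  then obtain d where d: "d > 0" "\<And>x. dist x x0 < d \<Longrightarrow> A < w x"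
    unfolding eventually_nhds_metric by blast
  define \<delta> where "\<delta> = min (\<rho> / 4) d"
  have \<delta>: "\<delta> > 0" "\<delta> \<le> \<rho> / 4" "\<delta> \<le> d" using d \<rho> by (auto simp: \<delta>_def)
  \<comment> \<open>The cut-off makes the mollification J finite at every centre. The bump is not
    normalised, so values of J compare with m times values of w.\<close>
  define W where "W x = indicator B x * w x" for x
  have "integrable lborel (\<lambda>x. indicator B x *\<^sub>R w x)"
    by (intro borel_integrable_compact continuous_on_subset[OF cont_w BX]) (auto simp: B_def)
  then have intW: "integrable lborel W" by (simp add: W_def[abs_def])
  have [measurable]: "W \<in> borel_measurable borel" using borel_measurable_integrable[OF intW] by simp
  define J where "J x = (\<integral>y. W y * bump \<delta> x y \<partial>lborel)" for x
  define m where "m = (\<integral>x. bump \<delta> (0 :: real ^ 'n) x \<partial>lborel)"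
  have m: "(\<integral>x. bump \<delta> c x \<partial>lborel) = m" "integrable lborel (bump \<delta> c)" "m > 0" for c :: "real ^ 'n"
    using bump_integral[OF \<delta>(1)] by (auto simp: m_def)
  have intWb: "integrable lborel (\<lambda>y. W y * bump \<delta> x y)" for x
  proof (rule Bochner_Integration.integrable_bound[OF intW])
    show "AE y in lborel. norm (W y * bump \<delta> x y) \<le> norm (W y)"
      using bump_nonneg[of \<delta> x] bump_le_1[of \<delta> x] by (intro AE_I2) (auto simp: abs_mult mult_left_le)
  qed measurable
  have contJ: "continuous_on (cball x0 (\<rho> / 2)) J"
  proof (intro continuous_at_imp_continuous_on ballI)
    fix x
    show "isCont J x" unfolding continuous_at_sequentially
    proof (intro allI impI)
      fix s assume s: "s \<longlonglongrightarrow> x"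
      show "(J \<circ> s) \<longlonglongrightarrow> J x" unfolding J_def o_def
      proof (rule integral_dominated_convergence[where w="\<lambda>y. \<bar>W y\<bar>"])
        show "integrable lborel (\<lambda>y. \<bar>W y\<bar>)" using intW by simp
        show "AE y in lborel. (\<lambda>n. W y * bump \<delta> (s n) y) \<longlonglongrightarrow> W y * bump \<delta> x y"
        proof (intro AE_I2 tendsto_intros)
          fix y
          have "isCont (bump \<delta> 0) (y - x)"
            using continuous_on_bump[of UNIV \<delta> "0 :: real ^ 'n"] by (simp add: continuous_on_eq_continuous_at)
          moreover have "(\<lambda>n. y - s n) \<longlonglongrightarrow> y - x" by (intro tendsto_intros s)
          ultimately have "(\<lambda>n. bump \<delta> 0 (y - s n)) \<longlonglongrightarrow> bump \<delta> 0 (y - x)"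
            by (rule isCont_tendsto_compose)
          then show "(\<lambda>n. bump \<delta> (s n) y) \<longlonglongrightarrow> bump \<delta> x y" by (simp add: bump_def)
        qed
        show "AE y in lborel. norm (W y * bump \<delta> (s n) y) \<le> \<bar>W y\<bar>" for n
          using bump_nonneg[of \<delta> "s n"] bump_le_1[of \<delta> "s n"] by (intro AE_I2) (auto simp: abs_mult mult_left_le)
      qed measurable
    qed
  qed
  have J0: "m * A \<le> J x0"
  proof -
    have "(\<integral>y. A * bump \<delta> x0 y \<partial>lborel) \<le> J x0" unfolding J_def
    proof (intro integral_mono intWb integrable_mult_right m(2))
      fix y
      show "A * bump \<delta> x0 y \<le> W y * bump \<delta> x0 y"
      proof (cases "dist x0 y < \<delta>")
        case True
        then have "y \<in> B" "A < w y" using d(2)[of y] \<delta> \<rho> by (auto simp: B_def dist_commute)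
        then show ?thesis using bump_nonneg[of \<delta> x0 y] by (simp add: W_def mult_right_mono)
      qed (use bump_pos_iff[OF \<delta>(1), of x0 y] in auto)
    qed
    then show ?thesis using m by (simp add: mult.commute)
  qed
  have Jb: "J x < m * A" if x: "dist x0 x = \<rho> / 2" for x
  proof -
    have "J x \<le> (\<integral>y. (w x0 - \<epsilon> * \<rho>\<^sup>2 / 16) * bump \<delta> x y \<partial>lborel)" unfolding J_def
    proof (intro integral_mono intWb integrable_mult_right m(2))
      fix y
      show "W y * bump \<delta> x y \<le> (w x0 - \<epsilon> * \<rho>\<^sup>2 / 16) * bump \<delta> x y"
      proof (cases "dist x y < \<delta>")
        case True
        have "dist x0 y \<le> \<rho>" using dist_triangle[of x0 y x] True x \<delta> \<rho> by linarith
        then have yB: "y \<in> B" by (simp add: B_def)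
        have "\<rho> / 4 \<le> dist y x0" using dist_triangle[of x0 x y] True x \<delta> \<rho> dist_commute[of x y] dist_commute[of x0 y] by linarith
        then have "(\<rho> / 4)\<^sup>2 \<le> (dist y x0)\<^sup>2" using \<rho> by (intro power_mono) auto
        then have "\<epsilon> * (\<rho> / 4)\<^sup>2 \<le> \<epsilon> * (dist y x0)\<^sup>2" using \<epsilon> by (intro mult_left_mono) auto
        then have "w y \<le> w x0 - \<epsilon> * \<rho>\<^sup>2 / 16"
          using w_le[OF B(1)[OF yB]] by (simp add: power_divide)
        then show ?thesis using bump_nonneg[of \<delta> x y] yB by (simp add: W_def mult_right_mono)
      qed (use bump_pos_iff[OF \<delta>(1), of x y] in auto)
    qed
    also have "\<dots> = m * (w x0 - \<epsilon> * \<rho>\<^sup>2 / 16)" using m by (simp add: mult.commute)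
    also have "\<dots> < m * A" using m(3) \<epsilon> \<rho> by (intro mult_strict_left_mono) (auto simp: A_def)
    finally show ?thesis .
  qed
  obtain x1 where x1: "x1 \<in> cball x0 (\<rho> / 2)" "\<And>x. x \<in> cball x0 (\<rho> / 2) \<Longrightarrow> J x \<le> J x1"
    using continuous_attains_sup[OF compact_cball _ contJ] \<rho> by auto
  have x1_int: "dist x0 x1 < \<rho> / 2"
  proof -
    have "J x0 \<le> J x1" using \<rho> by (intro x1(2)) auto
    then have "dist x0 x1 \<noteq> \<rho> / 2" using Jb[of x1] J0 by auto
    then show ?thesis using x1(1) by simp
  qed
  define q where "q = min 1 (\<rho> / 2 - dist x0 x1)"
  have q: "0 < q" "q \<le> 1" "q \<le> \<rho> / 2 - dist x0 x1" using x1_int by (auto simp: q_def)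
  define h where "h n = q * inverse (real (Suc n))" for n
  have h: "0 < h n" "h n \<le> 1" "h n \<le> \<rho> / 2 - dist x0 x1" for n
  proof -
    show "0 < h n" using q(1) by (simp add: h_def)
    have "h n \<le> q * 1" unfolding h_def using q(1) by (intro mult_left_mono) (auto simp: inverse_le_1_iff)
    then show "h n \<le> 1" "h n \<le> \<rho> / 2 - dist x0 x1" using q by auto
  qed
  have hlim: "h \<longlonglongrightarrow> 0"
    unfolding h_def by (rule tendsto_mult_right_zero[OF LIMSEQ_inverse_real_of_nat])
  have J_shift: "J (x1 + v) = (\<integral>y. W y * bump \<delta> x1 (y - v) \<partial>lborel)" "integrable lborel (\<lambda>y. W y * bump \<delta> x1 (y - v))" for v
    using intWb[of "x1 + v"] by (simp_all add: J_def bump_translate)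
  \<comment> \<open>Shifting the bump's centre is the opposite shift of its argument, so integrating
    W against the second difference of the bump gives the second difference of J at its maximum
    x1.\<close>
  have sd_neg: "(\<integral>y. W y * (second_difference (h n) (bump \<delta> x1) y / (h n)\<^sup>2) \<partial>lborel) \<le> 0" for n
  proof -
    have J_le: "J (x1 + v) \<le> J x1" if "norm v \<le> h n" for v
    proof (rule x1(2))
      show "x1 + v \<in> cball x0 (\<rho> / 2)"
        using dist_triangle[of x0 "x1 + v" x1] that h(3)[of n] by (simp add: dist_norm)
    qed
    let ?e = "\<lambda>i. h n *\<^sub>R axis i (1::real) :: real ^ 'n"
    have i1: "integrable lborel (\<lambda>y. W y * bump \<delta> x1 (y + ?e i))" "J (x1 - ?e i) = (\<integral>y. W y * bump \<delta> x1 (y + ?e i) \<partial>lborel)" for i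
      using J_shift[of "- ?e i"] by auto
    have "(\<integral>y. W y * second_difference (h n) (bump \<delta> x1) y \<partial>lborel)
      = (\<integral>y. (\<Sum>i\<in>UNIV. W y * bump \<delta> x1 (y + ?e i) + W y * bump \<delta> x1 (y - ?e i) - 2 * (W y * bump \<delta> x1 y)) \<partial>lborel)"
      unfolding second_difference_def sum_distrib_left
      by (intro arg_cong[where f="integral\<^sup>L lborel"] ext sum.cong refl) (simp add: algebra_simps)
    also have "\<dots> = (\<Sum>i\<in>UNIV. J (x1 - ?e i) + J (x1 + ?e i) - 2 * J x1)"
      using i1 J_shift(2) J_shift(1) intWb[of x1] by (simp add: J_def[of x1])
    also have "\<dots> \<le> (\<Sum>i\<in>(UNIV :: 'n set). 0)"
    proof (rule sum_mono)
      fix i :: 'n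
      show "J (x1 - ?e i) + J (x1 + ?e i) - 2 * J x1 \<le> 0"
        using J_le[of "?e i"] J_le[of "- ?e i"] h(1)[of n] by simp
    qed
    finally have "(\<integral>y. W y * second_difference (h n) (bump \<delta> x1) y \<partial>lborel) / (h n)\<^sup>2 \<le> 0"
      by (simp add: divide_nonpos_nonneg)
    then show ?thesis by simp
  qed
  have le0: "(\<integral>y. W y * laplacian (bump \<delta> x1) y \<partial>lborel) \<le> 0"
    by (rule LIMSEQ_le_const2[OF integral_second_difference_tendsto[OF bump_smooth bump_compact_support[OF \<delta>(1)] intW h(1,2) hlim]])
       (use sd_neg in auto)
  have sub: "cball x1 \<delta> \<subseteq> B"
  proof
    fix y assume "y \<in> cball x1 \<delta>"
    then show "y \<in> B" using dist_triangle[of x0 y x1] x1_int \<delta> \<rho> by (simp add: B_def)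
  qed
  have b0: "bump \<delta> x1 y = 0" if "y \<notin> B" for y
  proof -
    have "\<not> dist x1 y < \<delta>" using that sub by (auto simp: subset_iff)
    then show ?thesis using bump_pos_iff[OF \<delta>(1), of x1 y] by simp
  qed
  have l0: "laplacian (bump \<delta> x1) y = 0" if "y \<notin> B" for y
    using bump_support[OF \<delta>(1), of x1] that sub by (intro laplacian_zero_outside) blast
  have cut: "(LINT x:Y|lborel. p x * q x) = (\<integral>x. (indicator B x *\<^sub>R p x) * q x \<partial>lborel)"
    if "B \<subseteq> Y" "\<And>y. y \<notin> B \<Longrightarrow> q y = 0" for p q :: "real ^ 'n \<Rightarrow> real" and Y
  proof -
    have "indicator Y x *\<^sub>R (p x * q x) = (indicator B x *\<^sub>R p x) * q x" for x
      using that by (cases "x \<in> B") auto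
    then show ?thesis by (simp only: set_lebesgue_integral_def)
  qed
  have tf: "test_function \<Omega> (bump \<delta> x1)" "test_function X (bump \<delta> x1)"
    using sub BX X(2) by (auto intro!: bump_test_function[OF \<delta>(1)])
  have eq1: "(\<integral>x. (indicator B x *\<^sub>R u x) * laplacian (bump \<delta> x1) x \<partial>lborel) = (\<integral>x. (indicator B x *\<^sub>R g x) * bump \<delta> x1 x \<partial>lborel)"
    using dl tf(1) cut[of \<Omega> "laplacian (bump \<delta> x1)" u] cut[of \<Omega> "bump \<delta> x1" g] l0 b0 BX X(2)
    by (simp add: distributional_laplacian_def)
  have eq2: "(\<integral>x. (indicator B x *\<^sub>R z' x) * laplacian (bump \<delta> x1) x \<partial>lborel) = (\<integral>x. (indicator B x *\<^sub>R L' x) * bump \<delta> x1 x \<partial>lborel)"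
    using distributional_laplacian_classical[OF z' X(1)] tf(2) cut[of X "laplacian (bump \<delta> x1)" z'] cut[of X "bump \<delta> x1" L'] l0 b0 BX
    by (simp add: distributional_laplacian_def)
  have intB: "integrable lborel (\<lambda>x. (indicator B x *\<^sub>R p x) * q x)"
    if "continuous_on X p" "continuous_on X q" for p q :: "real ^ 'n \<Rightarrow> real"
  proof -
    have "integrable lborel (\<lambda>x. indicator B x *\<^sub>R (p x * q x))"
      by (intro borel_integrable_compact continuous_intros continuous_on_subset[OF that(1) BX] continuous_on_subset[OF that(2) BX])
        (simp add: B_def)
    then show ?thesis by (simp add: mult.assoc)
  qed
  note contX = continuous_on_subset[OF u X(2)] continuous_on_subset[OF g X(2)] cont_z' has_laplacian_continuous[OF z']
      has_laplacian_continuous[OF has_laplacian_subset[OF smooth_fun_has_laplacian[OF bump_smooth[of \<delta> x1]] subset_UNIV[of X]]]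
      continuous_on_bump[of X \<delta> x1]
  \<comment> \<open>Both equations are tested with the same bump: the integral equals that of (g -
    L') times the bump, which is at least m \<kappa> / 4.\<close>
  have "(\<integral>y. W y * laplacian (bump \<delta> x1) y \<partial>lborel) =
      (\<integral>x. (indicator B x *\<^sub>R u x) * laplacian (bump \<delta> x1) x - (indicator B x *\<^sub>R z' x) * laplacian (bump \<delta> x1) x \<partial>lborel)"
    by (simp add: W_def w_def algebra_simps)
  also have "\<dots> = (\<integral>x. (indicator B x *\<^sub>R g x) * bump \<delta> x1 x \<partial>lborel) - (\<integral>x. (indicator B x *\<^sub>R L' x) * bump \<delta> x1 x \<partial>lborel)"
    unfolding eq1[symmetric] eq2[symmetric] by (intro Bochner_Integration.integral_diff intB contX)
  also have "\<dots> = (\<integral>x. (indicator B x *\<^sub>R g x) * bump \<delta> x1 x - (indicator B x *\<^sub>R L' x) * bump \<delta> x1 x \<partial>lborel)"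
    by (intro Bochner_Integration.integral_diff[symmetric] intB contX)
  also have "\<dots> \<ge> (\<integral>x. \<kappa> / 4 * bump \<delta> x1 x \<partial>lborel)"
  proof (intro integral_mono Bochner_Integration.integrable_diff intB contX integrable_mult_right m(2))
    fix x
    show "\<kappa> / 4 * bump \<delta> x1 x \<le> (indicator B x *\<^sub>R g x) * bump \<delta> x1 x - (indicator B x *\<^sub>R L' x) * bump \<delta> x1 x"
    proof (cases "x \<in> B")
      case True
      have "\<kappa> / 4 * bump \<delta> x1 x \<le> (g x - L' x) * bump \<delta> x1 x"
        using B(2)[OF True] bump_nonneg by (intro mult_right_mono) auto
      then show ?thesis using True by (simp add: algebra_simps)
    qed (simp add: b0)
  qed
  also have "(\<integral>x. \<kappa> / 4 * bump \<delta> x1 x \<partial>lborel) = \<kappa> / 4 * m" using m by simp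
  finally have "\<kappa> / 4 * m \<le> 0" using le0 by simp
  moreover have "\<kappa> / 4 * m > 0" using \<kappa> m(3) by (intro mult_pos_pos) auto
  ultimately show False by linarith
qed

section \<open>Comparison with radial solutions\<close>

lemma filterlim_inner_self_at_0:
  "filterlim (\<lambda>x :: 'a::real_inner. x \<bullet> x) (at 0 within {0..}) (at 0)"
proof -
  have "((\<lambda>x :: 'a. x \<bullet> x) \<longlongrightarrow> (0 :: 'a) \<bullet> 0) (at 0)" by (intro tendsto_intros)
  moreover have "eventually (\<lambda>x :: 'a. x \<bullet> x \<in> {0..} \<and> x \<bullet> x \<noteq> 0) (at 0)"
    by (auto simp: eventually_at_filter)
  ultimately show ?thesis by (simp add: filterlim_at eventually_conj_iff)
qed

lemma isCont_radial:
  fixes x :: "'a::real_inner" and P :: "real \<Rightarrow> real"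
  assumes "x \<noteq> 0 \<Longrightarrow> isCont P (x \<bullet> x)" and "x = 0 \<Longrightarrow> (P \<longlongrightarrow> P 0) (at 0 within {0..})"
  shows "isCont (\<lambda>x. P (x \<bullet> x)) x"
proof (cases "x = 0")
  case True
  have "((\<lambda>x :: 'a. P (x \<bullet> x)) \<longlongrightarrow> P 0) (at 0)"
    by (rule filterlim_compose[OF assms(2)[OF True] filterlim_inner_self_at_0])
  then show ?thesis using True by (simp add: isCont_def)
next
  case False
  then show ?thesis
    by (intro isCont_o2[of x "\<lambda>x. x \<bullet> x" P] assms(1) continuous_intros)
qed

lemma inner_self_add_axis:
  fixes x :: "real ^ 'n::finite"
  shows "(x + t *\<^sub>R axis i 1) \<bullet> (x + t *\<^sub>R axis i 1) = x \<bullet> x + 2 * t * x $ i + t\<^sup>2"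
  using inner_shift_axis[of x t i 0] by simp

text \<open>The second derivative along axis i is 2 W1 + 4 x_i^2 W2. Since x_i^2 \<le> x \<bullet>
  x, continuity at the origin follows from s * W2 s tending to 0; W2 itself may be unbounded there
  when f is only continuous.\<close>

lemma has_laplacian_radial:
  fixes \<Omega> :: "(real ^ 'n::finite) set" and W W1 W2 :: "real \<Rightarrow> real"
  assumes "open \<Omega>"
    and pos: "\<And>x. x \<in> \<Omega> \<Longrightarrow> x \<noteq> 0 \<Longrightarrow> (W has_real_derivative W1 (x \<bullet> x)) (at (x \<bullet> x))"
      "\<And>x. x \<in> \<Omega> \<Longrightarrow> x \<noteq> 0 \<Longrightarrow> (W1 has_real_derivative W2 (x \<bullet> x)) (at (x \<bullet> x))"
      "\<And>x. x \<in> \<Omega> \<Longrightarrow> x \<noteq> 0 \<Longrightarrow> isCont W2 (x \<bullet> x)"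
    and zero: "0 \<in> \<Omega> \<Longrightarrow> (W has_real_derivative W1 0) (at 0 within {0..})"
      "0 \<in> \<Omega> \<Longrightarrow> (W1 \<longlongrightarrow> W1 0) (at 0 within {0..})"
      "0 \<in> \<Omega> \<Longrightarrow> ((\<lambda>s. s * W2 s) \<longlongrightarrow> 0) (at 0 within {0..})"
  shows "has_laplacian \<Omega> (\<lambda>x. W (x \<bullet> x)) (\<lambda>x. 4 * (x \<bullet> x) * W2 (x \<bullet> x) + 2 * real CARD('n) * W1 (x \<bullet> x))"
proof (rule has_laplacianI)
  have W1c: "isCont (\<lambda>x. W1 (x \<bullet> x)) x" if "x \<in> \<Omega>" for x
    using that zero(2) by (intro isCont_radial DERIV_isCont[OF pos(2)]) auto
  show "continuous_on \<Omega> (\<lambda>x. W (x \<bullet> x))"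
  proof (intro continuous_at_imp_continuous_on ballI isCont_radial)
    show "isCont W (x \<bullet> x)" if "x \<in> \<Omega>" "x \<noteq> 0" for x by (rule DERIV_isCont[OF pos(1)[OF that]])
    show "(W \<longlongrightarrow> W 0) (at 0 within {0..})" if "x \<in> \<Omega>" "x = 0" for x
      using DERIV_continuous[OF zero(1)] that by (simp add: continuous_within)
  qed
  show "((\<lambda>t. W ((x + t *\<^sub>R axis i 1) \<bullet> (x + t *\<^sub>R axis i 1))) has_real_derivative 2 * x $ i * W1 (x \<bullet> x)) (at 0)"
    if x: "x \<in> \<Omega>" for x i
  proof -
    define \<gamma> where "\<gamma> t = (x + t *\<^sub>R axis i 1) \<bullet> (x + t *\<^sub>R axis i 1)" for t
    have "(\<gamma> has_real_derivative 2 * x $ i) (at 0)"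
      unfolding \<gamma>_def inner_self_add_axis by (auto intro!: derivative_eq_intros)
    moreover have "(W has_real_derivative W1 (x \<bullet> x)) (at (\<gamma> 0) within range \<gamma>)"
    proof (cases "x = 0")
      case True
      then have "(W has_real_derivative W1 0) (at 0 within range \<gamma>)"
        using x by (intro DERIV_subset[OF zero(1)]) (auto simp: \<gamma>_def)
      then show ?thesis using True by (simp add: \<gamma>_def)
    next
      case False
      show ?thesis using has_field_derivative_at_within[OF pos(1)[OF x False]] by (simp add: \<gamma>_def)
    qed
    ultimately have "((W \<circ> \<gamma>) has_real_derivative W1 (x \<bullet> x) * (2 * x $ i)) (at 0)"
      by (intro DERIV_image_chain)
    then show ?thesis by (simp add: \<gamma>_def o_def mult_ac)
  qed
  show "((\<lambda>t. 2 * (x + t *\<^sub>R axis i 1) $ i * W1 ((x + t *\<^sub>R axis i 1) \<bullet> (x + t *\<^sub>R axis i 1))) has_real_derivative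
      2 * W1 (x \<bullet> x) + 4 * (x $ i)\<^sup>2 * W2 (x \<bullet> x)) (at 0)"
    if x: "x \<in> \<Omega>" for x i
  proof (cases "x = 0")
    case True
    \<comment> \<open>Along an axis through 0 the first derivative is 2 t W1(t^2). Caratheodory's
      criterion differentiates it at 0 from the continuity of W1 alone.\<close>
    have "isCont (\<lambda>t. W1 ((x + t *\<^sub>R axis i 1) \<bullet> (x + t *\<^sub>R axis i 1))) 0"
      using W1c[OF x] by (intro isCont_o2[of 0 "\<lambda>t. x + t *\<^sub>R axis i 1" "\<lambda>x. W1 (x \<bullet> x)"] continuous_intros) auto
    then have "isCont (\<lambda>t. 2 * W1 ((x + t *\<^sub>R axis i 1) \<bullet> (x + t *\<^sub>R axis i 1))) 0"
      by (intro continuous_intros)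
    then show ?thesis unfolding CARAT_DERIV using True
      by (intro exI[of _ "\<lambda>t. 2 * W1 ((x + t *\<^sub>R axis i 1) \<bullet> (x + t *\<^sub>R axis i 1))"] conjI allI) simp_all
  next
    case False
    have 1: "((\<lambda>t. x \<bullet> x + 2 * t * x $ i + t\<^sup>2) has_real_derivative 2 * x $ i) (at 0)"
      by (auto intro!: derivative_eq_intros)
    have "(W1 has_real_derivative W2 (x \<bullet> x)) (at (x \<bullet> x + 2 * 0 * x $ i + 0\<^sup>2))"
      using pos(2)[OF x False] by simp
    from DERIV_chain2[OF this 1]
    have 2: "((\<lambda>t. W1 (x \<bullet> x + 2 * t * x $ i + t\<^sup>2)) has_real_derivative W2 (x \<bullet> x) * (2 * x $ i)) (at 0)" .
    have 3: "((\<lambda>t. 2 * (x + t *\<^sub>R axis i 1) $ i) has_real_derivative 2) (at 0)"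
      by (auto intro!: derivative_eq_intros)
    from DERIV_mult[OF 3 2] show ?thesis
      unfolding inner_self_add_axis by (rule DERIV_cong) (simp add: power2_eq_square)
  qed
  show "continuous_on \<Omega> (\<lambda>x. 2 * W1 (x \<bullet> x) + 4 * (x $ i)\<^sup>2 * W2 (x \<bullet> x))" for i
  proof (intro continuous_at_imp_continuous_on ballI)
    fix x assume x: "x \<in> \<Omega>"
    have *: "isCont (\<lambda>x. (x $ i)\<^sup>2 * W2 (x \<bullet> x)) x"
    proof (cases "x = 0")
      case True
      have lim: "((\<lambda>x :: real ^ 'n. (x \<bullet> x) * W2 (x \<bullet> x)) \<longlongrightarrow> 0) (at 0)"
        using x True by (intro filterlim_compose[OF zero(3) filterlim_inner_self_at_0]) auto
      have "((\<lambda>x :: real ^ 'n. (x $ i)\<^sup>2 * W2 (x \<bullet> x)) \<longlongrightarrow> 0) (at 0)"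
      proof (rule Lim_null_comparison[OF _ tendsto_rabs_zero[OF lim]], intro always_eventually allI)
        fix x :: "real ^ 'n"
        have "\<bar>x $ i\<bar>\<^sup>2 \<le> (norm x)\<^sup>2" by (intro power_mono component_le_norm_cart) auto
        then have "(x $ i)\<^sup>2 \<le> x \<bullet> x" by (simp add: power2_norm_eq_inner)
        then show "norm ((x $ i)\<^sup>2 * W2 (x \<bullet> x)) \<le> \<bar>(x \<bullet> x) * W2 (x \<bullet> x)\<bar>"
          by (simp add: abs_mult mult_right_mono)
      qed
      then show ?thesis using True by (simp add: isCont_def)
    next
      case False
      then have "isCont (\<lambda>x. W2 (x \<bullet> x)) x" by (intro isCont_radial pos(3)[OF x]) auto
      then show ?thesis by (intro continuous_intros)
    qed
    have "isCont (\<lambda>x. 2 * W1 (x \<bullet> x) + 4 * ((x $ i)\<^sup>2 * W2 (x \<bullet> x))) x"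
      by (rule isCont_add[OF isCont_mult[OF continuous_const W1c[OF x]] isCont_mult[OF continuous_const *]])
    then show "isCont (\<lambda>x. 2 * W1 (x \<bullet> x) + 4 * (x $ i)\<^sup>2 * W2 (x \<bullet> x)) x" by (simp add: mult.assoc)
  qed
  show "4 * (x \<bullet> x) * W2 (x \<bullet> x) + 2 * real CARD('n) * W1 (x \<bullet> x) =
      (\<Sum>i\<in>UNIV. 2 * W1 (x \<bullet> x) + 4 * (x $ i)\<^sup>2 * W2 (x \<bullet> x))" for x :: "real ^ 'n"
  proof -
    have "(\<Sum>i\<in>UNIV. 4 * (x $ i)\<^sup>2 * W2 (x \<bullet> x)) = 4 * (\<Sum>i\<in>UNIV. (x $ i)\<^sup>2) * W2 (x \<bullet> x)"
      by (simp add: sum_distrib_left sum_distrib_right)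
    also have "(\<Sum>i\<in>UNIV. (x $ i)\<^sup>2) = x \<bullet> x" by (simp add: inner_vec_def power2_eq_square)
    finally show ?thesis by (simp add: sum.distrib)
  qed
qed

section \<open>The radial large solution as a function on the ball\<close>

locale radial_profile = keller_osserman f F a for f F :: "real \<Rightarrow> real" and a :: real +
  fixes N :: nat and W :: "real \<Rightarrow> real"
  assumes N: "N > 0"
    and cont_W: "\<And>S. S < 1 \<Longrightarrow> continuous_on {0..S} W"
    and W_eq: "\<And>t. t \<in> {0..<1} \<Longrightarrow> W t = W 0 + radial_integral N (\<lambda>t. f (W t)) t"
    and f_W_nonneg: "\<And>t. t \<in> {0..<1} \<Longrightarrow> f (W t) \<ge> 0"
    and blowup: "filterlim W at_top (at_left 1)"
begin

definition W1 :: "real \<Rightarrow> real" where "W1 = radial_mean N (\<lambda>t. f (W t))"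

text \<open>The second derivative read off the equation. Division by zero makes \<open>W2 0\<close>
  zero, and in the Laplacian this value is multiplied by x \<bullet> x = 0.\<close>

definition W2 :: "real \<Rightarrow> real" where "W2 s = (f (W s) - 2 * real N * W1 s) / (4 * s)"

lemma cont_fW: "S < 1 \<Longrightarrow> continuous_on {0..S} (\<lambda>t. f (W t))"
  by (rule continuous_on_compose2[OF cont_f cont_W]) auto

lemma W_mono: "0 \<le> s \<Longrightarrow> s \<le> t \<Longrightarrow> t < 1 \<Longrightarrow> W s \<le> W t"
  by (rule radial_solution_mono[OF cont_fW N W_eq f_W_nonneg, of t]) auto

lemma W1_bounds:
  assumes "s \<in> {0..<1}"
  shows "0 \<le> W1 s" "2 * real N * W1 s \<le> f (W s)"
proof -
  have "0 / (2 * real N) \<le> W1 s" "W1 s \<le> f (W s) / (2 * real N)"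
    unfolding W1_def using assms f_W_nonneg W_mono
    by (intro radial_mean_bounds[OF cont_fW _ N, of s s 0 "f (W s)"]; auto intro!: monoD[OF mono_f])+
  then show "0 \<le> W1 s" "2 * real N * W1 s \<le> f (W s)" using N by (auto simp: field_simps)
qed

lemma ode: "s > 0 \<Longrightarrow> 4 * s * W2 s + 2 * real N * W1 s = f (W s)"
  by (simp add: W2_def)

lemma W_has_derivative:
  assumes s: "0 < s" "s < 1"
  shows "(W has_real_derivative W1 s) (at s)" "(W1 has_real_derivative W2 s) (at s)" "isCont W2 s"
proof -
  define S where "S = (s + 1) / 2"
  have S: "s < S" "S < 1" using s by (auto simp: S_def)
  show W: "(W has_real_derivative W1 s) (at s)"
    unfolding W1_def
    by (rule radial_solution_has_derivative[OF cont_fW[OF S(2)] W_eq s(1) S(1)]) (use S in auto)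
  show W1: "(W1 has_real_derivative W2 s) (at s)"
    unfolding W2_def W1_def by (rule radial_mean_has_derivative[OF cont_fW[OF S(2)] s(1) S(1) N])
  have "isCont f (W s)" using cont_f by (simp add: continuous_on_eq_continuous_at)
  then have "isCont (\<lambda>s. f (W s)) s" by (rule isCont_o2[OF DERIV_isCont[OF W]])
  then show "isCont W2 s" unfolding W2_def[abs_def]
    using s by (intro continuous_intros DERIV_isCont[OF W1]) auto
qed

text \<open>The last limit holds because the mean of a continuous h at 0 is h 0 / (2 N), so that f(W
  s) - 2 N W1 s vanishes in the limit.\<close>

lemma at_zero:
  shows "(W has_real_derivative W1 0) (at 0 within {0..})"
    and "(W1 \<longlongrightarrow> W1 0) (at 0 within {0..})"
    and "((\<lambda>s. s * W2 s) \<longlongrightarrow> 0) (at 0 within {0..})"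
proof -
  have at: "at 0 within {0..1/2} = at (0::real) within {0..}"
    by (rule at_within_nhd[of _ "{-1<..<1/2}"]) auto
  have c: "continuous_on {0..1/2} (\<lambda>t. f (W t))" by (rule cont_fW) simp
  have "((\<lambda>t. W 0 + radial_integral N (\<lambda>t. f (W t)) t) has_real_derivative W1 0) (at 0 within {0..1/2})"
    unfolding W1_def using DERIV_add[OF DERIV_const radial_integral_has_derivative[OF c, of 0 N], of "W 0"] by simp
  then have "(W has_real_derivative W1 0) (at 0 within {0..1/2})"
  proof (rule has_field_derivative_transform_within[of _ _ _ _ 1])
    show "W 0 + radial_integral N (\<lambda>t. f (W t)) x = W x" if "x \<in> {0..1/2}" for x
      by (rule W_eq[symmetric]) (use that in auto)
  qed auto
  then show "(W has_real_derivative W1 0) (at 0 within {0..})" by (simp only: at)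
  have cW1: "continuous_on {0..1/2} W1" unfolding W1_def by (rule continuous_on_radial_mean[OF c])
  then have W1: "(W1 \<longlongrightarrow> W1 0) (at 0 within {0..1/2})" by (auto simp: continuous_on)
  then show "(W1 \<longlongrightarrow> W1 0) (at 0 within {0..})" by (simp only: at)
  have fW: "((\<lambda>s. f (W s)) \<longlongrightarrow> f (W 0)) (at 0 within {0..1/2})" using c by (auto simp: continuous_on)
  have "((\<lambda>s. (f (W s) - 2 * real N * W1 s) / 4) \<longlongrightarrow> (f (W 0) - 2 * real N * W1 0) / 4) (at 0 within {0..1/2})"
    by (intro tendsto_intros fW W1) auto
  moreover have "(f (W 0) - 2 * real N * W1 0) / 4 = 0"
    using N by (simp add: W1_def radial_mean_zero)
  moreover have "eventually (\<lambda>s. (f (W s) - 2 * real N * W1 s) / 4 = s * W2 s) (at 0 within {0..1/2})"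
    by (auto simp: eventually_at_filter W2_def)
  ultimately have "((\<lambda>s. s * W2 s) \<longlongrightarrow> 0) (at 0 within {0..1/2})"
    by (auto intro: Lim_transform_eventually)
  then show "((\<lambda>s. s * W2 s) \<longlongrightarrow> 0) (at 0 within {0..})" by (simp only: at)
qed

lemma inner_self_less_1: "x \<in> ball 0 1 \<Longrightarrow> x \<bullet> x < 1" for x :: "'a::real_inner"
  using power_strict_mono[of "norm x" 1 2] by (simp add: power2_norm_eq_inner)

lemma has_laplacian_profile:
  assumes "N = CARD('n)"
  shows "has_laplacian (ball 0 1) (\<lambda>x :: real ^ 'n::finite. W (x \<bullet> x)) (\<lambda>x. f (W (x \<bullet> x)))"
proof -
  have "has_laplacian (ball 0 1) (\<lambda>x :: real ^ 'n. W (x \<bullet> x))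
      (\<lambda>x. 4 * (x \<bullet> x) * W2 (x \<bullet> x) + 2 * real CARD('n) * W1 (x \<bullet> x))"
    by (rule has_laplacian_radial[where ?W1.0=W1 and ?W2.0=W2])
       (auto intro!: W_has_derivative at_zero inner_self_less_1)
  moreover have "4 * (x \<bullet> x) * W2 (x \<bullet> x) + 2 * real CARD('n) * W1 (x \<bullet> x) = f (W (x \<bullet> x))" for x :: "real ^ 'n"
  proof (cases "x = 0")
    case True
    then show ?thesis using N by (simp add: W1_def radial_mean_zero assms[symmetric])
  next
    case False
    then show ?thesis using ode[of "x \<bullet> x"] by (simp add: assms)
  qed
  ultimately show ?thesis by simp
qed

end

text \<open>The change of variable \<open>s \<mapsto> s + d (1 - 2 n (s - s0)\<^sup>2)\<close> turns a radial solution into a strict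
  supersolution (\<open>d > 0\<close>) or subsolution (\<open>d < 0\<close>) near the unit sphere: the concave factor
  compensates the first-order term of the radial Laplacian, which has the wrong sign for a plain shift.\<close>

lemma shifted_profile_sign:
  fixes n s s0 d A B H p p1 :: real
  assumes n: "n \<ge> 1" and s: "3/4 \<le> s0" "s0 \<le> s" "s < 1" "4 * n * (1 - s0) \<le> 1"
    and d: "d \<noteq> 0" "\<bar>d\<bar> \<le> 1/10" and A: "A \<ge> 0" and H: "H > 0"
    and p: "p = s + d * (1 - 2 * n * (s - s0)\<^sup>2)" and p1: "p1 = 1 - 4 * n * (s - s0) * d"
    and ode: "4 * p * B + 2 * n * A = H"
  shows "sgn d * (4 * s * (B * p1\<^sup>2 + A * (- 4 * n * d)) + 2 * n * (A * p1)) < sgn d * H"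
proof -
  \<comment> \<open>A, B and H stand for W', W'' and f(W) at the shifted point p, while p1 and -4 n
    d are p' and p''. The condition on s0 keeps y in [0, 1], hence p1 = 1 - y d within 1/10 of
    1.\<close>
  define y where "y = 4 * n * (s - s0)"
  have y: "0 \<le> y" "y \<le> 1"
  proof -
    have "4 * n * (s - s0) \<le> 4 * n * (1 - s0)" using n s by (intro mult_left_mono) auto
    then show "y \<le> 1" using s by (simp add: y_def)
    show "0 \<le> y" using n s by (simp add: y_def)
  qed
  define e where "e = y * (s - s0) / 2"
  have p': "p = s + d * (1 - e)" by (simp add: p y_def e_def power2_eq_square)
  have p1': "p1 = 1 - y * d" by (simp add: p1 y_def)
  have yx: "0 \<le> e" "e \<le> 1/8"
    using y s mult_mono[of y 1 "s - s0" "1/4"] by (auto simp: e_def)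
  have p_ge: "p \<ge> 13/20"
  proof -
    have "\<bar>d * (1 - e)\<bar> \<le> (1/10) * 1"
      unfolding abs_mult using d yx by (intro mult_mono) auto
    then show ?thesis using s by (simp add: p' abs_le_iff)
  qed
  have yd: "\<bar>y * d\<bar> \<le> 1/10" using mult_mono[of y 1 "\<bar>d\<bar>" "1/10"] y d by (simp add: abs_mult)
  have sgn_d: "sgn d * (d * r) = \<bar>d\<bar> * r" for r by (simp add: sgn_if)
  \<comment> \<open>Multiplying the claim by p and eliminating B through the equation leaves (s p1^2
    - p) H plus A times a second coefficient. The two coefficients are d times -Q1 and d times 2 n
    Q2, and both -Q1 and Q2 are negative.\<close>
  define Q1 where "Q1 = 2 * y * s - y * (y * d) * s + 1 - e"
  have "s * p1\<^sup>2 - p = d * (- Q1)"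
    by (simp add: p' p1' Q1_def power2_eq_square algebra_simps)
  then have "sgn d * (s * p1\<^sup>2 - p) = \<bar>d\<bar> * (- Q1)" by (simp only: sgn_d)
  moreover have "Q1 > 0"
  proof -
    have "\<bar>y * (y * d) * s\<bar> \<le> (1 * (1/10)) * 1"
      unfolding abs_mult[of "y * (y * d)"] abs_mult[of y "y * d"] using y yd s by (intro mult_mono) auto
    moreover have "0 \<le> 2 * y * s" using y s by simp
    ultimately show ?thesis using yx unfolding Q1_def by linarith
  qed
  ultimately have E1: "sgn d * (s * p1\<^sup>2 - p) < 0"
    using d(1) by (simp add: mult_pos_pos)
  define Q2 where "Q2 = p1 * (1 - e + y * s) - 8 * s * p"
  have "- 2 * n * s * p1\<^sup>2 + 4 * s * p * (- 4 * n * d) + 2 * n * p * p1 = d * (2 * n * Q2)"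
    by (simp add: p' p1' Q2_def power2_eq_square algebra_simps)
  then have "sgn d * (- 2 * n * s * p1\<^sup>2 + 4 * s * p * (- 4 * n * d) + 2 * n * p * p1) = \<bar>d\<bar> * (2 * n * Q2)"
    by (simp only: sgn_d)
  \<comment> \<open>The first product is at most (11/10) * 2, against 8 * (3/4) * (13/20) for the
    term that comes from the concavity p''.\<close>
  moreover have "Q2 < 0"
  proof -
    have "y * s \<le> 1 * 1" using y s by (intro mult_mono) auto
    moreover have "0 \<le> y * s" using y s by simp
    ultimately have "p1 * (1 - e + y * s) \<le> (11/10) * 2"
      using yd yx by (intro mult_mono) (auto simp: p1' abs_le_iff)
    moreover have "(3/4) * (13/20) \<le> s * p" using s p_ge by (intro mult_mono) auto
    ultimately show ?thesis unfolding Q2_def by linarith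
  qed
  ultimately have E2: "sgn d * (- 2 * n * s * p1\<^sup>2 + 4 * s * p * (- 4 * n * d) + 2 * n * p * p1) < 0"
    using d(1) n by (simp only:) (intro mult_pos_neg; simp)
  have "p * (4 * s * (B * p1\<^sup>2 + A * (- 4 * n * d)) + 2 * n * (A * p1))
      = s * p1\<^sup>2 * (4 * p * B) + A * p * (4 * s * (- 4 * n * d) + 2 * n * p1)"
    by (simp add: algebra_simps)
  also have "4 * p * B = H - 2 * n * A" using ode by simp
  finally have eq: "p * (4 * s * (B * p1\<^sup>2 + A * (- 4 * n * d)) + 2 * n * (A * p1) - H)
      = (s * p1\<^sup>2 - p) * H + A * (- 2 * n * s * p1\<^sup>2 + 4 * s * p * (- 4 * n * d) + 2 * n * p * p1)"
    by (simp add: algebra_simps)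
  have "p * (sgn d * (4 * s * (B * p1\<^sup>2 + A * (- 4 * n * d)) + 2 * n * (A * p1) - H))
      = (sgn d * (s * p1\<^sup>2 - p)) * H + A * (sgn d * (- 2 * n * s * p1\<^sup>2 + 4 * s * p * (- 4 * n * d) + 2 * n * p * p1))"
    unfolding mult.left_commute[of p "sgn d"] eq by (simp add: algebra_simps)
  also have "\<dots> < 0"
    using mult_neg_pos[OF E1 H] mult_nonneg_nonpos[OF A less_imp_le[OF E2]] by linarith
  finally have "sgn d * (4 * s * (B * p1\<^sup>2 + A * (- 4 * n * d)) + 2 * n * (A * p1) - H) < 0"
    using p_ge by (simp add: mult_less_0_iff)
  then show ?thesis by (simp add: algebra_simps)
qed

lemma distributional_laplacian_cmult:
  assumes "distributional_laplacian \<Omega> u g"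
  shows "distributional_laplacian \<Omega> (\<lambda>x. c * u x) (\<lambda>x. c * g x)"
  using assms by (simp add: distributional_laplacian_def mult.assoc)

text \<open>The definition gives blow-up at each boundary point separately; compactness turns this
  into u > b on a whole shell next to the sphere.\<close>

lemma large_solution_sublevel_compact:
  fixes u :: "real ^ 'n::finite \<Rightarrow> real"
  assumes u: "large_solution f (ball 0 1) u"
  shows "compact {x \<in> ball 0 1. u x \<le> b}"
proof -
  have cont: "continuous_on (ball 0 1) u" and lim: "\<And>p. p \<in> frontier (ball 0 1) \<Longrightarrow> filterlim u at_top (at p within ball 0 1)"
    using u by (auto simp: large_solution_def)
  have "closed {x \<in> ball 0 1. u x \<le> b}"
    unfolding closed_sequential_limits
  proof (intro allI impI, elim conjE)
    fix s p assume s: "\<forall>n. s n \<in> {x \<in> ball 0 1. u x \<le> b}" and sp: "s \<longlonglongrightarrow> p"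
    have sb: "s n \<in> ball 0 1" "u (s n) \<le> b" for n using s by auto
    have "p \<in> closure (ball 0 1)" unfolding closure_sequential using sb(1) sp by blast
    have pb: "p \<in> ball 0 1"
    proof (rule ccontr)
      assume np: "p \<notin> ball 0 1"
      then have "p \<in> frontier (ball 0 1)" using \<open>p \<in> closure (ball 0 1)\<close> by (simp add: frontier_def)
      then have "filterlim u at_top (at p within ball 0 1)" by (rule lim)
      moreover have "filterlim s (at p within ball 0 1) sequentially"
        using sb sp np by (auto simp: filterlim_at intro!: always_eventually)
      ultimately have "filterlim (\<lambda>n. u (s n)) at_top sequentially" by (rule filterlim_compose)
      then have "eventually (\<lambda>n. b < u (s n)) sequentially" by (simp add: filterlim_at_top_dense)
      then show False using sb(2) by (auto dest!: eventually_happens simp: not_le[symmetric])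
    qed
    have "(\<lambda>n. u (s n)) \<longlonglongrightarrow> u p"
      by (rule continuous_on_tendsto_compose[OF cont sp pb]) (use sb in auto)
    then have "u p \<le> b" by (rule LIMSEQ_le_const2) (use sb in auto)
    with pb show "p \<in> {x \<in> ball 0 1. u x \<le> b}" by simp
  qed
  moreover have "bounded {x \<in> ball (0 :: real ^ 'n) 1. u x \<le> b}"
    by (rule bounded_subset[OF bounded_ball, of _ 0 1]) auto
  ultimately show ?thesis by (simp add: compact_eq_bounded_closed)
qed

lemma compact_inner_self_le: "compact {x :: 'a::euclidean_space. c \<le> x \<bullet> x \<and> x \<bullet> x \<le> b}"
proof -
  have "bounded {x :: 'a. c \<le> x \<bullet> x \<and> x \<bullet> x \<le> b}"
  proof (rule boundedI)
    fix x :: 'a assume "x \<in> {x. c \<le> x \<bullet> x \<and> x \<bullet> x \<le> b}"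
    then show "norm x \<le> sqrt b" by (simp add: norm_eq_sqrt_inner)
  qed
  moreover have "closed {x :: 'a. c \<le> x \<bullet> x \<and> x \<bullet> x \<le> b}"
    by (intro closed_Collect_conj closed_Collect_le continuous_intros)
  ultimately show ?thesis by (simp add: compact_eq_bounded_closed)
qed

lemma mem_ball_iff_inner_self: "x \<in> ball 0 1 \<longleftrightarrow> x \<bullet> x < 1" for x :: "'a::real_inner"
  by (simp add: norm_eq_sqrt_inner)

section \<open>Comparison with the shifted profile\<close>

context radial_profile
begin

text \<open>An excess of \<sigma> (u - z) over m would have an interior maximum: next to the outer
  boundary \<sigma> (u - z) \<le> 0, and on the inner sphere it is at most m. At that maximum the
  touching principle and the monotonicity of f contradict the strict inequality for z. Any nonzero d
  is a strict gap, so two infinite boundary values never have to be compared.\<close>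

lemma shifted_comparison:
  fixes u :: "real ^ 'n::finite \<Rightarrow> real"
  assumes Nn: "N = CARD('n)" and u: "large_solution f (ball 0 1) u"
    and s0: "3/4 \<le> s0" "s0 < 1" "4 * real N * (1 - s0) \<le> 1"
    and pos: "s1 < s0" "0 < s1" "\<And>s. s1 \<le> s \<Longrightarrow> s < 1 \<Longrightarrow> f (W s) > 0"
    and d: "d \<noteq> 0" "\<bar>d\<bar> \<le> 1/10" "\<bar>d\<bar> \<le> s0 - s1" "\<bar>d\<bar> < 1 - s0"
    and m: "m \<ge> 0" "\<And>y. y \<bullet> y = s0 \<Longrightarrow> sgn d * (u y - W (y \<bullet> y)) \<le> m"
    and x: "s0 \<le> x \<bullet> x" "x \<bullet> x < 1" "x \<bullet> x + d * (1 - 2 * real N * (x \<bullet> x - s0)\<^sup>2) < 1"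
  shows "sgn d * (u x - W (x \<bullet> x + d * (1 - 2 * real N * (x \<bullet> x - s0)\<^sup>2))) \<le> m"
proof (rule ccontr)
  define \<sigma> where "\<sigma> = sgn d"
  have \<sigma>: "\<sigma> = 1 \<and> d > 0 \<or> \<sigma> = -1 \<and> d < 0" using d(1) by (auto simp: \<sigma>_def sgn_if)
  define \<phi> where "\<phi> s = s + d * (1 - 2 * real N * (s - s0)\<^sup>2)" for s
  define z where "z x = W (\<phi> (x \<bullet> x))" for x :: "real ^ 'n"
  have cu: "continuous_on (ball 0 1) u" and du: "distributional_laplacian (ball 0 1) u (\<lambda>x. f (u x))"
    using u by (auto simp: large_solution_def)
  \<comment> \<open>Since 4 N (1 - s0) \<le> 1, the actual displacement of s lies between |d| / 2
    and |d| and has the sign of d.\<close>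
  have half: "1/2 \<le> 1 - 2 * real N * (s - s0)\<^sup>2" "1 - 2 * real N * (s - s0)\<^sup>2 \<le> 1" if "s0 \<le> s" "s < 1" for s
  proof -
    have "(4 * real N * (s - s0)) * (s - s0) \<le> 1 * 1"
      using that s0 mult_left_mono[of "s - s0" "1 - s0" "4 * real N"] by (intro mult_mono) auto
    then show "1/2 \<le> 1 - 2 * real N * (s - s0)\<^sup>2" by (simp add: power2_eq_square)
  qed simp
  have \<phi>_dist: "\<bar>d\<bar> / 2 \<le> \<bar>\<phi> s - s\<bar>" "\<bar>\<phi> s - s\<bar> \<le> \<bar>d\<bar>" "0 < \<sigma> * (\<phi> s - s)" if "s0 \<le> s" "s < 1" for s
  proof -
    have "\<bar>\<phi> s - s\<bar> = \<bar>d\<bar> * (1 - 2 * real N * (s - s0)\<^sup>2)"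
      using half[OF that] by (simp add: \<phi>_def abs_mult)
    moreover have "\<bar>d\<bar> * (1/2) \<le> \<bar>d\<bar> * (1 - 2 * real N * (s - s0)\<^sup>2)" "\<bar>d\<bar> * (1 - 2 * real N * (s - s0)\<^sup>2) \<le> \<bar>d\<bar> * 1"
      using half[OF that] by (intro mult_left_mono; simp)+
    ultimately show "\<bar>d\<bar> / 2 \<le> \<bar>\<phi> s - s\<bar>" "\<bar>\<phi> s - s\<bar> \<le> \<bar>d\<bar>" by simp_all
    have "\<sigma> * (\<phi> s - s) = \<bar>d\<bar> * (1 - 2 * real N * (s - s0)\<^sup>2)"
      using \<sigma> by (auto simp: \<phi>_def)
    also have "\<dots> > 0" using d(1) half[OF that] by (intro mult_pos_pos) auto
    finally show "0 < \<sigma> * (\<phi> s - s)" .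
  qed
  have \<phi>_s1: "s1 \<le> \<phi> s" if "s0 \<le> s" "s < 1" for s
    using \<phi>_dist(2)[OF that] d(3) that by linarith
  have cont\<phi>: "continuous_on UNIV (\<lambda>x :: real ^ 'n. \<phi> (x \<bullet> x))"
    unfolding \<phi>_def by (intro continuous_intros)
  \<comment> \<open>The open shell where u and z are both defined: s and its image \<phi> s stay
    below 1.\<close>
  define D where "D = {x :: real ^ 'n. s0 < x \<bullet> x \<and> x \<bullet> x < 1 \<and> \<phi> (x \<bullet> x) < 1}"
  have openD: "open D"
    unfolding D_def by (intro open_Collect_conj open_Collect_less continuous_intros cont\<phi>)
  have D_ball: "D \<subseteq> ball 0 1" unfolding D_def mem_ball_iff_inner_self[symmetric] by auto
  define Z1 where "Z1 s = W1 (\<phi> s) * (1 - 4 * real N * (s - s0) * d)" for s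
  define Z2 where "Z2 s = W2 (\<phi> s) * (1 - 4 * real N * (s - s0) * d)\<^sup>2 + W1 (\<phi> s) * (- 4 * real N * d)" for s
  define Lz where "Lz x = 4 * (x \<bullet> x) * Z2 (x \<bullet> x) + 2 * real N * Z1 (x \<bullet> x)" for x :: "real ^ 'n"
  have d\<phi>: "(\<phi> has_real_derivative (1 - 4 * real N * (s - s0) * d)) (at s)" for s
    unfolding \<phi>_def by (auto intro!: derivative_eq_intros simp: algebra_simps)
  have lap_z: "has_laplacian D z Lz"
    unfolding z_def[abs_def] Lz_def[abs_def] unfolding Nn
  proof (rule has_laplacian_radial[where W="\<lambda>s. W (\<phi> s)" and ?W1.0=Z1 and ?W2.0=Z2])
    fix x assume "x \<in> D"
    define s where "s = x \<bullet> x"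
    have s: "s0 \<le> s" "s < 1" "\<phi> s < 1" using \<open>x \<in> D\<close> by (auto simp: D_def s_def)
    then have \<phi>s: "0 < \<phi> s" "\<phi> s < 1" using \<phi>_s1[of s] pos(2) by auto
    note dW = W_has_derivative[OF \<phi>s]
    show "((\<lambda>s. W (\<phi> s)) has_real_derivative Z1 (x \<bullet> x)) (at (x \<bullet> x))"
      unfolding Z1_def s_def[symmetric] by (rule DERIV_chain2[OF dW(1) d\<phi>])
    have 1: "((\<lambda>s. W1 (\<phi> s)) has_real_derivative W2 (\<phi> s) * (1 - 4 * real N * (s - s0) * d)) (at s)"
      by (rule DERIV_chain2[OF dW(2) d\<phi>])
    have 2: "((\<lambda>s. 1 - 4 * real N * (s - s0) * d) has_real_derivative - 4 * real N * d) (at s)"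
      by (auto intro!: derivative_eq_intros)
    show "(Z1 has_real_derivative Z2 (x \<bullet> x)) (at (x \<bullet> x))"
      unfolding Z1_def Z2_def s_def[symmetric]
      by (rule DERIV_cong[OF DERIV_mult[OF 1 2]]) (simp add: power2_eq_square algebra_simps)
    have "isCont (\<lambda>s. W2 (\<phi> s)) s" by (rule isCont_o2[OF DERIV_isCont[OF d\<phi>] dW(3)])
    moreover have "isCont (\<lambda>s. W1 (\<phi> s)) s" by (rule isCont_o2[OF DERIV_isCont[OF d\<phi>] DERIV_isCont[OF dW(2)]])
    ultimately show "isCont Z2 (x \<bullet> x)"
      unfolding Z2_def[abs_def] s_def[symmetric]
      by (intro isCont_add isCont_mult isCont_power isCont_diff continuous_const continuous_ident)
  qed (use openD s0 in \<open>auto simp: D_def\<close>)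
  have strict: "\<sigma> * Lz x < \<sigma> * f (z x)" if "x \<in> D" for x
  proof -
    define s where "s = x \<bullet> x"
    have s: "s0 \<le> s" "s < 1" "\<phi> s < 1" using \<open>x \<in> D\<close> by (auto simp: D_def s_def)
    then have \<phi>s: "s1 \<le> \<phi> s" "0 < \<phi> s" using \<phi>_s1[of s] pos(2) by auto
    show ?thesis
      unfolding Lz_def z_def Z1_def Z2_def s_def[symmetric] \<sigma>_def
      by (rule shifted_profile_sign[OF _ s0(1) s(1,2) s0(3) d(1,2) W1_bounds(1) pos(3)[OF \<phi>s(1) s(3)] _ _ ode[OF \<phi>s(2)]])
         (use N \<phi>s s in \<open>auto simp: \<phi>_def\<close>)
  qed
  assume "\<not> sgn d * (u x - W (x \<bullet> x + d * (1 - 2 * real N * (x \<bullet> x - s0)\<^sup>2))) \<le> m"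
  then have xm: "m < \<sigma> * (u x - z x)" by (simp add: \<sigma>_def z_def \<phi>_def)
  text \<open>Near the outer boundary of \<open>D\<close> either \<open>z\<close> blows up and \<open>u\<close> is bounded (\<open>d > 0\<close>), or conversely.\<close>
  have "\<exists>T<1. \<forall>y. s0 \<le> y \<bullet> y \<longrightarrow> y \<bullet> y < 1 \<longrightarrow> \<phi> (y \<bullet> y) < 1 \<longrightarrow> T < y \<bullet> y \<or> T < \<phi> (y \<bullet> y) \<longrightarrow> \<sigma> * (u y - z y) \<le> 0"
  proof (cases "d > 0")
    case True
    then have \<sigma>1: "\<sigma> = 1" by (simp add: \<sigma>_def)
    have "compact (u ` {y. s0 \<le> y \<bullet> y \<and> y \<bullet> y \<le> 1 - d / 2})"
      using True by (intro compact_continuous_image compact_inner_self_le continuous_on_subset[OF cu])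
        (auto simp: mem_ball_iff_inner_self simp del: mem_ball mem_ball_0)
    from compact_imp_bounded[OF this]
    obtain b where "\<And>v. v \<in> u ` {y. s0 \<le> y \<bullet> y \<and> y \<bullet> y \<le> 1 - d / 2} \<Longrightarrow> \<bar>v\<bar> \<le> b"
      unfolding bounded_real by blast
    then have b: "u y \<le> b" if "s0 \<le> y \<bullet> y" "y \<bullet> y \<le> 1 - d / 2" for y :: "real ^ 'n"
      by (rule abs_le_D1) (use that in auto)
    have "eventually (\<lambda>t. b \<le> W t) (at_left 1)" using blowup by (simp add: filterlim_at_top)
    then obtain T where T: "T < 1" "\<And>t. T < t \<Longrightarrow> t < 1 \<Longrightarrow> b \<le> W t"
      unfolding eventually_at_left_field by blast
    show ?thesis
    proof (intro exI[of _ T] conjI allI impI T(1))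
      fix y :: "real ^ 'n" assume y: "s0 \<le> y \<bullet> y" "y \<bullet> y < 1" "\<phi> (y \<bullet> y) < 1" "T < y \<bullet> y \<or> T < \<phi> (y \<bullet> y)"
      have dist: "d / 2 \<le> \<phi> (y \<bullet> y) - y \<bullet> y"
        using \<phi>_dist(1,3)[OF y(1,2)] True \<sigma>1 by simp
      have "u y \<le> b" using dist y by (intro b) auto
      also have "b \<le> z y" unfolding z_def using dist y True by (intro T(2)) auto
      finally show "\<sigma> * (u y - z y) \<le> 0" by (simp add: \<sigma>1)
    qed
  next
    case False
    then have \<sigma>1: "\<sigma> = -1" "d < 0" using \<sigma> by auto
    \<comment> \<open>For d < 0 the image \<phi> s lags behind s < 1 by at least |d| / 2, so this
      bounds z on the whole shell.\<close>
    define b where "b = W (1 + d / 2)"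
    obtain T where T: "T < 1" "\<And>y. y \<bullet> y < 1 \<Longrightarrow> u y \<le> b \<Longrightarrow> y \<bullet> y \<le> T"
    proof (cases "{y \<in> ball 0 1. u y \<le> b} = {}")
      case True
      then show ?thesis by (intro that[of 0]) (auto simp: mem_ball_iff_inner_self simp del: mem_ball mem_ball_0)
    next
      case False
      have "continuous_on {y \<in> ball 0 1. u y \<le> b} (\<lambda>y. y \<bullet> y)" by (intro continuous_intros)
      from continuous_attains_sup[OF large_solution_sublevel_compact[OF u] False this]
      obtain q where "q \<in> {y \<in> ball 0 1. u y \<le> b}" "\<And>y. y \<in> {y \<in> ball 0 1. u y \<le> b} \<Longrightarrow> y \<bullet> y \<le> q \<bullet> q"
        by blast
      then show ?thesis by (intro that[of "q \<bullet> q"]) (auto simp: mem_ball_iff_inner_self simp del: mem_ball mem_ball_0)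
    qed
    show ?thesis
    proof (intro exI[of _ T] conjI allI impI T(1))
      fix y :: "real ^ 'n" assume y: "s0 \<le> y \<bullet> y" "y \<bullet> y < 1" "\<phi> (y \<bullet> y) < 1" "T < y \<bullet> y \<or> T < \<phi> (y \<bullet> y)"
      have dist: "- d / 2 \<le> y \<bullet> y - \<phi> (y \<bullet> y)"
        using \<phi>_dist(1,3)[OF y(1,2)] \<sigma>1 by simp
      then have "T < y \<bullet> y" using y \<sigma>1 by auto
      then have "b < u y" using T(2)[OF y(2)] by fastforce
      moreover have "z y \<le> b" unfolding z_def b_def
        using \<phi>_s1[OF y(1,2)] pos(2) dist y \<sigma>1 by (intro W_mono) auto
      ultimately show "\<sigma> * (u y - z y) \<le> 0" by (simp add: \<sigma>1)
    qed
  qed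
  then obtain T where T: "T < 1" "\<And>y. s0 \<le> y \<bullet> y \<Longrightarrow> y \<bullet> y < 1 \<Longrightarrow> \<phi> (y \<bullet> y) < 1 \<Longrightarrow>
      T < y \<bullet> y \<or> T < \<phi> (y \<bullet> y) \<Longrightarrow> \<sigma> * (u y - z y) \<le> 0"
    by blast
  define C where "C = {y :: real ^ 'n. s0 \<le> y \<bullet> y \<and> y \<bullet> y \<le> T} \<inter> {y. \<phi> (y \<bullet> y) \<le> T}"
  have compC: "compact C"
    unfolding C_def by (intro compact_Int_closed compact_inner_self_le closed_Collect_le cont\<phi> continuous_on_const)
  have xC: "x \<in> C"
  proof (rule ccontr)
    assume "x \<notin> C"
    then have "T < x \<bullet> x \<or> T < \<phi> (x \<bullet> x)" using x(1) by (auto simp: C_def not_le)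
    then have "\<sigma> * (u x - z x) \<le> 0" using x by (intro T(2)) (auto simp: \<phi>_def)
    then show False using xm m(1) by simp
  qed
  have contC: "continuous_on C (\<lambda>y. \<sigma> * (u y - z y))"
  proof (intro continuous_on_mult_left continuous_on_diff)
    show "continuous_on C u"
      using T(1) by (intro continuous_on_subset[OF cu]) (auto simp: C_def mem_ball_iff_inner_self simp del: mem_ball mem_ball_0)
    have "continuous_on {0..T} W" using T(1) by (rule cont_W)
    then show "continuous_on C z" unfolding z_def
    proof (rule continuous_on_compose2)
      show "continuous_on C (\<lambda>y. \<phi> (y \<bullet> y))" by (rule continuous_on_subset[OF cont\<phi>]) simp
      show "(\<lambda>y. \<phi> (y \<bullet> y)) ` C \<subseteq> {0..T}"
      proof (rule image_subsetI)
        fix y :: "real ^ 'n" assume "y \<in> C"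
        then have "s0 \<le> y \<bullet> y" "y \<bullet> y < 1" "\<phi> (y \<bullet> y) \<le> T" using T(1) by (auto simp: C_def)
        then show "\<phi> (y \<bullet> y) \<in> {0..T}" using \<phi>_s1[of "y \<bullet> y"] pos(2) by auto
      qed
    qed
  qed
  obtain q where q: "q \<in> C" "\<And>y. y \<in> C \<Longrightarrow> \<sigma> * (u y - z y) \<le> \<sigma> * (u q - z q)"
    using continuous_attains_sup[OF compC _ contC] xC by blast
  have qm: "m < \<sigma> * (u q - z q)" using xm q(2)[OF xC] by simp
  have q1: "s0 \<le> q \<bullet> q" "q \<bullet> q < 1" "\<phi> (q \<bullet> q) < 1" using q(1) T(1) by (auto simp: C_def)
  have "q \<bullet> q \<noteq> s0"
  proof
    assume qs: "q \<bullet> q = s0"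
    \<comment> \<open>\<phi> moves s0 in the direction of d and W is nondecreasing, so the bound m
      for W on the inner sphere carries over to z.\<close>
    have "\<sigma> * (W s0 - W (\<phi> s0)) \<le> 0"
      using \<sigma>
    proof
      assume "\<sigma> = 1 \<and> d > 0"
      then show ?thesis using W_mono[of s0 "\<phi> s0"] \<phi>_dist(3)[of s0] q1 qs s0 by simp
    next
      assume "\<sigma> = -1 \<and> d < 0"
      then show ?thesis using W_mono[of "\<phi> s0" s0] \<phi>_dist(3)[of s0] \<phi>_s1[of s0] pos(2) q1 qs s0 by simp
    qed
    moreover have "\<sigma> * (u q - W s0) \<le> m" using m(2)[OF qs] by (simp add: qs \<sigma>_def)
    ultimately show False using qm by (simp add: z_def qs right_diff_distrib)
  qed
  then have qD: "q \<in> D" using q1 by (simp add: D_def)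
  have "\<sigma> * f (u q) \<le> \<sigma> * Lz q"
  proof (rule distributional_laplacian_touching[OF _ _ distributional_laplacian_cmult[OF du] openD D_ball has_laplacian_cmult[OF lap_z] qD])
    show "continuous_on (ball 0 1) (\<lambda>x. \<sigma> * u x)" by (intro continuous_on_mult_left cu)
    show "continuous_on (ball 0 1) (\<lambda>x. \<sigma> * f (u x))"
      by (intro continuous_on_mult_left continuous_on_compose2[OF cont_f cu]) auto
    fix y assume y: "y \<in> D"
    have "\<sigma> * (u y - z y) \<le> \<sigma> * (u q - z q)"
    proof (cases "y \<in> C")
      case False
      then have "\<sigma> * (u y - z y) \<le> 0" using y by (intro T(2)) (auto simp: C_def D_def)
      then show ?thesis using qm m(1) by simp
    qed (rule q(2))
    then show "\<sigma> * u y - \<sigma> * z y \<le> \<sigma> * u q - \<sigma> * z q" by (simp add: right_diff_distrib)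
  qed
  also have "\<dots> < \<sigma> * f (z q)" by (rule strict[OF qD])
  finally show False
    using \<sigma> qm m(1) monoD[OF mono_f, of "z q" "u q"] monoD[OF mono_f, of "u q" "z q"] by auto
qed

end

text \<open>Integrals over \<Omega> and filters within \<Omega> ignore values elsewhere; this allows
  the solution to be replaced by its extensional representative.\<close>

lemma large_solution_cong:
  assumes "open \<Omega>" and eq: "\<And>x. x \<in> \<Omega> \<Longrightarrow> u x = v x" and u: "large_solution f \<Omega> u"
  shows "large_solution f \<Omega> v"
  unfolding large_solution_def
proof (intro conjI ballI)
  show "continuous_on \<Omega> v"
    using u eq continuous_on_cong[of \<Omega> \<Omega> u v] by (simp add: large_solution_def)
  have *: "indicator \<Omega> x *\<^sub>R (v x * p) = indicator \<Omega> x *\<^sub>R (u x * p)"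
    "indicator \<Omega> x *\<^sub>R (f (v x) * p) = indicator \<Omega> x *\<^sub>R (f (u x) * p)" for x p
    using eq[of x] by (cases "x \<in> \<Omega>"; simp)+
  have "distributional_laplacian \<Omega> v (\<lambda>x. f (v x)) = distributional_laplacian \<Omega> u (\<lambda>x. f (u x))"
    unfolding distributional_laplacian_def set_lebesgue_integral_def * ..
  then show "distributional_laplacian \<Omega> v (\<lambda>x. f (v x))"
    using u by (simp add: large_solution_def)
  fix p assume "p \<in> frontier \<Omega>"
  then have "filterlim u at_top (at p within \<Omega>)" using u by (simp add: large_solution_def)
  moreover have "eventually (\<lambda>x. u x = v x) (at p within \<Omega>)"
    using eq by (auto simp: eventually_at_filter)
  ultimately show "filterlim v at_top (at p within \<Omega>)"
    using filterlim_cong[OF refl refl] by blast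
qed

section \<open>Uniqueness of the large solution\<close>

context radial_profile
begin

lemma large_solution_profile:
  assumes "N = CARD('n)"
  shows "large_solution f (ball 0 1) (\<lambda>x :: real ^ 'n::finite. W (x \<bullet> x))"
  unfolding large_solution_def
proof (intro conjI ballI)
  note lap = has_laplacian_profile[OF assms]
  show "continuous_on (ball 0 1) (\<lambda>x :: real ^ 'n. W (x \<bullet> x))"
    using lap unfolding has_laplacian_def by (rule conjunct1)
  show "distributional_laplacian (ball 0 1) (\<lambda>x :: real ^ 'n. W (x \<bullet> x)) (\<lambda>x. f (W (x \<bullet> x)))"
    by (rule distributional_laplacian_classical[OF lap open_ball])
  fix p :: "real ^ 'n" assume "p \<in> frontier (ball 0 1)"
  then have "p \<bullet> p = 1" by (simp add: norm_eq_sqrt_inner)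
  then have "((\<lambda>x. x \<bullet> x) \<longlongrightarrow> 1) (at p within ball 0 1)"
    using tendsto_inner[OF tendsto_ident_at tendsto_ident_at, of p "ball 0 1"] by simp
  moreover have "eventually (\<lambda>x. x \<bullet> x \<in> {..<1} \<and> x \<bullet> x \<noteq> 1) (at p within ball 0 1)"
    using inner_self_less_1 by (auto simp: eventually_at_filter simp del: mem_ball mem_ball_0 intro!: always_eventually dest: less_imp_neq)
  ultimately have "filterlim (\<lambda>x. x \<bullet> x) (at_left 1) (at p within ball 0 1)"
    by (simp add: filterlim_at eventually_conj_iff)
  from filterlim_compose[OF blowup this] show "filterlim (\<lambda>x. W (x \<bullet> x)) at_top (at p within ball 0 1)" .
qed

text \<open>The limit of \<open>shifted_comparison\<close> along d = \<sigma> \<eta> with \<eta>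
  decreasing to 0, by continuity of W at x \<bullet> x. A bound on one sphere thus propagates
  outwards although u - W has no boundary value to start from.\<close>

lemma sphere_bound:
  fixes u :: "real ^ 'n::finite \<Rightarrow> real"
  assumes Nn: "N = CARD('n)" and u: "large_solution f (ball 0 1) u" and \<sigma>: "\<sigma> = 1 \<or> \<sigma> = -1"
    and s0: "3/4 \<le> s0" "s0 < 1" "4 * real N * (1 - s0) \<le> 1"
    and pos: "s1 < s0" "0 < s1" "\<And>s. s1 \<le> s \<Longrightarrow> s < 1 \<Longrightarrow> f (W s) > 0"
    and m: "m \<ge> 0" "\<And>y. y \<bullet> y = s0 \<Longrightarrow> \<sigma> * (u y - W (y \<bullet> y)) \<le> m"
    and x: "s0 \<le> x \<bullet> x" "x \<bullet> x < 1"
  shows "\<sigma> * (u x - W (x \<bullet> x)) \<le> m"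
proof -
  define c where "c = 1 - 2 * real N * (x \<bullet> x - s0)\<^sup>2"
  have lim: "((\<lambda>\<eta>. x \<bullet> x + \<sigma> * \<eta> * c) \<longlongrightarrow> x \<bullet> x) (at_right 0)"
    by (auto intro!: tendsto_eq_intros)
  have "isCont W (x \<bullet> x)"
    using x s0 by (intro DERIV_isCont[OF W_has_derivative(1)]) auto
  then have "((\<lambda>\<eta>. W (x \<bullet> x + \<sigma> * \<eta> * c)) \<longlongrightarrow> W (x \<bullet> x)) (at_right 0)"
    by (rule isCont_tendsto_compose[OF _ lim])
  then have "((\<lambda>\<eta>. \<sigma> * (u x - W (x \<bullet> x + \<sigma> * \<eta> * c))) \<longlongrightarrow> \<sigma> * (u x - W (x \<bullet> x))) (at_right 0)"
    by (intro tendsto_intros)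
  moreover have "eventually (\<lambda>\<eta>. \<sigma> * (u x - W (x \<bullet> x + \<sigma> * \<eta> * c)) \<le> m) (at_right 0)"
  proof -
    have "eventually (\<lambda>\<eta>. x \<bullet> x + \<sigma> * \<eta> * c < 1) (at_right 0)"
      by (rule order_tendstoD(2)[OF lim x(2)])
    moreover have "eventually (\<lambda>\<eta>. \<eta> \<in> {0<..<Min {1/10, s0 - s1, 1 - s0}}) (at_right 0)"
      using s0 pos(1) by (intro eventually_at_right_real) auto
    ultimately show ?thesis
    proof eventually_elim
      case (elim \<eta>)
      then have \<eta>: "0 < \<eta>" "\<eta> < 1/10" "\<eta> < s0 - s1" "\<eta> < 1 - s0" by auto
      have sg: "sgn (\<sigma> * \<eta>) = \<sigma>" and ab: "\<bar>\<sigma> * \<eta>\<bar> = \<eta>" using \<sigma> \<eta> by auto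
      have "sgn (\<sigma> * \<eta>) * (u x - W (x \<bullet> x + \<sigma> * \<eta> * (1 - 2 * real N * (x \<bullet> x - s0)\<^sup>2))) \<le> m"
      proof (rule shifted_comparison[OF Nn u s0 pos])
        show "\<sigma> * \<eta> \<noteq> 0" using \<sigma> \<eta> by auto
        show "sgn (\<sigma> * \<eta>) * (u y - W (y \<bullet> y)) \<le> m" if "y \<bullet> y = s0" for y
          unfolding sg by (rule m(2)[OF that])
      qed (use \<eta> m(1) x elim in \<open>simp_all add: ab c_def\<close>)
      then show ?case by (simp add: sg c_def)
    qed
  qed
  ultimately show ?thesis by (intro tendsto_upperbound[where F="at_right 0"]) auto
qed

lemma ex_threshold: "\<exists>s1. 0 < s1 \<and> s1 < 1 \<and> (\<forall>s. s1 \<le> s \<longrightarrow> s < 1 \<longrightarrow> f (W s) > 0)"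
proof -
  have "eventually (\<lambda>t. a \<le> W t) (at_left 1)" using blowup by (simp add: filterlim_at_top)
  then obtain T where T: "T < 1" "\<And>t. T < t \<Longrightarrow> t < 1 \<Longrightarrow> a \<le> W t"
    unfolding eventually_at_left_field by blast
  define s1 where "s1 = max (1/2) ((T + 1) / 2)"
  have "0 < s1" "s1 < 1" "T < s1" using T(1) by (auto simp: s1_def less_max_iff_disj)
  then show ?thesis using T(2) f_pos by (intro exI[of _ s1]) auto
qed

text \<open>A nondecreasing function with a period is constant, which \<open>f_unbounded\<close>
  excludes.\<close>

lemma periodic_contradiction:
  assumes M: "M > 0" and eq: "\<And>t. t \<ge> t0 \<Longrightarrow> f (t + M) = f t"
  shows False
proof -
  have k: "f (t0 + real k * M) = f t0" for k
  proof (induction k)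
    case (Suc k)
    have "f (t0 + real (Suc k) * M) = f ((t0 + real k * M) + M)" by (simp add: algebra_simps)
    also have "\<dots> = f t0" using M Suc by (subst eq) auto
    finally show ?case .
  qed simp
  obtain t where t: "f t > f t0" using f_unbounded[of "f t0"] by blast
  obtain k :: nat where "t - t0 < real k * M" using reals_Archimedean3[OF M] by blast
  then have "f t \<le> f (t0 + real k * M)" by (intro monoD[OF mono_f]) auto
  then show False using t k by simp
qed

text \<open>A positive maximum \<open>M\<close> of \<open>\<sigma> (u - W)\<close> is attained on every sphere near the boundary: it cannot
  drop when moving outwards by the shift argument, nor when moving inwards by the maximum principle.
  There \<open>f (W + \<sigma> M) = f W\<close>, so \<open>f\<close> is constant near infinity.\<close>

lemma large_solution_le_profile:
  fixes u :: "real ^ 'n::finite \<Rightarrow> real"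
  assumes Nn: "N = CARD('n)" and u: "large_solution f (ball 0 1) u" and \<sigma>: "\<sigma> = 1 \<or> \<sigma> = -1"
    and x: "x \<in> ball 0 1"
  shows "\<sigma> * (u x - W (x \<bullet> x)) \<le> 0"
proof (rule ccontr)
  assume neg: "\<not> \<sigma> * (u x - W (x \<bullet> x)) \<le> 0"
  define v where "v x = \<sigma> * (u x - W (x \<bullet> x))" for x :: "real ^ 'n"
  have cu: "continuous_on (ball 0 1) u" and du: "distributional_laplacian (ball 0 1) u (\<lambda>x. f (u x))"
    using u by (auto simp: large_solution_def)
  note lap = has_laplacian_profile[OF Nn]
  have cW: "continuous_on (ball 0 1) (\<lambda>x :: real ^ 'n. W (x \<bullet> x))"
    using lap unfolding has_laplacian_def by (rule conjunct1)
  have cv: "continuous_on (ball 0 1) v"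
    unfolding v_def by (intro continuous_on_mult_left continuous_on_diff cu cW)
  \<comment> \<open>A maximum of v + \<epsilon> (y \<bullet> y) means that \<sigma> W - \<epsilon>
    (y \<bullet> y) touches \<sigma> u from above up to a constant, with Laplacian lowered by 2 N
    \<epsilon>. It is used with \<epsilon> > 0 to get a strict inequality and with \<epsilon> = 0 to
    get equality of f.\<close>
  have touch: "\<sigma> * f (u q) \<le> \<sigma> * f (W (q \<bullet> q)) - \<epsilon> * (2 * real N)"
    if X: "open X" "X \<subseteq> ball 0 1" "q \<in> X"
      and mx: "\<And>y. y \<in> X \<Longrightarrow> v y + \<epsilon> * (y \<bullet> y) \<le> v q + \<epsilon> * (q \<bullet> q)" for X q \<epsilon>
  proof -
    have lap': "has_laplacian X (\<lambda>x :: real ^ 'n. \<sigma> * W (x \<bullet> x) + (- \<epsilon>) * ((x - 0) \<bullet> (x - 0)))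
        (\<lambda>x. \<sigma> * f (W (x \<bullet> x)) + (- \<epsilon>) * (2 * real CARD('n)))"
      by (intro has_laplacian_add has_laplacian_cmult has_laplacian_square has_laplacian_subset[OF lap X(2)])
    have "\<sigma> * f (u q) \<le> \<sigma> * f (W (q \<bullet> q)) + (- \<epsilon>) * (2 * real CARD('n))"
    proof (rule distributional_laplacian_touching[OF _ _ distributional_laplacian_cmult[OF du] X(1,2) lap' X(3)])
      show "continuous_on (ball 0 1) (\<lambda>x. \<sigma> * u x)" by (intro continuous_on_mult_left cu)
      show "continuous_on (ball 0 1) (\<lambda>x. \<sigma> * f (u x))"
        by (intro continuous_on_mult_left continuous_on_compose2[OF cont_f cu]) auto
      fix y assume "y \<in> X"
      then show "\<sigma> * u y - (\<sigma> * W (y \<bullet> y) + - \<epsilon> * ((y - 0) \<bullet> (y - 0)))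
        \<le> \<sigma> * u q - (\<sigma> * W (q \<bullet> q) + - \<epsilon> * ((q - 0) \<bullet> (q - 0)))"
        using mx[of y] by (simp add: v_def right_diff_distrib)
    qed
    then show ?thesis by (simp add: Nn)
  qed
  have f_le: "\<sigma> * f (W (q \<bullet> q)) \<le> \<sigma> * f (u q)" if "v q > 0" for q
    using that \<sigma> monoD[OF mono_f, of "W (q \<bullet> q)" "u q"] monoD[OF mono_f, of "u q" "W (q \<bullet> q)"]
    by (auto simp: v_def)
  obtain s1 where s1: "0 < s1" "s1 < 1" "\<And>s. s1 \<le> s \<Longrightarrow> s < 1 \<Longrightarrow> f (W s) > 0" using ex_threshold by blast
  define smin where "smin = max (3/4) (max (1 - 1 / (4 * real N)) s1)"
  have smin: "smin < 1" "smin > 0" using s1 N by (auto simp: smin_def)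
  have sphere: "v y \<le> m"
    if s: "smin < s" "s < 1" and m: "m \<ge> 0" "\<And>y. y \<bullet> y = s \<Longrightarrow> v y \<le> m" and y: "s \<le> y \<bullet> y" "y \<bullet> y < 1" for s m y
    unfolding v_def
  proof (rule sphere_bound[OF Nn u \<sigma> _ _ _ _ s1(1,3) m(1) _ y])
    show "3/4 \<le> s" "s < 1" "s1 < s" using s by (auto simp: smin_def)
    have "1 - 1 / (4 * real N) \<le> s" using s by (simp add: smin_def)
    then show "4 * real N * (1 - s) \<le> 1" using N by (simp add: field_simps)
    show "\<sigma> * (u z - W (z \<bullet> z)) \<le> m" if "z \<bullet> z = s" for z using m(2)[OF that] by (simp add: v_def)
  qed
  have ball_sub: "{y :: real ^ 'n. c \<le> y \<bullet> y \<and> y \<bullet> y \<le> s} \<subseteq> ball 0 1" if "s < 1" for c s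
    using that by (auto simp: mem_ball_iff_inner_self simp del: mem_ball mem_ball_0)
  \<comment> \<open>By \<open>sphere\<close>, the maximum over the closed ball bounded by the sphere
    b0 also controls v outside, so a positive supremum of v is attained although v is not a priori
    bounded near the boundary.\<close>
  define b0 where "b0 = (smin + 1) / 2"
  have b0: "smin < b0" "b0 < 1" "b0 > 0" using smin by (auto simp: b0_def)
  obtain p where p: "p \<bullet> p \<le> b0" "\<And>y. y \<bullet> y \<le> b0 \<Longrightarrow> v y \<le> v p"
  proof -
    have "(0 :: real ^ 'n) \<in> {y. 0 \<le> y \<bullet> y \<and> y \<bullet> y \<le> b0}" using b0 by simp
    then have "{y :: real ^ 'n. 0 \<le> y \<bullet> y \<and> y \<bullet> y \<le> b0} \<noteq> {}" by blast
    from continuous_attains_sup[OF compact_inner_self_le this continuous_on_subset[OF cv ball_sub[OF b0(2)]]]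
    show ?thesis using that by auto
  qed
  define M where "M = v p"
  have le_max: "v y \<le> max 0 M" if "y \<bullet> y < 1" for y
  proof (cases "y \<bullet> y \<le> b0")
    case True
    then show ?thesis using p(2)[of y] by (simp add: M_def)
  next
    case False
    show ?thesis
    proof (rule sphere[OF b0(1,2)])
      show "v z \<le> max 0 M" if "z \<bullet> z = b0" for z using p(2)[of z] that by (simp add: M_def)
    qed (use False that in auto)
  qed
  have "x \<bullet> x < 1" using x by (rule inner_self_less_1)
  then have M: "M > 0" using neg le_max[of x] by (simp add: v_def[of x] max_def split: if_splits)
  have le_M: "v y \<le> M" if "y \<bullet> y < 1" for y using le_max[OF that] M by simp
  have attained: "\<exists>y. y \<bullet> y = s \<and> v y = M" if s: "smin < s" "s < 1" for s
  proof (rule ccontr)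
    assume none: "\<nexists>y. y \<bullet> y = s \<and> v y = M"
    have s_pos: "s > 0" using s smin by simp
    \<comment> \<open>Any coordinate axis meets the sphere; \<open>undefined\<close> just picks
      one.\<close>
    have "(sqrt s *\<^sub>R axis undefined 1 :: real ^ 'n) \<in> {y. s \<le> y \<bullet> y \<and> y \<bullet> y \<le> s}"
      using s_pos by (simp add: inner_axis_axis)
    then have "{y :: real ^ 'n. s \<le> y \<bullet> y \<and> y \<bullet> y \<le> s} \<noteq> {}" by blast
    from continuous_attains_sup[OF compact_inner_self_le this continuous_on_subset[OF cv ball_sub[OF s(2)]]]
    obtain y1 where y1: "y1 \<bullet> y1 = s" "\<And>y. y \<bullet> y = s \<Longrightarrow> v y \<le> v y1" by force
    define ms where "ms = max 0 (v y1)"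
    have ms: "0 \<le> ms" "ms < M" "\<And>y. y \<bullet> y = s \<Longrightarrow> v y \<le> ms"
    proof -
      have "v y1 \<noteq> M" using none y1(1) by blast
      then have "v y1 < M" using le_M[of y1] y1(1) s(2) by simp
      then show "ms < M" using M by (simp add: ms_def)
      show "v y \<le> ms" if "y \<bullet> y = s" for y using y1(2)[OF that] by (simp add: ms_def)
    qed (simp add: ms_def)
    have p_s: "p \<bullet> p \<le> s"
    proof (rule ccontr)
      assume "\<not> p \<bullet> p \<le> s"
      then have "v p \<le> ms" using p(1) b0(2) by (intro sphere[OF s ms(1,3)]) auto
      then show False using ms(2) by (simp add: M_def)
    qed
    \<comment> \<open>Half of the gap: the perturbation is at most \<epsilon> in the unit ball, so v
      q \<ge> M - \<epsilon> > ms and q cannot lie on the sphere s.\<close>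
    define \<epsilon> where "\<epsilon> = (M - ms) / 2"
    have "2 * \<epsilon> = M - ms" by (simp add: \<epsilon>_def)
    then have \<epsilon>: "\<epsilon> > 0" "\<epsilon> < M" "ms + \<epsilon> < M" using ms(1,2) by simp_all
    have cont: "continuous_on {y :: real ^ 'n. 0 \<le> y \<bullet> y \<and> y \<bullet> y \<le> s} (\<lambda>y. v y + \<epsilon> * (y \<bullet> y))"
      by (intro continuous_on_add continuous_on_subset[OF cv ball_sub[OF s(2)]] continuous_intros)
    have "p \<in> {y :: real ^ 'n. 0 \<le> y \<bullet> y \<and> y \<bullet> y \<le> s}" using p_s by simp
    then have "{y :: real ^ 'n. 0 \<le> y \<bullet> y \<and> y \<bullet> y \<le> s} \<noteq> {}" by blast
    from continuous_attains_sup[OF compact_inner_self_le this cont]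
    obtain q where q: "q \<bullet> q \<le> s" "\<And>y. y \<bullet> y \<le> s \<Longrightarrow> v y + \<epsilon> * (y \<bullet> y) \<le> v q + \<epsilon> * (q \<bullet> q)"
      by force
    have "0 \<le> \<epsilon> * (p \<bullet> p)" using \<epsilon>(1) by simp
    then have vq: "M \<le> v q + \<epsilon> * (q \<bullet> q)" using q(2)[OF p_s] by (simp add: M_def)
    have "\<epsilon> * (q \<bullet> q) \<le> \<epsilon> * 1" using \<epsilon>(1) q(1) s(2) by (intro mult_left_mono) auto
    then have vq': "M - \<epsilon> \<le> v q" using vq by simp
    have "q \<bullet> q \<noteq> s" using ms(3)[of q] vq' \<epsilon>(3) by auto
    then have qs: "q \<bullet> q < s" using q(1) by simp
    have "\<sigma> * f (u q) \<le> \<sigma> * f (W (q \<bullet> q)) - \<epsilon> * (2 * real N)"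
    proof (rule touch[of "{y. y \<bullet> y < s}"])
      show "open {y :: real ^ 'n. y \<bullet> y < s}" by (intro open_Collect_less continuous_intros)
      show "{y :: real ^ 'n. y \<bullet> y < s} \<subseteq> ball 0 1"
        using s(2) by (auto simp: mem_ball_iff_inner_self simp del: mem_ball mem_ball_0)
      show "q \<in> {y. y \<bullet> y < s}" using qs by simp
      show "v y + \<epsilon> * (y \<bullet> y) \<le> v q + \<epsilon> * (q \<bullet> q)" if "y \<in> {y. y \<bullet> y < s}" for y
        by (rule q(2)) (use that in auto)
    qed
    moreover have "\<sigma> * f (W (q \<bullet> q)) \<le> \<sigma> * f (u q)" using vq' \<epsilon>(2) by (intro f_le) auto
    moreover have "\<epsilon> * (2 * real N) > 0" using \<epsilon>(1) N by simp
    ultimately show False by linarith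
  qed
  have eqW: "f (W s + \<sigma> * M) = f (W s)" if s: "smin < s" "s < 1" for s
  proof -
    obtain y where y: "y \<bullet> y = s" "v y = M" using attained[OF s] by blast
    have "\<sigma> * f (u y) \<le> \<sigma> * f (W (y \<bullet> y)) - 0 * (2 * real N)"
    proof (rule touch[OF open_ball order_refl])
      show "y \<in> ball 0 1" using y(1) s(2) by (simp add: mem_ball_iff_inner_self del: mem_ball mem_ball_0)
      show "v z + 0 * (z \<bullet> z) \<le> v y + 0 * (y \<bullet> y)" if "z \<in> ball 0 1" for z
        using le_M[OF inner_self_less_1[OF that]] y(2) by simp
    qed
    then have "\<sigma> * f (u y) \<le> \<sigma> * f (W s)" by (simp add: y(1))
    moreover have "\<sigma> * f (W s) \<le> \<sigma> * f (u y)" using f_le[of y] y M by simp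
    ultimately have "\<sigma> * f (u y) = \<sigma> * f (W s)" by (rule antisym)
    moreover have "u y = W s + \<sigma> * M" using \<sigma> y by (auto simp: v_def)
    ultimately show ?thesis using \<sigma> by auto
  qed
  \<comment> \<open>W is continuous and blows up, so it takes every value from W b0 on.\<close>
  have eq: "f (t + \<sigma> * M) = f t" if t: "W b0 \<le> t" for t
  proof -
    have e1: "eventually (\<lambda>s. t \<le> W s) (at_left 1)" using blowup by (simp add: filterlim_at_top)
    have e2: "eventually (\<lambda>s. s \<in> {b0<..<1}) (at_left 1)" using b0(2) by (rule eventually_at_left_real)
    obtain r where r: "t \<le> W r" "b0 < r" "r < 1"
      using eventually_happens[OF eventually_conj[OF e1 e2]] by auto
    have "continuous_on {b0..r} W"
      by (rule continuous_on_subset[OF cont_W[OF r(3)]]) (use b0 in auto)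
    then obtain s where "b0 \<le> s" "s \<le> r" "W s = t"
      using IVT'[of W b0 t r] t r by auto
    then show ?thesis using eqW[of s] b0 r by auto
  qed
  show False
    using \<sigma>
  proof
    assume "\<sigma> = 1"
    then show False using eq by (intro periodic_contradiction[OF M, of "W b0"]) auto
  next
    assume "\<sigma> = -1"
    \<comment> \<open>A shift by -M becomes a period M when read from t + M.\<close>
    then have "f (t + M) = f t" if "t \<ge> W b0" for t using eq[of "t + M"] that M by simp
    then show False by (rule periodic_contradiction[OF M])
  qed
qed

lemma large_solution_unique:
  fixes u :: "real ^ 'n::finite \<Rightarrow> real"
  assumes "N = CARD('n)" "large_solution f (ball 0 1) u" "x \<in> ball 0 1"
  shows "u x = W (x \<bullet> x)"
  using large_solution_le_profile[OF assms(1,2) _ assms(3), of 1]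
    large_solution_le_profile[OF assms(1,2) _ assms(3), of "-1"] by simp

end

text \<open>Functions on the ball are represented by their extensional representatives, since a
  total function would be free to vary outside the ball.\<close>

theorem corollary1p3:
  fixes f F :: "real \<Rightarrow> real" and a :: real
  assumes "continuous_on UNIV f"
    and "f a > 0"
    and "\<And>t. t > a \<Longrightarrow> f t \<ge> 0"
    and "\<And>t. F t = (LBINT s=ereal a..ereal t. f s)"
    and "integral_converges_at_top (\<lambda>t. 1 / sqrt (F t))"
    and "mono f"
  shows "\<exists>!u :: real ^ 'n::finite \<Rightarrow> real.
           u \<in> extensional (ball 0 1) \<and> large_solution f (ball 0 1) u"
proof -
  interpret keller_osserman f F a
    by unfold_locales (use assms in \<open>auto simp: integral_converges_at_top_def\<close>)
  obtain W where W: "\<forall>S<1. continuous_on {0..S} W"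
    "\<forall>t\<in>{0..<1}. W t = W 0 + radial_integral CARD('n) (\<lambda>t. f (W t)) t"
    "\<forall>t\<in>{0..<1}. f (W t) \<ge> 0" "filterlim W at_top (at_left 1)"
    using ex_radial_large_solution[OF zero_less_card_finite] by blast
  interpret radial_profile f F a "CARD('n)" W
    by (unfold_locales; use W zero_less_card_finite in blast)
  define u :: "real ^ 'n \<Rightarrow> real" where "u = restrict (\<lambda>x. W (x \<bullet> x)) (ball 0 1)"
  show ?thesis
  proof (rule ex1I[of _ u])
    have "large_solution f (ball 0 1) u"
      by (rule large_solution_cong[OF open_ball _ large_solution_profile[OF refl]]) (simp add: u_def)
    then show "u \<in> extensional (ball 0 1) \<and> large_solution f (ball 0 1) u" by (simp add: u_def)
    fix w :: "real ^ 'n \<Rightarrow> real"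
    assume w: "w \<in> extensional (ball 0 1) \<and> large_solution f (ball 0 1) w"
    show "w = u"
    proof (rule extensionalityI[of _ "ball 0 1"])
      show "w x = u x" if "x \<in> ball 0 1" for x
        using large_solution_unique[OF refl _ that, of w] w that by (simp add: u_def)
    qed (use w in \<open>auto simp: u_def\<close>)
  qed
qed

end
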